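(* Fix $0<p<1$, and let $B>0$ and $K\ge 1$ be constants. Let $G(n,p)$ be an Erdős–Rényi random graph on $n$ vertices with edge density $p$. Then, for $n$ sufficiently large (depending on $B$, $K$, and $p$), the probability that the adjacency matrix $\mathbf{A}_n$ of $G(n,p)$ has an eigenvalue that is an algebraic number of degree at most $K$ is bounded above by $n^{-B}$.
   Context: The degree of an algebraic number is the degree of its minimal polynomial over $\mathbb{Q}$. $G(n,p)$ is the random simple graph on the vertex set $\{1,\ldots,n\}$ in which each edge $\{i,j\}$ ($i\ne j$) is present with probability $p$, independently of the other edges. Its adjacency matrix is the real symmetric $n\times n$ matrix whose $(i,j)$ entry is $1$ if $\{i,j\}$ is an edge and $0$ otherwise (zero diagonal). *)

theory Defs
  imports
    "Jordan_Normal_Form.Char_Poly"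
    "HOL-Probability.Product_PMF"
begin

text \<open>
  The minimal polynomial over the rationals: the monic rational polynomial of least degree
  that vanishes at the given number. It is unspecified at non-algebraic arguments.
\<close>

definition is_rat_min_poly :: "'a :: field_char_0 \<Rightarrow> rat poly \<Rightarrow> bool" where
  "is_rat_min_poly x q \<longleftrightarrow>
     lead_coeff q = 1 \<and> poly (map_poly of_rat q) x = 0 \<and>
     (\<forall>r. r \<noteq> 0 \<and> poly (map_poly of_rat r) x = 0 \<longrightarrow> degree q \<le> degree r)"

lemma is_rat_min_poly_unique:
  fixes x :: "'a :: field_char_0"
  assumes q: "is_rat_min_poly x q" and r: "is_rat_min_poly x r"
  shows "q = r"
proof (rule ccontr)
  assume neq: "q \<noteq> r"
  have nz: "q \<noteq> 0" "r \<noteq> 0" using q r by (auto simp: is_rat_min_poly_def)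
  have deg: "degree q = degree r"
    using q r nz unfolding is_rat_min_poly_def by (meson le_antisym)
  have hom: "map_poly of_rat (q - r) = (map_poly of_rat q - map_poly of_rat r :: 'a poly)"
    by (rule poly_eqI) (simp add: coeff_map_poly of_rat_diff)
  have "poly (map_poly of_rat (q - r)) x = 0"
    using q r by (simp add: hom is_rat_min_poly_def)
  then have le: "degree q \<le> degree (q - r)"
    using q neq unfolding is_rat_min_poly_def by simp
  have "degree (q - r) \<le> degree q" using degree_diff_le[of q "degree q" r] deg by simp
  with le have "degree (q - r) = degree q" by simp
  then have "lead_coeff (q - r) = lead_coeff q - lead_coeff r" using deg by simp
  also have "\<dots> = 0" using q r by (simp add: is_rat_min_poly_def)
  finally have "q - r = 0" by (simp only: leading_coeff_0_iff)
  then show False using neq by simp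
qed

lemma ex1_is_rat_min_poly:
  fixes x :: "'a :: field_char_0"
  assumes "algebraic x"
  shows "\<exists>!q. is_rat_min_poly x q"
proof -
  define S where "S = (\<lambda>q. q \<noteq> 0 \<and> poly (map_poly of_rat q :: 'a poly) x = 0)"
  obtain p where p: "\<And>i. coeff p i \<in> \<rat>" "p \<noteq> 0" "poly p x = 0"
    using assms unfolding algebraic_altdef by blast
  have "\<forall>i. \<exists>c. coeff p i = of_rat c" using p(1) by (auto elim: Rats_cases)
  then obtain f where f: "\<And>i. coeff p i = of_rat (f i)" by (auto dest: choice)
  define q0 where "q0 = Abs_poly f"
  have "\<forall>\<^sub>\<infinity>i. f i = 0"
    using MOST_coeff_eq_0[of p] by (simp add: f)
  then have coeff_q0: "coeff q0 i = f i" for i unfolding q0_def by (simp add: Abs_poly_inverse)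
  have "map_poly of_rat q0 = p" by (rule poly_eqI) (simp add: coeff_map_poly coeff_q0 f)
  then have "S q0" using p by (auto simp: S_def)
  then obtain m where m: "S m" "\<And>r. S r \<Longrightarrow> degree m \<le> degree r"
    using ex_has_least_nat[of S q0 degree] by blast
  define q where "q = Polynomial.smult (inverse (lead_coeff m)) m"
  have "map_poly of_rat q = Polynomial.smult (of_rat (inverse (lead_coeff m))) (map_poly of_rat m :: 'a poly)"
    unfolding q_def by (rule poly_eqI) (simp add: coeff_map_poly of_rat_mult)
  then have "is_rat_min_poly x q"
    using m by (auto simp: is_rat_min_poly_def S_def q_def)
  then show ?thesis using is_rat_min_poly_unique by blast
qed

definition rat_min_poly :: "'a :: field_char_0 \<Rightarrow> rat poly" where
  "rat_min_poly x = (THE q. is_rat_min_poly x q)"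

definition algebraic_degree :: "'a :: field_char_0 \<Rightarrow> nat" where
  "algebraic_degree x = degree (rat_min_poly x)"

text \<open>
  A simple graph on the vertex set \<open>{1..n}\<close> is given by its edge set, a subset of the
  two-element subsets of \<open>{1..n}\<close>.
\<close>

definition possible_edges :: "nat \<Rightarrow> nat set set" where
  "possible_edges n = {{i, j} | i j. i \<in> {1..n} \<and> j \<in> {1..n} \<and> i \<noteq> j}"

definition erdos_renyi :: "nat \<Rightarrow> real \<Rightarrow> nat set set pmf" where
  "erdos_renyi n p =
     map_pmf (\<lambda>present. {e \<in> possible_edges n. present e})
       (Pi_pmf (possible_edges n) False (\<lambda>_. bernoulli_pmf p))"

text \<open>Matrix indices start at 0, so row and column \<open>i\<close> belong to the vertex \<open>Suc i\<close>.\<close>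

definition adjacency_matrix :: "nat \<Rightarrow> nat set set \<Rightarrow> real mat" where
  "adjacency_matrix n E = Matrix.mat n n (\<lambda>(i, j). if {Suc i, Suc j} \<in> E then 1 else 0)"

end

theory Submission
  imports Defs
    "HOL-Number_Theory.Cong"
    "HOL-Computational_Algebra.Polynomial_Factorial"
    "HOL-Real_Asymp.Real_Asymp"
begin

text \<open>
  An eigenvalue of degree at most \<open>K\<close> is a root of a monic integer factor \<open>g\<close> of the characteristic
  polynomial, of degree at most \<open>K\<close> (Gauss). All roots of \<open>g\<close> are eigenvalues and hence bounded by \<open>n\<close>,
  so there are only polynomially many candidates for \<open>g\<close>, and it suffices to show that a fixed \<open>g\<close>
  divides the characteristic polynomial with probability at most \<open>n\<close> to the power \<open>- B\<close>, for arbitrarily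
  large \<open>B\<close>.

  The problem is moved into a finite prime field. A count of prime powers dividing the values of \<open>g\<close>
  yields an integer \<open>a\<close> and a prime \<open>q\<close> dividing \<open>g(a)\<close> which is larger than a prescribed power of \<open>n\<close>, but
  whose logarithm is \<open>O(ln\<^sup>2 n)\<close> (\<open>exists_large_prime_divisor\<close>). If \<open>g\<close> divides the characteristic
  polynomial of the adjacency matrix \<open>A\<close>, then \<open>q\<close> divides \<open>det (a I - A)\<close>, so \<open>A - a I\<close> has a nonzero
  kernel vector modulo \<open>q\<close> (\<open>singular_mod_if_dvd_det\<close>).

  That \<open>A - a I\<close> is rarely singular modulo \<open>q\<close> is shown by inserting the vertices one at a time; write \<open>x\<close>
  for the random row of the new vertex and \<open>M\<close> for the matrix before the insertion. If \<open>M w = 0\<close> with \<open>w\<close>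
  nonzero, the kernel shrinks by a factor \<open>q\<close> unless \<open>x \<bullet> w = 0\<close> (\<open>card_Ker_ext_le\<close>). If \<open>M\<close> is nonsingular,
  the new matrix is singular only if a quadratic form in \<open>x\<close> takes one prescribed value; resampling a few
  entries of \<open>x\<close> and applying the Cauchy-Schwarz inequality turns this into a linear equation in the
  remaining entries, whose coefficients form a solution of \<open>M w = u\<close> with a fixed nonzero \<open>u\<close>
  (\<open>prob_new_singular\<close>). In both cases it remains to know that \<open>w\<close> is unstructured, so that
  \<open>x \<bullet> w\<close> takes no value modulo \<open>q\<close> with probability above \<open>26 / q\<close>.

  Structured solutions are excluded by a union bound. The quantity \<open>conc c q l w\<close> is a Fourier bound for
  the point probabilities of \<open>x \<bullet> w\<close>, where \<open>c = p (1 - p)\<close> and only the first \<open>l\<close> coordinates of \<open>w\<close> count.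
  Vertex exposure gives \<open>P (M w = u) \<le> (\<Prod>j<l. conc c q j w)\<close>, and this product is summed over all structured \<open>w\<close>
  one coordinate at a time, weighted by a high power of \<open>conc c' q l w\<close> with \<open>c' = c / k\<^sup>2\<close>. Each coordinate
  then contributes a factor below 1 once \<open>w\<close> has of the order of \<open>ln q\<close> nonzero coordinates
  (\<open>potential_step\<close>): by Parseval only about \<open>1 / conc c'\<close> values of the new coordinate fail to decrease
  \<open>conc c'\<close> by a constant factor, and by the Cauchy-Davenport inequality, applied to sets of frequencies,
  \<open>conc c\<close> is smaller than \<open>conc c'\<close> by a factor of order \<open>k\<close> (\<open>sum_exp_gain\<close>). Sparse vectors \<open>w\<close> are so few
  that the exponentially small bound of \<open>prob_solves_nonzero\<close> suffices for them.
\<close>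

abbreviation prob :: "'a pmf \<Rightarrow> 'a set \<Rightarrow> real" where
  "prob M S \<equiv> measure_pmf.prob M S"

abbreviation cosq :: "int \<Rightarrow> int \<Rightarrow> real" where
  "cosq q s \<equiv> cos (2 * pi * real_of_int s / real_of_int q)"

abbreviation cisq :: "int \<Rightarrow> int \<Rightarrow> complex" where
  "cisq q s \<equiv> cis (2 * pi * real_of_int s / real_of_int q)"

section \<open>Sumsets modulo a prime\<close>

definition modsum :: "int \<Rightarrow> int set \<Rightarrow> int set \<Rightarrow> int set" where
  "modsum q A B = (\<lambda>(a, b). (a + b) mod q) ` (A \<times> B)"

lemma shift_inj_on:
  fixes q e :: int
  assumes "B \<subseteq> {0..<q}"
  shows "inj_on (\<lambda>b. (b + e) mod q) B"
proof (rule inj_onI)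
  fix x y assume xy: "x \<in> B" "y \<in> B" "(x + e) mod q = (y + e) mod q"
  then have "[x + e = y + e] (mod q)" by (simp add: cong_def)
  then have "[x = y] (mod q)" by (simp add: cong_add_rcancel)
  moreover have "0 \<le> x" "x < q" "0 \<le> y" "y < q" using xy assms by auto
  ultimately show "x = y" by (simp add: cong_def)
qed

text \<open>
  Since \<open>q\<close> is prime, the translates by multiples of \<open>d\<close> exhaust all residues. Primality enters the
  Cauchy-Davenport inequality through this lemma alone.
\<close>

lemma shift_closed_imp_all:
  fixes q d :: int
  assumes q: "prime q" and A: "A \<subseteq> {0..<q}" "A \<noteq> {}" and d: "\<not> q dvd d"
    and closed: "\<And>a. a \<in> A \<Longrightarrow> (a + d) mod q \<in> A"
  shows "A = {0..<q}"
proof -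
  have q0: "q > 0" using q prime_gt_0_int by blast
  obtain a where a: "a \<in> A" using A by auto
  have it: "(a + int n * d) mod q \<in> A" for n
  proof (induction n)
    case 0 then show ?case using a A by (auto simp: mod_pos_pos_trivial)
  next
    case (Suc n)
    from closed[OF Suc] have "((a + int n * d) mod q + d) mod q \<in> A" .
    then show ?case by (simp add: mod_simps algebra_simps)
  qed
  have "coprime d q" using q d prime_imp_coprime coprime_commute by metis
  then obtain e where e: "[d * e = 1] (mod q)" using cong_solve_coprime_int by blast
  have "x \<in> A" if x: "x \<in> {0..<q}" for x
  proof -
    define n where "n = nat (((x - a) * e) mod q)"
    have n: "int n = ((x - a) * e) mod q" unfolding n_def using q0 by simp
    have "[a + int n * d = a + ((x - a) * e) * d] (mod q)"
      unfolding n by (intro cong_add cong_mult) (auto simp: cong_def)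
    also have "a + ((x - a) * e) * d = a + (x - a) * (d * e)" by (simp add: algebra_simps)
    also have "[a + (x - a) * (d * e) = a + (x - a) * 1] (mod q)"
      by (intro cong_add cong_mult e) auto
    finally have "(a + int n * d) mod q = x mod q" by (simp add: cong_def)
    then show "x \<in> A" using it[of n] x by (simp add: mod_pos_pos_trivial)
  qed
  then show ?thesis using A by auto
qed

text \<open>
  The e-transform replaces \<open>(A, B)\<close> by \<open>(A \<union> (B + e), B \<inter> (A - e))\<close>. This keeps the sum of the two
  cardinalities and does not enlarge the sumset. As long as \<open>B\<close> has two elements and \<open>A\<close> is not
  everything, some \<open>e\<close> makes the second set smaller, which reduces the claim to a singleton \<open>B\<close>.
\<close>

theorem cauchy_davenport:
  fixes q :: int
  assumes q: "prime q"
  shows "\<lbrakk>A \<subseteq> {0..<q}; B \<subseteq> {0..<q}; A \<noteq> {}; B \<noteq> {}\<rbrakk>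
         \<Longrightarrow> min (nat q) (card A + card B - 1) \<le> card (modsum q A B)"
proof (induction "card B" arbitrary: A B rule: less_induct)
  case less
  have q0: "q > 0" using q prime_gt_0_int by blast
  have fin: "finite A" "finite B" using less.prems finite_subset by blast+
  then have finS: "finite (modsum q A B)" unfolding modsum_def by auto
  obtain b0 where b0: "b0 \<in> B" using less.prems by auto
  have "(\<lambda>a. (a + b0) mod q) ` A \<subseteq> modsum q A B" unfolding modsum_def using b0 by auto
  then have cA: "card A \<le> card (modsum q A B)"
    using card_mono[OF finS] card_image[OF shift_inj_on[OF less.prems(1), of b0]] by metis
  show ?case
  proof (cases "card B = 1 \<or> A = {0..<q}")
    case True
    then show ?thesis using cA by auto
  next
    case False
    then have "B \<noteq> {b0}" by auto
    then obtain b1 where b1: "b1 \<in> B" "b1 \<noteq> b0" using b0 by auto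
    have nd: "\<not> q dvd (b1 - b0)"
    proof
      assume "q dvd (b1 - b0)"
      then have "[b1 = b0] (mod q)" by (simp add: cong_iff_dvd_diff)
      then show False using b0 b1 less.prems(2) by (auto simp: cong_def subset_iff)
    qed
    obtain a where a: "a \<in> A" "(a + (b1 - b0)) mod q \<notin> A"
      using shift_closed_imp_all[OF q less.prems(1,3) nd] False by blast
    define e where "e = a - b0"
    \<comment> \<open>With this \<open>e\<close>, \<open>b0\<close> stays in the second set (as \<open>b0 + e = a \<in> A\<close>) and \<open>b1\<close> leaves it.\<close>
    define B' where "B' = {b \<in> B. (b + e) mod q \<in> A}"
    define A' where "A' = A \<union> (\<lambda>b. (b + e) mod q) ` (B - B')"
    have b0': "b0 \<in> B'" using b0 a less.prems(1) by (auto simp: B'_def e_def)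
    have b1': "b1 \<notin> B'" using a(2) by (simp add: B'_def e_def algebra_simps)
    have lt: "card B' < card B"
      using b1 b1' fin by (intro psubset_card_mono) (auto simp: B'_def)
    have disj: "A \<inter> (\<lambda>b. (b + e) mod q) ` (B - B') = {}" by (auto simp: B'_def)
    have "card A' = card A + card (B - B')"
      unfolding A'_def using fin disj less.prems(2)
      by (subst card_Un_disjoint) (auto intro!: card_image shift_inj_on)
    moreover have "card (B - B') = card B - card B'"
      using fin by (intro card_Diff_subset) (auto simp: B'_def)
    ultimately have sum: "card A' + card B' = card A + card B" using lt by simp
    have sub: "modsum q A' B' \<subseteq> modsum q A B"
    proof
      fix x assume "x \<in> modsum q A' B'"
      then obtain a' b' where x: "x = (a' + b') mod q" "a' \<in> A'" "b' \<in> B'"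
        by (auto simp: modsum_def)
      show "x \<in> modsum q A B"
      proof (cases "a' \<in> A")
        case True then show ?thesis using x by (auto simp: modsum_def B'_def)
      next
        case False
        then obtain b where b: "b \<in> B" "a' = (b + e) mod q" using x by (auto simp: A'_def)
        have "x = ((b' + e) mod q + b) mod q" using x b by (simp add: mod_simps algebra_simps)
        then show ?thesis using x(3) b by (auto simp: modsum_def B'_def)
      qed
    qed
    have "A' \<subseteq> {0..<q}" using less.prems(1) q0 by (auto simp: A'_def)
    moreover have "B' \<subseteq> {0..<q}" using less.prems(2) by (auto simp: B'_def)
    moreover have "A' \<noteq> {}" "B' \<noteq> {}" using less.prems(3) b0' by (auto simp: A'_def)
    ultimately have "min (nat q) (card A' + card B' - 1) \<le> card (modsum q A' B')"
      using less.hyps[OF lt] by blast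
    also have "\<dots> \<le> card (modsum q A B)" by (rule card_mono[OF finS sub])
    finally show ?thesis using sum by simp
  qed
qed

fun modsum_iter :: "int \<Rightarrow> nat \<Rightarrow> int set \<Rightarrow> int set" where
  "modsum_iter q 0 T = {0}"
| "modsum_iter q (Suc k) T = modsum q (modsum_iter q k T) T"

lemma modsum_iter_subset: "q > 0 \<Longrightarrow> modsum_iter q k T \<subseteq> {0..<q}"
  by (cases k) (auto simp: modsum_def)

lemma card_modsum_iter:
  fixes q :: int
  assumes q: "prime q" and T: "T \<subseteq> {0..<q}" "T \<noteq> {}"
  shows "modsum_iter q k T \<noteq> {} \<and> min (nat q) (k * (card T - 1) + 1) \<le> card (modsum_iter q k T)"
proof (induction k)
  case 0
  have "q > 0" using q prime_gt_0_int by blast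
  then show ?case by simp
next
  case (Suc k)
  have q0: "q > 0" using q prime_gt_0_int by blast
  have cT: "card T \<ge> 1" using T finite_subset[of T "{0..<q}"] by (simp add: Suc_le_eq card_gt_0_iff)
  have "min (nat q) (card (modsum_iter q k T) + card T - 1) \<le> card (modsum_iter q (Suc k) T)"
    using cauchy_davenport[OF q modsum_iter_subset[OF q0] T(1) _ T(2)] Suc by simp
  moreover have "modsum_iter q (Suc k) T \<noteq> {}" using Suc T by (auto simp: modsum_def)
  ultimately show ?case using Suc cT by (auto simp: min_def algebra_simps split: if_splits)
qed

section \<open>Exponential sums and level sets of frequencies\<close>

lemma sum_int_as_nat: "q \<ge> 0 \<Longrightarrow> (\<Sum>t\<in>{0..<q::int}. f t) = (\<Sum>n<nat q. f (int n))"
  by (rule sum.reindex_bij_witness[of _ int nat]) auto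

lemma cis_multiple_of_2pi: "q dvd a \<Longrightarrow> q \<noteq> 0 \<Longrightarrow> cisq q a = 1"
proof -
  assume "q dvd a" "q \<noteq> 0"
  then obtain k where "a = q * k" by auto
  then have "2 * pi * real_of_int a / real_of_int q = 2 * pi * real_of_int k" using \<open>q \<noteq> 0\<close> by simp
  then show ?thesis by (simp only: complex_eq_iff cis.simps cos_int_2pin sin_int_2pin) simp
qed

lemma cis_eq_1_imp_dvd:
  assumes "cisq q a = 1" "q \<noteq> 0"
  shows "q dvd a"
proof -
  have "exp (\<i> * complex_of_real (2 * pi * real_of_int a / real_of_int q)) = 1"
    using assms(1) by (simp add: cis_conv_exp)
  then obtain n :: int where "2 * pi * real_of_int a / real_of_int q = real_of_int (2 * n) * pi"
    unfolding exp_eq_1 by auto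
  then have "real_of_int a = real_of_int n * real_of_int q" using assms(2) by (simp add: field_simps)
  then have "a = n * q" by (metis of_int_eq_iff of_int_mult)
  then show ?thesis by simp
qed

lemma sum_cis:
  fixes q a :: int
  assumes q: "q > 0"
  shows "(\<Sum>t\<in>{0..<q}. cisq q (t * a)) = (if q dvd a then of_int q else 0)"
proof -
  define z where "z = cisq q a"
  have zn: "cisq q (int n * a) = z ^ n" for n
    unfolding z_def Complex.DeMoivre by (rule arg_cong[of _ _ cis]) simp
  have "(\<Sum>t\<in>{0..<q}. cisq q (t * a)) = (\<Sum>n<nat q. z ^ n)"
    using q by (simp only: sum_int_as_nat zn order.strict_implies_order)
  also have "\<dots> = (if q dvd a then of_int q else 0)"
  proof (cases "q dvd a")
    case True
    then have "z = 1" unfolding z_def using cis_multiple_of_2pi q by simp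
    then show ?thesis using True q by simp
  next
    case False
    then have z1: "z \<noteq> 1" unfolding z_def using cis_eq_1_imp_dvd q by auto
    have "z ^ nat q = 1"
      unfolding zn[symmetric] using q by (intro cis_multiple_of_2pi) auto
    then show ?thesis using False z1 by (simp add: geometric_sum)
  qed
  finally show ?thesis .
qed

lemma sum_cos:
  fixes q a :: int
  assumes q: "q > 0"
  shows "(\<Sum>t\<in>{0..<q}. cosq q (t * a)) = (if q dvd a then of_int q else 0)"
  using arg_cong[OF sum_cis[OF q, of a], of Re] by (simp add: if_distrib cong: if_cong)

text \<open>
  Twice this value is the squared Euclidean distance between the vector of the characters
  \<open>cisq q (t * v i)\<close>, \<open>i < l\<close>, and the all-ones vector. The level sets in \<open>t\<close> therefore behave like balls.
\<close>

definition defect :: "int \<Rightarrow> nat \<Rightarrow> (nat \<Rightarrow> int) \<Rightarrow> int \<Rightarrow> real" where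
  "defect q l v t = (\<Sum>i<l. 1 - cosq q (t * v i))"

text \<open>
  For \<open>c = p (1 - p)\<close> this is the Fourier (Halasz) bound for the largest point probability modulo \<open>q\<close> of a
  sum of the \<open>v i\<close>, \<open>i < l\<close>, over a random subset containing each index with probability \<open>p\<close>. It lies
  between \<open>1 / q\<close> and \<open>1\<close>, and large values mean that \<open>v\<close> has additive structure.
\<close>

definition conc :: "real \<Rightarrow> int \<Rightarrow> nat \<Rightarrow> (nat \<Rightarrow> int) \<Rightarrow> real" where
  "conc c q l v = (\<Sum>t\<in>{0..<q}. exp (- c * defect q l v t)) / real_of_int q"

lemma defect_nonneg: "defect q l v t \<ge> 0"
  unfolding defect_def by (intro sum_nonneg) (simp add: cos_le_one)

lemma defect_0 [simp]: "defect q l v 0 = 0"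
  by (simp add: defect_def)

text \<open>
  Squared triangle inequality for the distance \<open>2 * \<bar>sin (x / 2)\<bar>\<close> between \<open>cis x\<close> and 1, in the weighted form
  \<open>(a + b)\<^sup>2 \<le> (1 + 1 / j) * a\<^sup>2 + (1 + j) * b\<^sup>2\<close>.
\<close>

lemma one_minus_cos_add_le:
  fixes x y :: real
  assumes "j > 0"
  shows "1 - cos (x + y) \<le> (1 + 1 / j) * (1 - cos x) + (1 + j) * (1 - cos y)"
proof -
  define a where "a = \<bar>sin (x / 2)\<bar>"
  define b where "b = \<bar>sin (y / 2)\<bar>"
  have h: "1 - cos z = 2 * (sin (z / 2))\<^sup>2" for z :: real
    using cos_double_sin[of "z / 2"] by simp
  have "\<bar>sin ((x + y) / 2)\<bar> = \<bar>sin (x / 2) * cos (y / 2) + cos (x / 2) * sin (y / 2)\<bar>"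
    by (simp add: add_divide_distrib sin_add)
  also have "\<dots> \<le> \<bar>sin (x / 2)\<bar> * \<bar>cos (y / 2)\<bar> + \<bar>cos (x / 2)\<bar> * \<bar>sin (y / 2)\<bar>"
    by (metis abs_triangle_ineq abs_mult)
  also have "\<dots> \<le> a * 1 + 1 * b"
    unfolding a_def b_def by (intro add_mono mult_mono) auto
  finally have "\<bar>sin ((x + y) / 2)\<bar> \<le> a + b" by simp
  then have "(sin ((x + y) / 2))\<^sup>2 \<le> (a + b)\<^sup>2"
    by (metis abs_ge_zero power2_abs power_mono)
  also have "\<dots> \<le> (1 + 1 / j) * a\<^sup>2 + (1 + j) * b\<^sup>2"
  proof -
    have "0 \<le> (a - j * b)\<^sup>2 / j" using assms by simp
    also have "\<dots> = a\<^sup>2 / j - 2 * a * b + j * b\<^sup>2"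
      using assms by (simp add: power2_eq_square field_simps)
    finally show ?thesis by (simp add: power2_eq_square algebra_simps)
  qed
  finally show ?thesis unfolding h a_def b_def by simp
qed

lemma cos_mod:
  fixes q t a :: int assumes "q > 0"
  shows "cosq q ((t mod q) * a) = cosq q (t * a)"
proof -
  have t: "t = t mod q + q * (t div q)" by simp
  have "real_of_int (t * a) = real_of_int ((t mod q) * a) + real_of_int q * real_of_int (t div q * a)"
    by (subst t) (simp only: of_int_mult of_int_add distrib_right mult.assoc)
  then have "2 * pi * real_of_int (t * a) / real_of_int q
        = 2 * pi * real_of_int ((t mod q) * a) / real_of_int q + 2 * pi * real_of_int (t div q * a)"
    using assms by (simp only: ring_distribs add_divide_distrib) simp
  then show ?thesis by (simp only: cos_add cos_int_2pin sin_int_2pin mult_1_right mult_zero_right diff_0_right)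
qed

lemma defect_mod: "q > 0 \<Longrightarrow> defect q l v (t mod q) = defect q l v t"
  unfolding defect_def by (simp add: cos_mod del: of_int_mult)

lemma defect_add_le:
  assumes "j > 0"
  shows "defect q l v (s + t) \<le> (1 + 1 / j) * defect q l v s + (1 + j) * defect q l v t"
proof -
  have "defect q l v (s + t) \<le> (\<Sum>i<l. (1 + 1 / j) * (1 - cosq q (s * v i))
          + (1 + j) * (1 - cosq q (t * v i)))"
    unfolding defect_def
  proof (rule sum_mono)
    fix i
    have "2 * pi * real_of_int ((s + t) * v i) / real_of_int q
        = 2 * pi * real_of_int (s * v i) / real_of_int q + 2 * pi * real_of_int (t * v i) / real_of_int q"
      by (simp add: algebra_simps add_divide_distrib)
    then show "1 - cosq q ((s + t) * v i)
      \<le> (1 + 1 / j) * (1 - cosq q (s * v i))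
          + (1 + j) * (1 - cosq q (t * v i))"
      using one_minus_cos_add_le[OF assms] by presburger
  qed
  then show ?thesis unfolding defect_def by (simp only: sum.distrib sum_distrib_left)
qed

text \<open>
  The weight \<open>j = k\<close> in the triangle inequality makes \<open>(1 + 1 / k) * k\<^sup>2 + (1 + k)\<close> equal to \<open>(k + 1)\<^sup>2\<close>, so
  the induction loses nothing.
\<close>

lemma defect_modsum_iter_le:
  assumes q: "q > 0" and T: "\<And>t. t \<in> T \<Longrightarrow> defect q l v t \<le> y"
  shows "t \<in> modsum_iter q k T \<Longrightarrow> defect q l v t \<le> (real k)\<^sup>2 * y"
proof (induction k arbitrary: t)
  case 0
  then show ?case by simp
next
  case (Suc k)
  then obtain a b where ab: "t = (a + b) mod q" "a \<in> modsum_iter q k T" "b \<in> T"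
    by (auto simp: modsum_def)
  show ?case
  proof (cases "k = 0")
    case True
    then show ?thesis using ab T q by (simp add: defect_mod)
  next
    case False
    have "defect q l v t \<le> (1 + 1 / real k) * defect q l v a + (1 + real k) * defect q l v b"
      using ab(1) defect_add_le[of "real k"] False q by (simp add: defect_mod)
    also have "\<dots> \<le> (1 + 1 / real k) * ((real k)\<^sup>2 * y) + (1 + real k) * y"
      using Suc.IH[OF ab(2)] T[OF ab(3)] by (intro add_mono mult_left_mono) auto
    also have "\<dots> = (real (Suc k))\<^sup>2 * y"
      using False by (simp add: field_simps power2_eq_square)
    finally show ?thesis .
  qed
qed

text \<open>
  The \<open>k\<close>-fold sumset of a level set lies in the level set at \<open>k\<^sup>2 * y\<close>, and Cauchy-Davenport makes it
  about \<open>k\<close> times as large.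
\<close>

lemma level_set_growth:
  fixes q :: int and k :: nat
  assumes q: "prime q" and y: "y \<ge> 0"
    and notall: "card {t\<in>{0..<q}. defect q l v t \<le> (real k)\<^sup>2 * y} < nat q"
  shows "k * (card {t\<in>{0..<q}. defect q l v t \<le> y} - 1) + 1 \<le> card {t\<in>{0..<q}. defect q l v t \<le> (real k)\<^sup>2 * y}"
proof -
  have q0: "q > 0" using q prime_gt_0_int by blast
  let ?T = "{t\<in>{0..<q}. defect q l v t \<le> y}"
  have "0 \<in> ?T" using q0 y by simp
  then have "min (nat q) (k * (card ?T - 1) + 1) \<le> card (modsum_iter q k ?T)"
    using card_modsum_iter[OF q, of ?T k] by blast
  also have "\<dots> \<le> card {t\<in>{0..<q}. defect q l v t \<le> (real k)\<^sup>2 * y}"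
    using defect_modsum_iter_le[OF q0, of ?T l v y _ k] modsum_iter_subset[OF q0, of k ?T]
    by (intro card_mono finite_subset[of "{t\<in>{0..<q}. defect q l v t \<le> (real k)\<^sup>2 * y}" "{0..<q}"]) auto
  finally show ?thesis using notall by simp
qed

definition supp :: "int \<Rightarrow> nat \<Rightarrow> (nat \<Rightarrow> int) \<Rightarrow> nat set" where
  "supp q l v = {i. i < l \<and> \<not> q dvd v i}"

lemma finite_supp [simp]: "finite (supp q l v)"
  by (simp add: supp_def)

lemma sum_defect:
  assumes q: "q > 0"
  shows "(\<Sum>t\<in>{0..<q}. defect q l v t) = real_of_int q * card (supp q l v)"
proof -
  have "(\<Sum>t\<in>{0..<q}. defect q l v t)
      = (\<Sum>i<l. \<Sum>t\<in>{0..<q}. 1 - cosq q (t * v i))"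
    unfolding defect_def by (rule sum.swap)
  also have "\<dots> = (\<Sum>i<l. if q dvd v i then 0 else real_of_int q)"
  proof (rule sum.cong[OF refl])
    fix i
    show "(\<Sum>t\<in>{0..<q}. 1 - cosq q (t * v i)) = (if q dvd v i then 0 else real_of_int q)"
      unfolding sum_subtractf sum_cos[OF q] using q by simp
  qed
  also have "\<dots> = (\<Sum>i\<in>supp q l v. real_of_int q)"
    unfolding supp_def by (rule sum.mono_neutral_cong_right) auto
  finally show ?thesis by simp
qed

text \<open>
  The average of the defect over all frequencies is the number of nonzero coordinates. This is what
  keeps the level sets from exhausting all frequencies, where their growth would stop.
\<close>

lemma level_set_not_all:
  fixes y :: real
  assumes q: "q > 0" and y: "y < card (supp q l v)"
  shows "card {t\<in>{0..<q}. defect q l v t \<le> y} < nat q"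
proof (rule ccontr)
  assume "\<not> ?thesis"
  then have "card {0..<q} \<le> card {t\<in>{0..<q}. defect q l v t \<le> y}" by simp
  then have "{t\<in>{0..<q}. defect q l v t \<le> y} = {0..<q}"
    by (intro card_seteq) auto
  then have "(\<Sum>t\<in>{0..<q}. defect q l v t) \<le> (\<Sum>t\<in>{0..<q}. y)"
    by (intro sum_mono) blast
  then have "real_of_int q * card (supp q l v) \<le> real_of_int q * y"
    unfolding sum_defect[OF q] using q by simp
  then show False using y q by simp
qed

text \<open>
  Both sides integrate \<open>exp (- c * y)\<close> over the region \<open>Z t \<le> y\<close>, summed over \<open>t\<close>.
\<close>

lemma layer_cake:
  fixes Z :: "'a \<Rightarrow> real"
  assumes "finite T" "\<And>t. t \<in> T \<Longrightarrow> Z t \<ge> 0" "c > 0"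
  shows "((\<lambda>y. exp (- c * y) * card {t\<in>T. Z t \<le> y}) has_integral (\<Sum>t\<in>T. exp (- c * Z t)) / c) {0..}"
proof -
  have "((\<lambda>y. \<Sum>t\<in>T. if y \<in> {Z t..} then exp (- c * y) else 0) has_integral (\<Sum>t\<in>T. exp (- c * Z t) / c)) {0..}"
  proof (rule has_integral_sum[OF assms(1)])
    fix t assume "t \<in> T"
    then have "{Z t..} \<subseteq> {0..}" using assms(2) by auto
    then show "((\<lambda>y. if y \<in> {Z t..} then exp (- c * y) else 0) has_integral exp (- c * Z t) / c) {0..}"
      using has_integral_exp_minus_to_infinity[OF assms(3)] by (simp only: has_integral_restrict)
  qed
  moreover have "(\<Sum>t\<in>T. if y \<in> {Z t..} then exp (- c * y) else 0) = exp (- c * y) * card {t\<in>T. Z t \<le> y}" for y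
    using assms(1) by (simp add: sum.If_cases Int_def mult.commute)
  ultimately show ?thesis by (simp add: sum_divide_distrib)
qed

text \<open>
  In the layer-cake formula for \<open>c\<close>, replacing the level \<open>y\<close> by \<open>k\<^sup>2 * y\<close> amounts to replacing \<open>c\<close> by
  \<open>c / k\<^sup>2\<close>. The additive constant 1 in the hypothesis integrates to 1, and above \<open>y0\<close> the trivial bound
  \<open>card T\<close> is used.
\<close>

lemma layer_cake_compare:
  fixes Z :: "'a \<Rightarrow> real"
  assumes T: "finite T" "\<And>t. t \<in> T \<Longrightarrow> Z t \<ge> 0" and c: "c > 0" and k: "k > 0" and y0: "y0 \<ge> 0"
    and N: "\<And>y. 0 \<le> y \<Longrightarrow> y < y0 \<Longrightarrow> card {t\<in>T. Z t \<le> y} \<le> card {t\<in>T. Z t \<le> k\<^sup>2 * y} / k + 1"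
  shows "(\<Sum>t\<in>T. exp (- c * Z t)) \<le> (\<Sum>t\<in>T. exp (- (c / k\<^sup>2) * Z t)) / k + 1 + card T * exp (- c * y0)"
proof -
  let ?S = "\<Sum>t\<in>T. exp (- c * Z t)" and ?S' = "\<Sum>t\<in>T. exp (- (c / k\<^sup>2) * Z t)"
  have I1: "((\<lambda>y. exp (- c * y) * card {t\<in>T. Z t \<le> y}) has_integral ?S / c) {0..}"
    by (rule layer_cake[OF T c])
  have "((\<lambda>y. exp (- c * y) * card {t\<in>T. Z t / k\<^sup>2 \<le> y}) has_integral
           (\<Sum>t\<in>T. exp (- c * (Z t / k\<^sup>2))) / c) {0..}"
    using T by (intro layer_cake c) auto
  moreover have "Z t / k\<^sup>2 \<le> y \<longleftrightarrow> Z t \<le> k\<^sup>2 * y" for t y using k by (simp add: field_simps)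
  ultimately have I2: "((\<lambda>y. exp (- c * y) * card {t\<in>T. Z t \<le> k\<^sup>2 * y}) has_integral ?S' / c) {0..}"
    by simp
  have I3: "((\<lambda>y. exp (- c * y)) has_integral exp (- c * 0) / c) {0..}"
    by (rule has_integral_exp_minus_to_infinity[OF c])
  have I4: "((\<lambda>y. if y \<in> {y0..} then exp (- c * y) else 0) has_integral exp (- c * y0) / c) {0..}"
  proof -
    have "{y0..} \<subseteq> {0..}" using y0 by auto
    then show ?thesis using has_integral_exp_minus_to_infinity[OF c] by (simp only: has_integral_restrict)
  qed
  have "((\<lambda>y. (1 / k) * (exp (- c * y) * card {t\<in>T. Z t \<le> k\<^sup>2 * y}) + exp (- c * y)
            + card T * (if y \<in> {y0..} then exp (- c * y) else 0)) has_integral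
         (1 / k) * (?S' / c) + exp (- c * 0) / c + card T * (exp (- c * y0) / c)) {0..}"
    by (intro has_integral_add has_integral_mult_right I2 I3 I4)
  with I1 have "?S / c \<le> (1 / k) * (?S' / c) + exp (- c * 0) / c + card T * (exp (- c * y0) / c)"
  proof (rule has_integral_le)
    fix y :: real assume y: "y \<in> {0..}"
    show "exp (- c * y) * card {t\<in>T. Z t \<le> y} \<le> (1 / k) * (exp (- c * y) * card {t\<in>T. Z t \<le> k\<^sup>2 * y})
          + exp (- c * y) + card T * (if y \<in> {y0..} then exp (- c * y) else 0)"
    proof (cases "y < y0")
      case True
      then have "exp (- c * y) * card {t\<in>T. Z t \<le> y}
           \<le> exp (- c * y) * (card {t\<in>T. Z t \<le> k\<^sup>2 * y} / k + 1)"
        using N y by (intro mult_left_mono) auto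
      then show ?thesis using True by (simp add: algebra_simps)
    next
      case False
      have "card {t\<in>T. Z t \<le> y} \<le> card T" using T by (intro card_mono) auto
      then have "exp (- c * y) * card {t\<in>T. Z t \<le> y} \<le> exp (- c * y) * card T"
        by (intro mult_left_mono) auto
      moreover have "0 \<le> (1 / k) * (exp (- c * y) * card {t\<in>T. Z t \<le> k\<^sup>2 * y}) + exp (- c * y)"
        using k by (intro add_nonneg_nonneg mult_nonneg_nonneg) auto
      moreover have "(if y \<in> {y0..} then exp (- c * y) else 0) = exp (- c * y)" using False by auto
      ultimately show ?thesis by (simp only: mult.commute[of "real (card T)"])
    qed
  qed
  also have "(1 / k) * (?S' / c) + exp (- c * 0) / c + card T * (exp (- c * y0) / c)
      = (?S' / k + 1 + card T * exp (- c * y0)) / c"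
    by (simp add: add_divide_distrib mult.commute)
  finally show ?thesis using c divide_le_cancel[of ?S c "?S' / k + 1 + card T * exp (- c * y0)"] by linarith
qed

text \<open>
  The gain of a factor \<open>k\<close> on which the treatment of structured vectors rests. The two units on the right
  come from the frequency \<open>0\<close>, at which nothing is gained, and from the levels above \<open>ln q / c\<close>, where the
  \<open>q\<close> frequencies have weight at most \<open>1 / q\<close> each.
\<close>

lemma sum_exp_gain:
  fixes q :: int and k :: nat
  assumes q: "prime q" and c: "c > 0" and k: "k > 0"
    and s: "(real k)\<^sup>2 * ln (real_of_int q) / c \<le> card (supp q l v)"
  shows "(\<Sum>t\<in>{0..<q}. exp (- c * defect q l v t)) \<le> (\<Sum>t\<in>{0..<q}. exp (- (c / (real k)\<^sup>2) * defect q l v t)) / k + 2"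
proof -
  have q0: "q > 0" "q > 1" using q prime_gt_0_int prime_gt_1_int by blast+
  define y0 where "y0 = ln (real_of_int q) / c"
  have y0: "y0 \<ge> 0" using q0 c by (simp add: y0_def)
  have *: "real (card {t\<in>{0..<q}. defect q l v t \<le> y}) \<le> card {t\<in>{0..<q}. defect q l v t \<le> (real k)\<^sup>2 * y} / real k + 1"
    if y: "0 \<le> y" "y < y0" for y
  proof -
    have "(real k)\<^sup>2 * y < (real k)\<^sup>2 * y0" using y k by simp
    also have "\<dots> \<le> card (supp q l v)" using s by (simp add: y0_def)
    finally have *: "card {t\<in>{0..<q}. defect q l v t \<le> (real k)\<^sup>2 * y} < nat q"
      by (rule level_set_not_all[OF q0(1)])
    define N where "N = card {t\<in>{0..<q}. defect q l v t \<le> y}"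
    define M where "M = card {t\<in>{0..<q}. defect q l v t \<le> (real k)\<^sup>2 * y}"
    have NM: "k * (N - 1) + 1 \<le> M" unfolding N_def M_def by (rule level_set_growth[OF q y(1) *])
    have "real k * (real N - 1) \<le> real k * real (N - 1)" by (intro mult_left_mono) auto
    also have "\<dots> \<le> real M" using NM by (metis add_leD1 of_nat_le_iff of_nat_mult)
    finally have "real N - 1 \<le> real M / real k" using k by (simp add: field_simps)
    then show ?thesis unfolding N_def M_def by simp
  qed
  have "(\<Sum>t\<in>{0..<q}. exp (- c * defect q l v t)) \<le> (\<Sum>t\<in>{0..<q}. exp (- (c / (real k)\<^sup>2) * defect q l v t)) / real k
       + 1 + card {0..<q} * exp (- c * y0)"
    by (rule layer_cake_compare) (use * y0 c k defect_nonneg in auto)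
  also have "card {0..<q} * exp (- c * y0) = 1"
    using q0 c by (simp add: y0_def exp_minus)
  finally show ?thesis by simp
qed

section \<open>The concentration bound under extension by one coordinate\<close>

text \<open>
  The slope, up to sign, of the chord of \<open>exp (- c * y)\<close> over the interval from 0 to 2, the range of \<open>1 - cos\<close>.
\<close>

definition chord :: "real \<Rightarrow> real" where
  "chord c = (1 - exp (- 2 * c)) / 2"

lemma chord_bounds: "c > 0 \<Longrightarrow> 0 < chord c \<and> chord c < 1 / 2"
  by (simp add: chord_def)

lemma exp_le_chord:
  assumes "0 \<le> y" "y \<le> 2"
  shows "exp (- c * y) \<le> 1 - chord c * y"
proof -
  have "exp ((1 - y / 2) *\<^sub>R 0 + (y / 2) *\<^sub>R (- 2 * c)) \<le> (1 - y / 2) * exp 0 + (y / 2) * exp (- 2 * c)"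
    using assms by (intro convex_onD[OF exp_convex]) auto
  then show ?thesis by (simp add: chord_def field_simps)
qed

lemma defect_Suc: "defect q (Suc l) v t = defect q l v t + (1 - cosq q (t * v l))"
  by (simp add: defect_def)

lemma defect_upd: "defect q l (v(l := a)) t = defect q l v t"
  by (simp add: defect_def)

lemma conc_upd: "conc c q l (v(l := a)) = conc c q l v"
  by (simp add: conc_def defect_upd)

lemma defect_cong: "(\<And>i. i < l \<Longrightarrow> v i = w i) \<Longrightarrow> defect q l v t = defect q l w t"
  by (simp add: defect_def)

lemma conc_cong: "(\<And>i. i < l \<Longrightarrow> v i = w i) \<Longrightarrow> conc c q l v = conc c q l w"
  unfolding conc_def using defect_cong[of l v w q] by simp

lemma conc_pos: "q > 0 \<Longrightarrow> conc c q l v > 0"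
  unfolding conc_def by (intro divide_pos_pos sum_pos) auto

lemma conc_le_1: "q > 0 \<Longrightarrow> c \<ge> 0 \<Longrightarrow> conc c q l v \<le> 1"
proof -
  assume q: "q > 0" and c: "c \<ge> 0"
  have "(\<Sum>t\<in>{0..<q}. exp (- c * defect q l v t)) \<le> (\<Sum>t\<in>{0..<q}. 1)"
    by (intro sum_mono) (use c defect_nonneg[of q l v] in auto)
  then show ?thesis unfolding conc_def using q by simp
qed

lemma conc_0 [simp]: "q > 0 \<Longrightarrow> conc c q 0 v = 1"
  by (simp add: conc_def defect_def)

lemma defect_mono: "l \<le> l' \<Longrightarrow> defect q l v t \<le> defect q l' v t"
  unfolding defect_def by (intro sum_mono2) (auto simp: cos_le_one)

lemma conc_antimono_len: "l \<le> l' \<Longrightarrow> c \<ge> 0 \<Longrightarrow> q > 0 \<Longrightarrow> conc c q l' v \<le> conc c q l v"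
  unfolding conc_def by (intro divide_right_mono sum_mono) (auto intro!: mult_left_mono defect_mono)

lemma conc_antimono_exp: "c' \<le> c \<Longrightarrow> q > 0 \<Longrightarrow> conc c q l v \<le> conc c' q l v"
  unfolding conc_def by (intro divide_right_mono sum_mono) (auto intro!: mult_right_mono defect_nonneg)

text \<open>
  At a single nonzero coordinate \<open>1 - cos\<close> has average 1 over all frequencies, and the chord turns this
  into a bound for the average of the exponential.
\<close>

lemma conc_le_chord:
  assumes q: "q > 0" and c: "c > 0" and i: "i \<in> supp q l v"
  shows "conc c q l v \<le> 1 - chord c"
proof -
  let ?C = "\<lambda>t. cosq q (t * v i)"
  have i': "i < l" "\<not> q dvd v i" using i by (auto simp: supp_def)
  have "exp (- c * defect q l v t) \<le> 1 - chord c * (1 - ?C t)" for t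
  proof -
    have "1 - ?C t \<le> defect q l v t"
      unfolding defect_def using i' by (intro member_le_sum) (auto simp: cos_le_one)
    then have "exp (- c * defect q l v t) \<le> exp (- c * (1 - ?C t))" using c by simp
    also have "\<dots> \<le> 1 - chord c * (1 - ?C t)"
      using cos_ge_minus_one[of "2 * pi * real_of_int (t * v i) / real_of_int q"]
      by (intro exp_le_chord) (auto simp: cos_le_one)
    finally show ?thesis .
  qed
  then have "(\<Sum>t\<in>{0..<q}. exp (- c * defect q l v t)) \<le> (\<Sum>t\<in>{0..<q}. 1 - chord c * (1 - ?C t))"
    by (intro sum_mono)
  also have "\<dots> = real_of_int q - chord c * (real_of_int q - (\<Sum>t\<in>{0..<q}. ?C t))"
    using q by (simp only: sum_subtractf sum_distrib_left[symmetric]) simp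
  also have "(\<Sum>t\<in>{0..<q}. ?C t) = 0" unfolding sum_cos[OF q] using i' by simp
  finally show ?thesis unfolding conc_def using q by (simp add: field_simps)
qed

lemma parseval_cos:
  fixes f :: "int \<Rightarrow> real"
  assumes q: "q > 0"
  shows "(\<Sum>a\<in>{0..<q}. (\<Sum>t\<in>{0..<q}. f t * cosq q (t * a))\<^sup>2)
          \<le> real_of_int q * (\<Sum>t\<in>{0..<q}. (f t)\<^sup>2)"
proof -
  define e where "e = (\<lambda>t a. cisq q (t * a))"
  define F where "F = (\<lambda>a. \<Sum>t\<in>{0..<q}. of_real (f t) * e t a)"
  have ecnj: "e s a * cnj (e t a) = e a (s - t)" for s t a
  proof -
    have "e s a * cnj (e t a) = cis (2 * pi * real_of_int (s * a) / real_of_int q + - (2 * pi * real_of_int (t * a) / real_of_int q))"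
      unfolding e_def cis_cnj cis_mult ..
    also have "\<dots> = e a (s - t)"
      unfolding e_def by (rule arg_cong[of _ _ cis]) (simp add: algebra_simps diff_divide_distrib)
    finally show ?thesis .
  qed
  have sumE: "(\<Sum>a\<in>{0..<q}. e a (s - t)) = (if s = t then of_int q else 0)" if "s \<in> {0..<q}" "t \<in> {0..<q}" for s t
  proof -
    have "q dvd (s - t) \<longleftrightarrow> s = t"
    proof
      assume "q dvd s - t"
      then have "s mod q = t mod q" by (simp add: mod_eq_dvd_iff)
      then show "s = t" using that by simp
    qed simp
    then show ?thesis unfolding e_def sum_cis[OF q] by simp
  qed
  have "complex_of_real (\<Sum>a\<in>{0..<q}. (cmod (F a))\<^sup>2) = (\<Sum>a\<in>{0..<q}. F a * cnj (F a))"
    by (simp only: of_real_sum complex_norm_square)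
  also have "\<dots> = (\<Sum>a\<in>{0..<q}. \<Sum>s\<in>{0..<q}. \<Sum>t\<in>{0..<q}. of_real (f s * f t) * (e s a * cnj (e t a)))"
    unfolding F_def by (simp add: sum_product algebra_simps)
  also have "\<dots> = (\<Sum>s\<in>{0..<q}. \<Sum>t\<in>{0..<q}. \<Sum>a\<in>{0..<q}. of_real (f s * f t) * e a (s - t))"
    unfolding ecnj by (subst sum.swap, rule sum.cong[OF refl], rule sum.swap)
  also have "\<dots> = (\<Sum>s\<in>{0..<q}. \<Sum>t\<in>{0..<q}. if s = t then of_real (f s * f t) * of_int q else 0)"
    by (intro sum.cong refl) (simp only: sum_distrib_left[symmetric] sumE, simp)
  also have "\<dots> = complex_of_real (real_of_int q * (\<Sum>t\<in>{0..<q}. (f t)\<^sup>2))"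
    by (simp add: sum_distrib_left power2_eq_square mult.commute)
  finally have *: "(\<Sum>a\<in>{0..<q}. (cmod (F a))\<^sup>2) = real_of_int q * (\<Sum>t\<in>{0..<q}. (f t)\<^sup>2)"
    by (simp only: of_real_eq_iff)
  have "(\<Sum>t\<in>{0..<q}. f t * cosq q (t * a)) = Re (F a)" for a
    unfolding F_def e_def by simp
  then show ?thesis unfolding *[symmetric]
    by (simp only:) (intro sum_mono, simp add: cmod_power2)
qed

text \<open>
  The new coordinate \<open>a\<close> multiplies the summand at \<open>t\<close> by \<open>exp (- c * (1 - cosq q (t * a)))\<close>. Bounding this
  factor by its chord expresses the loss through the Fourier coefficient at \<open>a\<close> of the summands.
\<close>

lemma conc_extend_le:
  fixes q :: int
  assumes q: "q > 0" and c: "c > 0"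
  defines "f \<equiv> \<lambda>v l t. exp (- c * defect q l v t)"
  shows "conc c q (Suc l) (v(l := a)) \<le> conc c q l v - chord c *
     (conc c q l v - (\<Sum>t\<in>{0..<q}. f v l t * cosq q (t * a)) / real_of_int q)"
proof -
  let ?C = "\<lambda>t. cosq q (t * a)"
  have "conc c q (Suc l) (v(l := a)) = (\<Sum>t\<in>{0..<q}. f v l t * exp (- c * (1 - ?C t))) / real_of_int q"
    unfolding conc_def f_def by (simp add: defect_Suc defect_upd exp_add[symmetric] algebra_simps)
  also have "\<dots> \<le> (\<Sum>t\<in>{0..<q}. f v l t * (1 - chord c * (1 - ?C t))) / real_of_int q"
  proof (intro divide_right_mono sum_mono mult_left_mono)
    fix t
    have "- 1 \<le> ?C t" "?C t \<le> 1" by (rule cos_ge_minus_one, rule cos_le_one)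
    then show "exp (- c * (1 - ?C t)) \<le> 1 - chord c * (1 - ?C t)" by (intro exp_le_chord) linarith+
  qed (use q in \<open>auto simp: f_def\<close>)
  also have "(\<Sum>t\<in>{0..<q}. f v l t * (1 - chord c * (1 - ?C t)))
      = (\<Sum>t\<in>{0..<q}. f v l t) - chord c * ((\<Sum>t\<in>{0..<q}. f v l t) - (\<Sum>t\<in>{0..<q}. f v l t * ?C t))"
    by (simp add: algebra_simps sum.distrib sum_subtractf sum_distrib_left)
  finally show ?thesis unfolding conc_def f_def by (simp only: diff_divide_distrib times_divide_eq_right[symmetric])
qed

lemma conc_extend_mono: "q > 0 \<Longrightarrow> c \<ge> 0 \<Longrightarrow> conc c q (Suc l) (v(l := a)) \<le> conc c q l v"
  using conc_antimono_len[of l "Suc l" c q "v(l := a)"] by (simp add: conc_upd)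

text \<open>
  Write \<open>R\<close> for the concentration bound at \<open>c / k\<^sup>2\<close>. A new coordinate \<open>a\<close> decreases \<open>R\<close> by a constant factor
  unless the Fourier coefficient at \<open>a\<close> of the summands of \<open>R\<close> exceeds half of its maximum; by Parseval
  there are at most \<open>4 / R\<close> such \<open>a\<close>. The power \<open>m\<close> makes the contribution of all the others negligible. The
  remaining factor \<open>4 / R\<close> is beaten by \<open>conc c q l v\<close>, which is at most \<open>3 * R / k\<close> by \<open>sum_exp_gain\<close>.
\<close>

lemma potential_step:
  fixes q :: int and k m :: nat
  assumes q: "prime q" and c: "c > 0" and k: "k > 0"
    and s: "(real k)\<^sup>2 * ln (real_of_int q) / c \<le> card (supp q l v)"
    and big: "conc (c / (real k)\<^sup>2) q l v \<ge> k / real_of_int q"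
    and m: "real_of_int q * (1 - chord (c / (real k)\<^sup>2) / 2) ^ m \<le> 1 / k"
  shows "conc c q l v * (\<Sum>a\<in>{0..<q}. conc (c / (real k)\<^sup>2) q (Suc l) (v(l := a)) ^ m)
           \<le> 13 / k * conc (c / (real k)\<^sup>2) q l v ^ m"
proof -
  have q0: "q > 0" using q prime_gt_0_int by blast
  define c' where "c' = c / (real k)\<^sup>2"
  have c': "c' > 0" using c k by (simp add: c'_def)
  define f where "f = (\<lambda>t. exp (- c' * defect q l v t))"
  define S where "S = (\<Sum>t\<in>{0..<q}. exp (- c * defect q l v t))"
  define S' where "S' = (\<Sum>t\<in>{0..<q}. f t)"
  define R where "R = conc c' q l v"
  define g where "g = (\<lambda>a. \<Sum>t\<in>{0..<q}. f t * cosq q (t * a))"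
  have RS: "R = S' / real_of_int q" unfolding R_def conc_def S'_def f_def ..
  have S'k: "S' \<ge> k" using big q0 unfolding c'_def[symmetric] R_def[symmetric] RS by (simp add: field_simps)
  then have S'0: "S' > 0" using k by linarith
  then have R0: "R > 0" using RS q0 by simp
  have "S \<le> S' / k + 2"
    unfolding S_def S'_def f_def c'_def by (rule sum_exp_gain[OF q c k s])
  also have "\<dots> \<le> 3 * S' / k" using S'k k by (simp add: field_simps)
  finally have SS': "S \<le> 3 * S' / k" .
  \<comment> \<open>The new coordinates for which the potential need not decrease.\<close>
  define D where "D = {a\<in>{0..<q}. g a > S' / 2}"
  have "real (card D) * (S' / 2)\<^sup>2 = (\<Sum>a\<in>D. (S' / 2)\<^sup>2)" by simp
  also have "\<dots> \<le> (\<Sum>a\<in>D. (g a)\<^sup>2)"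
    using S'0 by (intro sum_mono power_mono) (auto simp: D_def)
  also have "\<dots> \<le> (\<Sum>a\<in>{0..<q}. (g a)\<^sup>2)" by (intro sum_mono2) (auto simp: D_def)
  also have "\<dots> \<le> real_of_int q * (\<Sum>t\<in>{0..<q}. (f t)\<^sup>2)" unfolding g_def by (rule parseval_cos[OF q0])
  also have "\<dots> \<le> real_of_int q * S'"
  proof (intro mult_left_mono)
    have "f t ^ 2 \<le> f t" for t
    proof -
      have "f t \<le> 1" "f t \<ge> 0" unfolding f_def using c' defect_nonneg[of q l v t] by auto
      then show ?thesis by (simp add: power2_eq_square mult_left_le)
    qed
    then show "(\<Sum>t\<in>{0..<q}. (f t)\<^sup>2) \<le> S'" unfolding S'_def by (intro sum_mono)
  qed (use q0 in auto)
  finally have cD: "real (card D) \<le> 4 * real_of_int q / S'"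
    using S'0 by (simp add: field_simps power2_eq_square)
  \<comment> \<open>The factor gained at every other coordinate.\<close>
  define \<beta> where "\<beta> = 1 - chord c' / 2"
  have \<beta>: "0 \<le> \<beta>" "\<beta> \<le> 1" using chord_bounds[OF c'] by (auto simp: \<beta>_def)
  have step: "conc c' q (Suc l) (v(l := a)) ^ m \<le> (if a \<in> D then R ^ m else \<beta> ^ m * R ^ m)" if a: "a \<in> {0..<q}" for a
  proof (cases "a \<in> D")
    case True
    then show ?thesis using conc_extend_mono[OF q0, of c' l v a] c' conc_pos[OF q0, of c' "Suc l" "v(l := a)"]
      by (simp add: R_def power_mono)
  next
    case False
    then have ga: "g a \<le> S' / 2" using a by (auto simp: D_def)
    have "conc c' q (Suc l) (v(l := a)) \<le> R - chord c' * (R - g a / real_of_int q)"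
      using conc_extend_le[OF q0 c', of l v a] unfolding R_def g_def f_def by simp
    also have "\<dots> \<le> R - chord c' * (R - R / 2)"
      using ga chord_bounds[OF c'] q0 unfolding RS by (intro diff_left_mono mult_left_mono) (auto simp: field_simps)
    also have "\<dots> = \<beta> * R" by (simp add: \<beta>_def field_simps)
    finally have "conc c' q (Suc l) (v(l := a)) ^ m \<le> (\<beta> * R) ^ m"
      using conc_pos[OF q0, of c' "Suc l" "v(l := a)"] by (intro power_mono) auto
    then show ?thesis using False by (simp add: power_mult_distrib)
  qed
  have "(\<Sum>a\<in>{0..<q}. conc c' q (Suc l) (v(l := a)) ^ m) \<le> (\<Sum>a\<in>{0..<q}. if a \<in> D then R ^ m else \<beta> ^ m * R ^ m)"
    by (intro sum_mono step)
  also have "\<dots> \<le> (\<Sum>a\<in>{0..<q}. (if a \<in> D then R ^ m else 0) + \<beta> ^ m * R ^ m)"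
    using \<beta> R0 by (intro sum_mono) auto
  also have "\<dots> = card D * R ^ m + real_of_int q * \<beta> ^ m * R ^ m"
  proof -
    have "D \<subseteq> {0..<q}" by (auto simp: D_def)
    then have "{0..<q} \<inter> D = D" by auto
    then show ?thesis using q0 by (simp add: sum.distrib sum.If_cases)
  qed
  also have "\<dots> \<le> (4 * real_of_int q / S' + 1 / k) * R ^ m"
    using m R0 unfolding distrib_right
    by (intro add_mono mult_right_mono cD) (auto simp: \<beta>_def c'_def)
  finally have "(\<Sum>a\<in>{0..<q}. conc c' q (Suc l) (v(l := a)) ^ m) \<le> (4 * real_of_int q / S' + 1 / k) * R ^ m" .
  then have "conc c q l v * (\<Sum>a\<in>{0..<q}. conc c' q (Suc l) (v(l := a)) ^ m)
      \<le> conc c q l v * ((4 * real_of_int q / S' + 1 / k) * R ^ m)"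
    using conc_pos[OF q0, of c l v] by (intro mult_left_mono) auto
  also have "\<dots> = (conc c q l v * (4 * real_of_int q / S') + conc c q l v / k) * R ^ m"
    by (simp add: algebra_simps)
  also have "\<dots> \<le> (12 / k + 1 / k) * R ^ m"
  proof (intro mult_right_mono add_mono)
    have "conc c q l v * (4 * real_of_int q / S') = 4 * (S / S')"
      using q0 by (simp add: conc_def S_def)
    also have "\<dots> \<le> 4 * (3 / k)" using SS' S'0 k by (intro mult_left_mono) (auto simp: field_simps)
    finally show "conc c q l v * (4 * real_of_int q / S') \<le> 12 / k" by simp
    show "conc c q l v / k \<le> 1 / k" using conc_le_1[OF q0, of c l v] c by (intro divide_right_mono) auto
  qed (use R0 in auto)
  also have "\<dots> = 13 / k * R ^ m" by (simp add: add_divide_distrib[symmetric])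
  finally show ?thesis unfolding c'_def R_def .
qed

section \<open>Vertex exposure for random graphs\<close>

lemma prob_bind_pmf:
  "prob (bind_pmf M f) S = measure_pmf.expectation M (\<lambda>x. prob (f x) S)"
proof -
  have int: "integrable (measure_pmf M) (\<lambda>x. prob (f x) S)"
    by (rule measure_pmf.integrable_const_bound[where B = 1]) auto
  have "ennreal (prob (bind_pmf M f) S) = (\<integral>\<^sup>+x. emeasure (f x) S \<partial>M)"
    by (simp add: measure_pmf.emeasure_eq_measure[symmetric] del: measure_pmf.emeasure_eq_measure)
  also have "\<dots> = (\<integral>\<^sup>+x. ennreal (prob (f x) S) \<partial>M)"
    by (simp add: measure_pmf.emeasure_eq_measure)
  also have "\<dots> = ennreal (measure_pmf.expectation M (\<lambda>x. prob (f x) S))"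
    by (rule nn_integral_eq_integral[OF int]) auto
  finally show ?thesis by (subst (asm) ennreal_inj) (auto intro: integral_nonneg_AE)
qed

text \<open>
  Conditioning on a first random choice, with an exceptional set \<open>A\<close> of outcomes.
\<close>

lemma prob_bind_le:
  assumes "\<And>x. x \<in> set_pmf M \<Longrightarrow> prob (f x) S \<le> indicator A x * \<beta> + \<gamma>"
  shows "prob (bind_pmf M f) S \<le> prob M A * \<beta> + \<gamma>"
proof -
  have i: "integrable (measure_pmf M) (\<lambda>x. indicator A x * \<beta> + \<gamma> :: real)"
    by (rule measure_pmf.integrable_const_bound[where B = "\<bar>\<beta>\<bar> + \<bar>\<gamma>\<bar>"]) (auto simp: indicator_def)
  have "prob (bind_pmf M f) S = measure_pmf.expectation M (\<lambda>x. prob (f x) S)"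
    by (rule prob_bind_pmf)
  also have "\<dots> \<le> measure_pmf.expectation M (\<lambda>x. indicator A x * \<beta> + \<gamma>)"
    using assms by (intro integral_mono_AE i measure_pmf.integrable_const_bound[where B = 1] AE_pmfI) auto
  also have "\<dots> = measure_pmf.expectation M (\<lambda>x. indicator A x * \<beta>) + measure_pmf.expectation M (\<lambda>x. \<gamma>)"
    by (intro Bochner_Integration.integral_add measure_pmf.integrable_const_bound[where B = "\<bar>\<beta>\<bar>"]
          measure_pmf.integrable_const) (auto simp: indicator_def)
  also have "\<dots> = prob M A * \<beta> + \<gamma>" by simp
  finally show ?thesis .
qed

definition bits :: "real \<Rightarrow> nat \<Rightarrow> (nat \<Rightarrow> bool) pmf" where
  "bits p l = Pi_pmf {..<l} False (\<lambda>_. bernoulli_pmf p)"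

definition dot :: "nat \<Rightarrow> (nat \<Rightarrow> bool) \<Rightarrow> (nat \<Rightarrow> int) \<Rightarrow> int" where
  "dot l x v = (\<Sum>i<l. if x i then v i else 0)"

lemma finite_set_bits: "finite (set_pmf (bits p l))"
  unfolding bits_def by (rule finite_subset[OF set_Pi_pmf_subset']) auto

lemma bits_Suc: "bits p (Suc l) = bind_pmf (bernoulli_pmf p) (\<lambda>b. map_pmf (\<lambda>x. x(l := b)) (bits p l))"
  unfolding bits_def lessThan_Suc by (subst Pi_pmf_insert') (auto simp: map_pmf_def)

lemma cmod_bernoulli_cis:
  assumes "0 \<le> p" "p \<le> 1"
  shows "cmod (of_real p * cis \<theta> + of_real (1 - p)) \<le> exp (- (p * (1 - p)) * (1 - cos \<theta>))"
proof -
  have "(cmod (of_real p * cis \<theta> + of_real (1 - p)))\<^sup>2 = (p * cos \<theta> + (1 - p))\<^sup>2 + (p * sin \<theta>)\<^sup>2"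
    by (simp add: cmod_power2)
  also have "\<dots> = 1 + 2 * (- (p * (1 - p)) * (1 - cos \<theta>))"
    unfolding power_mult_distrib[of p "sin \<theta>"] sin_squared_eq
    by (simp add: power2_eq_square algebra_simps)
  also have "\<dots> \<le> exp (2 * (- (p * (1 - p)) * (1 - cos \<theta>)))" by (rule exp_ge_add_one_self)
  also have "\<dots> = (exp (- (p * (1 - p)) * (1 - cos \<theta>)))\<^sup>2" by (rule exp_double)
  finally show ?thesis by (rule power2_le_imp_le) auto
qed

lemma expectation_cis_dot:
  assumes "0 \<le> p" "p \<le> 1"
  shows "cmod (measure_pmf.expectation (bits p l) (\<lambda>x. cisq q (t * dot l x v)))
         \<le> exp (- (p * (1 - p)) * defect q l v t)"
proof (induction l)
  case 0
  then show ?case by (simp add: bits_def dot_def defect_def)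
next
  case (Suc l)
  define \<theta> where "\<theta> = 2 * pi * real_of_int (t * v l) / real_of_int q"
  define F where "F = (\<lambda>x. cisq q (t * dot l x v))"
  have F: "cisq q (t * dot (Suc l) (x(l := b)) v) = (if b then cis \<theta> else 1) * F x" for x b
  proof -
    have d: "dot (Suc l) (x(l := b)) v = dot l x v + (if b then v l else 0)" by (simp add: dot_def)
    have "2 * pi * real_of_int (t * dot (Suc l) (x(l := b)) v) / real_of_int q
       = (if b then \<theta> else 0) + 2 * pi * real_of_int (t * dot l x v) / real_of_int q"
      unfolding d \<theta>_def by (simp add: algebra_simps add_divide_distrib)
    then show ?thesis unfolding F_def by (simp only: cis_mult[symmetric] if_distrib[of cis] cis_zero)
  qed
  have "measure_pmf.expectation (bits p (Suc l)) (\<lambda>x. cisq q (t * dot (Suc l) x v))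
     = (\<Sum>b\<in>UNIV. pmf (bernoulli_pmf p) b *\<^sub>R measure_pmf.expectation (map_pmf (\<lambda>x. x(l := b)) (bits p l))
          (\<lambda>x. cisq q (t * dot (Suc l) x v)))"
    unfolding bits_Suc by (rule pmf_expectation_bind) (auto simp: finite_set_bits)
  also have "\<dots> = (\<Sum>b\<in>UNIV. pmf (bernoulli_pmf p) b *\<^sub>R ((if b then cis \<theta> else 1) * measure_pmf.expectation (bits p l) F))"
    unfolding integral_map_pmf F by simp
  also have "\<dots> = (of_real p * cis \<theta> + of_real (1 - p)) * measure_pmf.expectation (bits p l) F"
    using assms by (simp add: UNIV_bool scaleR_conv_of_real algebra_simps)
  also have "cmod \<dots> \<le> exp (- (p * (1 - p)) * (1 - cos \<theta>)) * exp (- (p * (1 - p)) * defect q l v t)"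
    unfolding norm_mult using cmod_bernoulli_cis[OF assms, of \<theta>] Suc unfolding F_def by (intro mult_mono) auto
  also have "\<dots> = exp (- (p * (1 - p)) * defect q (Suc l) v t)"
    by (simp add: defect_Suc \<theta>_def exp_add[symmetric] algebra_simps)
  finally show ?case .
qed

text \<open>
  The indicator of a congruence is an average of characters. The expectation of each character factors
  over the independent bits, and \<open>cmod_bernoulli_cis\<close> bounds the factors.
\<close>

lemma prob_dot_eq_le_conc:
  fixes q b :: int
  assumes q: "q > 0" and p: "0 \<le> p" "p \<le> 1"
  shows "prob (bits p l) {x. [dot l x v = b] (mod q)} \<le> conc (p * (1 - p)) q l v"
proof -
  let ?A = "{x. [dot l x v = b] (mod q)}"
  let ?e = "\<lambda>a. cisq q a"
  have ind: "complex_of_real (indicator ?A x) = (\<Sum>t\<in>{0..<q}. ?e (t * dot l x v) * ?e (- t * b)) / of_int q" for x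
  proof -
    have "(\<Sum>t\<in>{0..<q}. ?e (t * dot l x v) * ?e (- t * b)) = (\<Sum>t\<in>{0..<q}. ?e (t * (dot l x v - b)))"
    proof (rule sum.cong[OF refl])
      fix t
      show "?e (t * dot l x v) * ?e (- t * b) = ?e (t * (dot l x v - b))"
        unfolding cis_mult by (rule arg_cong[of _ _ cis]) (simp add: algebra_simps diff_divide_distrib)
    qed
    also have "\<dots> = (if q dvd (dot l x v - b) then of_int q else 0)" by (rule sum_cis[OF q])
    finally show ?thesis using q by (auto simp: indicator_def cong_iff_dvd_diff)
  qed
  have "complex_of_real (prob (bits p l) ?A) = measure_pmf.expectation (bits p l) (\<lambda>x. complex_of_real (indicator ?A x))"
    by simp
  also have "\<dots> = (\<Sum>t\<in>{0..<q}. measure_pmf.expectation (bits p l) (\<lambda>x. ?e (t * dot l x v)) * ?e (- t * b)) / of_int q"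
    unfolding ind by (simp add: Bochner_Integration.integral_sum integrable_measure_pmf_finite[OF finite_set_bits])
  finally have E: "complex_of_real (prob (bits p l) ?A)
      = (\<Sum>t\<in>{0..<q}. measure_pmf.expectation (bits p l) (\<lambda>x. ?e (t * dot l x v)) * ?e (- t * b)) / of_int q" .
  have "prob (bits p l) ?A = cmod (complex_of_real (prob (bits p l) ?A))" by simp
  also have "\<dots> = cmod ((\<Sum>t\<in>{0..<q}. measure_pmf.expectation (bits p l) (\<lambda>x. ?e (t * dot l x v)) * ?e (- t * b)) / of_int q)"
    unfolding E ..
  also have "\<dots> \<le> (\<Sum>t\<in>{0..<q}. cmod (measure_pmf.expectation (bits p l) (\<lambda>x. ?e (t * dot l x v)) * ?e (- t * b))) / real_of_int q"
    unfolding norm_divide using q by (simp add: divide_right_mono norm_sum)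
  also have "\<dots> \<le> (\<Sum>t\<in>{0..<q}. exp (- (p * (1 - p)) * defect q l v t)) / real_of_int q"
    using q expectation_cis_dot[OF p] by (intro divide_right_mono sum_mono) (auto simp: norm_mult)
  finally show ?thesis unfolding conc_def .
qed

definition ext_graph :: "nat set set \<Rightarrow> nat \<Rightarrow> (nat \<Rightarrow> bool) \<Rightarrow> nat set set" where
  "ext_graph E l x = E \<union> {{Suc i, Suc l} |i. i < l \<and> x i}"

lemma finite_possible_edges: "finite (possible_edges n)"
proof -
  have "possible_edges n \<subseteq> Pow {1..n}" by (auto simp: possible_edges_def)
  then show ?thesis by (rule finite_subset) auto
qed

lemma possible_edges_Suc:
  "possible_edges (Suc l) = possible_edges l \<union> (\<lambda>i. {Suc i, Suc l}) ` {..<l}"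
proof (intro equalityI subsetI)
  fix e assume "e \<in> possible_edges (Suc l)"
  then obtain i j where e: "e = {i, j}" "i \<in> {1..Suc l}" "j \<in> {1..Suc l}" "i \<noteq> j"
    by (auto simp: possible_edges_def)
  consider "i = Suc l" | "j = Suc l" | "i \<le> l" "j \<le> l" using e by fastforce
  then show "e \<in> possible_edges l \<union> (\<lambda>i. {Suc i, Suc l}) ` {..<l}"
  proof cases
    case 1
    then have "e = {Suc (j - 1), Suc l}" "j - 1 < l" using e by auto
    then show ?thesis by blast
  next
    case 2
    then have "e = {Suc (i - 1), Suc l}" "i - 1 < l" using e by auto
    then show ?thesis by blast
  next
    case 3
    then show ?thesis using e by (auto simp: possible_edges_def)
  qed
next
  fix e assume "e \<in> possible_edges l \<union> (\<lambda>i. {Suc i, Suc l}) ` {..<l}"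
  then show "e \<in> possible_edges (Suc l)"
  proof
    assume "e \<in> possible_edges l"
    then obtain i j where "e = {i, j}" "i \<in> {1..l}" "j \<in> {1..l}" "i \<noteq> j"
      by (auto simp: possible_edges_def)
    then have "e = {i, j} \<and> i \<in> {1..Suc l} \<and> j \<in> {1..Suc l} \<and> i \<noteq> j" by auto
    then show ?thesis unfolding possible_edges_def by blast
  next
    assume "e \<in> (\<lambda>i. {Suc i, Suc l}) ` {..<l}"
    then obtain i where "e = {Suc i, Suc l}" "i < l" by auto
    then have "e = {Suc i, Suc l} \<and> Suc i \<in> {1..Suc l} \<and> Suc l \<in> {1..Suc l} \<and> Suc i \<noteq> Suc l" by auto
    then show ?thesis unfolding possible_edges_def by blast
  qed
qed

lemma new_edge_notin: "{Suc i, Suc l} \<notin> possible_edges l"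
proof
  assume "{Suc i, Suc l} \<in> possible_edges l"
  then obtain a b where "{Suc i, Suc l} = {a, b}" "a \<le> l" "b \<le> l"
    by (auto simp: possible_edges_def)
  then have "Suc l \<in> {a, b}" by blast
  then show False using \<open>a \<le> l\<close> \<open>b \<le> l\<close> by auto
qed

text \<open>
  The edges at the vertex \<open>Suc l\<close> are independent of the graph on the first \<open>l\<close> vertices. This is the
  recursion along which all probabilities below are computed.
\<close>

lemma erdos_renyi_Suc:
  "erdos_renyi (Suc l) p = bind_pmf (erdos_renyi l p) (\<lambda>E. map_pmf (ext_graph E l) (bits p l))"
proof -
  let ?h = "\<lambda>i. {Suc i, Suc l}" and ?B = "\<lambda>_. bernoulli_pmf p"
  let ?N = "?h ` {..<l}"
  have bits: "bits p l = map_pmf (\<lambda>g. g \<circ> ?h) (Pi_pmf ?N False ?B)"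
    unfolding bits_def
  proof (rule Pi_pmf_bij_betw)
    show "bij_betw ?h {..<l} ?N"
      by (auto simp: bij_betw_def inj_on_def doubleton_eq_iff)
    show "?h i \<notin> ?N" if "i \<notin> {..<l}" for i
    proof
      assume "?h i \<in> ?N"
      then obtain j where "j < l" "{Suc i, Suc l} = {Suc j, Suc l}" by blast
      then have "i = j" unfolding doubleton_eq_iff by linarith
      then show False using that \<open>j < l\<close> by simp
    qed
  qed simp
  have "erdos_renyi (Suc l) p = map_pmf (\<lambda>(f, g). {e \<in> possible_edges (Suc l). if e \<in> possible_edges l then f e else g e})
           (pair_pmf (Pi_pmf (possible_edges l) False ?B) (Pi_pmf ?N False ?B))"
    unfolding erdos_renyi_def possible_edges_Suc
  proof (subst Pi_pmf_union)
    show "possible_edges l \<inter> ?N = {}" using new_edge_notin[of _ l] by blast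
  qed (simp_all add: finite_possible_edges map_pmf_comp split_def)
  also have "(\<lambda>(f, g). {e \<in> possible_edges (Suc l). if e \<in> possible_edges l then f e else g e})
      = (\<lambda>(f, g). ext_graph {e \<in> possible_edges l. f e} l (g \<circ> ?h))"
  proof (intro ext, clarify)
    fix f g :: "nat set \<Rightarrow> bool"
    show "{e \<in> possible_edges (Suc l). if e \<in> possible_edges l then f e else g e} = ext_graph {e \<in> possible_edges l. f e} l (g \<circ> ?h)"
    proof (rule Set.set_eqI)
      fix e
      have mem: "e \<in> ext_graph {e \<in> possible_edges l. f e} l (g \<circ> ?h) \<longleftrightarrow> e \<in> possible_edges l \<and> f e \<or> e \<in> ?N \<and> g e"
        unfolding ext_graph_def comp_def by blast
      have "e \<in> ?N \<Longrightarrow> e \<notin> possible_edges l" using new_edge_notin[of _ l] by blast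
      then show "e \<in> {e \<in> possible_edges (Suc l). if e \<in> possible_edges l then f e else g e}
          \<longleftrightarrow> e \<in> ext_graph {e \<in> possible_edges l. f e} l (g \<circ> ?h)"
        unfolding mem unfolding possible_edges_Suc mem_Collect_eq Un_iff
        by (cases "e \<in> possible_edges l"; cases "e \<in> ?N") (simp_all only: if_True if_False simp_thms)
    qed
  qed
  finally show ?thesis
    unfolding bits erdos_renyi_def pair_pmf_def map_pmf_def
    by (simp add: bind_assoc_pmf bind_return_pmf)
qed

lemma set_erdos_renyi: "E \<in> set_pmf (erdos_renyi n p) \<Longrightarrow> E \<subseteq> possible_edges n"
  unfolding erdos_renyi_def by auto

definition adj :: "nat set set \<Rightarrow> nat \<Rightarrow> nat \<Rightarrow> int" where
  "adj E i j = (if {Suc i, Suc j} \<in> E then 1 else 0)"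

lemma adj_commute: "adj E i j = adj E j i"
  by (simp add: adj_def insert_commute)

text \<open>
  Entry \<open>i\<close> of \<open>(A - a I) v\<close>, where \<open>A\<close> is the adjacency matrix on the first \<open>l\<close> vertices. Vectors are functions
  on all natural numbers, so that one vector serves for all graphs of a vertex exposure.
\<close>

definition shift_mult :: "nat set set \<Rightarrow> int \<Rightarrow> nat \<Rightarrow> (nat \<Rightarrow> int) \<Rightarrow> nat \<Rightarrow> int" where
  "shift_mult E a l v i = (\<Sum>j<l. adj E i j * v j) - a * v i"

definition solves :: "int \<Rightarrow> int \<Rightarrow> nat set set \<Rightarrow> nat \<Rightarrow> (nat \<Rightarrow> int) \<Rightarrow> (nat \<Rightarrow> int) \<Rightarrow> bool" where
  "solves q a E l w u \<longleftrightarrow> (\<forall>i<l. [shift_mult E a l w i = u i] (mod q))"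

lemma new_edge_in_ext:
  assumes "E \<subseteq> possible_edges l"
  shows "{Suc i, Suc l} \<in> ext_graph E l x \<longleftrightarrow> i < l \<and> x i"
proof -
  have "{Suc i, Suc l} \<notin> E" using assms new_edge_notin by blast
  moreover have "{Suc i, Suc l} = {Suc j, Suc l} \<longleftrightarrow> i = j" for j
    unfolding doubleton_eq_iff by auto
  ultimately show ?thesis unfolding ext_graph_def by auto
qed

lemma adj_ext_old:
  assumes "i < l" "j < l"
  shows "adj (ext_graph E l x) i j = adj E i j"
proof -
  have "{Suc i, Suc j} \<noteq> {Suc m, Suc l}" for m
    unfolding doubleton_eq_iff using assms by auto
  then show ?thesis unfolding adj_def ext_graph_def by auto
qed

lemma adj_ext_new:
  assumes "E \<subseteq> possible_edges l" "j < l"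
  shows "adj (ext_graph E l x) l j = (if x j then 1 else 0)" "adj (ext_graph E l x) j l = (if x j then 1 else 0)"
proof -
  show "adj (ext_graph E l x) j l = (if x j then 1 else 0)"
    using assms(2) by (simp add: adj_def new_edge_in_ext[OF assms(1)])
  then show "adj (ext_graph E l x) l j = (if x j then 1 else 0)" by (subst adj_commute)
qed

lemma adj_ext_diag:
  assumes "E \<subseteq> possible_edges l"
  shows "adj (ext_graph E l x) l l = 0"
  by (simp only: adj_def new_edge_in_ext[OF assms]) simp

lemma shift_mult_ext_old:
  assumes "E \<subseteq> possible_edges l" "i < l"
  shows "shift_mult (ext_graph E l x) a (Suc l) v i = shift_mult E a l v i + (if x i then v l else 0)"
  unfolding shift_mult_def using assms by (simp add: adj_ext_old adj_ext_new)

lemma shift_mult_ext_new: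
  assumes "E \<subseteq> possible_edges l"
  shows "shift_mult (ext_graph E l x) a (Suc l) v l = dot l x v - a * v l"
  unfolding shift_mult_def dot_def using assms by (auto simp: adj_ext_new adj_ext_diag intro!: sum.cong)

lemma solves_ext:
  assumes "E \<subseteq> possible_edges l"
  shows "solves q a (ext_graph E l x) (Suc l) w u \<longleftrightarrow>
    solves q a E l w (\<lambda>i. u i - (if x i then w l else 0)) \<and> [dot l x w = u l + a * w l] (mod q)"
proof -
  have 1: "[m + d = e] (mod q) \<longleftrightarrow> [m = e - d] (mod q)" for m d e :: int
    by (simp add: cong_iff_dvd_diff algebra_simps)
  have 2: "[m - d = e] (mod q) \<longleftrightarrow> [m = e + d] (mod q)" for m d e :: int
    by (simp add: cong_iff_dvd_diff algebra_simps)
  show ?thesis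
    unfolding solves_def less_Suc_eq using shift_mult_ext_old[OF assms] shift_mult_ext_new[OF assms] 1 2 by auto
qed

lemma prob_solves_Suc:
  "prob (erdos_renyi (Suc l) p) {E. solves q a E (Suc l) w u} \<le>
   prob (bind_pmf (bits p l) (\<lambda>x. map_pmf (\<lambda>E. (E, x)) (erdos_renyi l p)))
     {(E, x). solves q a E l w (\<lambda>i. u i - (if x i then w l else 0)) \<and> [dot l x w = u l + a * w l] (mod q)}"
proof -
  have "erdos_renyi (Suc l) p = map_pmf (\<lambda>(E, x). ext_graph E l x) (pair_pmf (erdos_renyi l p) (bits p l))"
    unfolding erdos_renyi_Suc pair_pmf_def map_pmf_def by (simp add: bind_assoc_pmf bind_return_pmf)
  moreover have "bind_pmf (bits p l) (\<lambda>x. map_pmf (\<lambda>E. (E, x)) (erdos_renyi l p)) = pair_pmf (erdos_renyi l p) (bits p l)"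
    unfolding pair_pmf_def map_pmf_def by (rule bind_commute_pmf)
  ultimately show ?thesis
    using set_erdos_renyi[of _ l p] solves_ext
    by (auto intro!: measure_pmf.finite_measure_mono_AE AE_pmfI)
qed

text \<open>
  For a fixed row \<open>x\<close> of the new vertex, the old equations have a shifted right-hand side, on which \<open>\<beta>\<close> does
  not depend; the new equation involves \<open>x\<close> alone.
\<close>

lemma prob_solves_step:
  assumes q: "q > 0" and p: "0 \<le> p" "p \<le> 1"
    and IH: "\<And>u. prob (erdos_renyi l p) {E. solves q a E l w u} \<le> \<beta>" and "\<beta> \<ge> 0"
  shows "prob (erdos_renyi (Suc l) p) {E. solves q a E (Suc l) w u} \<le> conc (p * (1 - p)) q l w * \<beta>"
proof -
  let ?A = "{x. [dot l x w = u l + a * w l] (mod q)}"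
  have "prob (erdos_renyi (Suc l) p) {E. solves q a E (Suc l) w u} \<le> prob (bits p l) ?A * \<beta> + 0"
  proof (rule order_trans[OF prob_solves_Suc prob_bind_le])
    fix x
    have "(\<lambda>E. (E, x)) -` {(E, x). solves q a E l w (\<lambda>i. u i - (if x i then w l else 0)) \<and> [dot l x w = u l + a * w l] (mod q)}
       = (if x \<in> ?A then {E. solves q a E l w (\<lambda>i. u i - (if x i then w l else 0))} else {})" by auto
    then show "prob (map_pmf (\<lambda>E. (E, x)) (erdos_renyi l p))
       {(E, x). solves q a E l w (\<lambda>i. u i - (if x i then w l else 0)) \<and> [dot l x w = u l + a * w l] (mod q)}
       \<le> indicator ?A x * \<beta> + 0"
      using IH by (simp add: measure_map_pmf)
  qed
  also have "\<dots> \<le> conc (p * (1 - p)) q l w * \<beta>"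
    using prob_dot_eq_le_conc[OF q p] assms(5) by (simp add: mult_right_mono)
  finally show ?thesis .
qed

lemma prob_solves_le_prod:
  assumes q: "q > 0" and p: "0 \<le> p" "p \<le> 1"
  shows "prob (erdos_renyi l p) {E. solves q a E l w u} \<le> (\<Prod>j<l. conc (p * (1 - p)) q j w)"
proof (induction l arbitrary: u)
  case 0
  then show ?case by simp
next
  case (Suc l)
  have "(\<Prod>j<l. conc (p * (1 - p)) q j w) \<ge> 0" by (intro prod_nonneg) (auto simp: less_imp_le conc_pos[OF q])
  from prob_solves_step[OF q p Suc this] show ?case by (simp add: mult.commute)
qed

text \<open>
  Let \<open>j\<close> be the first index with \<open>w j\<close> nonzero. Column \<open>j\<close> is determined by the equations \<open>i < j\<close>, so each of
  these holds with probability at most \<open>max p (1 - p)\<close>; each equation after \<open>j\<close> is a congruence for fresh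
  bits with a nonzero coefficient.
\<close>

lemma prob_solves_nonzero:
  assumes q: "q > 0" and p: "0 < p" "p < 1" and w: "supp q l w \<noteq> {}"
  shows "prob (erdos_renyi l p) {E. solves q a E l w u}
           \<le> max (max p (1 - p)) (1 - chord (p * (1 - p))) ^ (l - 1)"
  using w
proof (induction l arbitrary: u)
  case 0
  then show ?case by (simp add: supp_def)
next
  case (Suc l)
  define \<zeta> where "\<zeta> = max (max p (1 - p)) (1 - chord (p * (1 - p)))"
  have \<zeta>0: "\<zeta> \<ge> 0" using p by (simp add: \<zeta>_def)
  show ?case
  proof (cases "supp q l w = {}")
    case False
    then have l: "l \<ge> 1" by (cases l) (auto simp: supp_def)
    have "prob (erdos_renyi (Suc l) p) {E. solves q a E (Suc l) w u} \<le> conc (p * (1 - p)) q l w * \<zeta> ^ (l - 1)"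
      using p Suc.IH[OF False] \<zeta>0 by (intro prob_solves_step q) (auto simp: \<zeta>_def)
    also have "conc (p * (1 - p)) q l w \<le> 1 - chord (p * (1 - p))" using False p by (auto intro: conc_le_chord[OF q])
    also have "\<dots> \<le> \<zeta>" by (simp add: \<zeta>_def)
    finally have "prob (erdos_renyi (Suc l) p) {E. solves q a E (Suc l) w u} \<le> \<zeta> * \<zeta> ^ (l - 1)"
      using \<zeta>0 by (simp add: mult_right_mono)
    then show ?thesis using l unfolding \<zeta>_def by (simp add: power_eq_if)
  next
    case True
    then have wl: "\<not> q dvd w l" using Suc.prems by (auto simp: supp_def less_Suc_eq)
    have "prob (erdos_renyi (Suc l) p) {E. solves q a E (Suc l) w u}
        \<le> prob (erdos_renyi l p) UNIV * 0 + \<zeta> ^ l"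
      unfolding erdos_renyi_Suc
    proof (rule prob_bind_le)
      fix E assume "E \<in> set_pmf (erdos_renyi l p)"
      then have E: "E \<subseteq> possible_edges l" by (rule set_erdos_renyi)
      let ?B = "\<lambda>i. {b. [shift_mult E a l w i = u i - (if b then w l else 0)] (mod q)}"
      have "prob (map_pmf (ext_graph E l) (bits p l)) {E. solves q a E (Suc l) w u}
          \<le> prob (bits p l) (Pi {..<l} ?B)"
        unfolding measure_map_pmf
      proof (intro measure_pmf.finite_measure_mono subsetI)
        fix x assume "x \<in> ext_graph E l -` {E. solves q a E (Suc l) w u}"
        then have "solves q a E l w (\<lambda>i. u i - (if x i then w l else 0))" using solves_ext[OF E] by simp
        then show "x \<in> Pi {..<l} ?B" by (simp add: solves_def)
      qed simp
      also have "\<dots> = (\<Prod>i<l. prob (bernoulli_pmf p) (?B i))"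
        unfolding bits_def by (rule measure_Pi_pmf_Pi) auto
      also have "\<dots> \<le> (\<Prod>i<l. \<zeta>)"
      proof (intro prod_mono conjI)
        fix i
        have "\<not> (True \<in> ?B i \<and> False \<in> ?B i)"
        proof
          assume "True \<in> ?B i \<and> False \<in> ?B i"
          then have "[u i - w l = u i] (mod q)" by (auto intro: cong_trans cong_sym)
          then show False using wl by (simp add: cong_iff_dvd_diff)
        qed
        then have "?B i \<subseteq> {True} \<or> ?B i \<subseteq> {False}" by (metis (full_types) insertI1 subsetI)
        then have "prob (bernoulli_pmf p) (?B i) \<le> max (pmf (bernoulli_pmf p) True) (pmf (bernoulli_pmf p) False)"
          unfolding pmf.rep_eq le_max_iff_disj by (metis measure_pmf.finite_measure_mono sets_measure_pmf UNIV_I)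
        then show "prob (bernoulli_pmf p) (?B i) \<le> \<zeta>" using p by (simp add: \<zeta>_def)
      qed simp
      finally show "prob (map_pmf (ext_graph E l) (bits p l)) {E. solves q a E (Suc l) w u} \<le> indicator UNIV E * 0 + \<zeta> ^ l"
        by simp
    qed
    then show ?thesis by (simp add: \<zeta>_def)
  qed
qed

section \<open>Structured vectors are rarely solutions\<close>

definition Vec :: "int \<Rightarrow> nat \<Rightarrow> (nat \<Rightarrow> int) set" where
  "Vec q l = PiE {..<l} (\<lambda>_. {0..<q})"

lemma finite_Vec [simp]: "finite (Vec q l)"
  unfolding Vec_def by (rule finite_PiE) auto

lemma card_Vec: "q > 0 \<Longrightarrow> card (Vec q l) = nat q ^ l"
  unfolding Vec_def by (simp add: card_PiE)

lemma sum_Vec_Suc: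
  "(\<Sum>w\<in>Vec q (Suc l). F w) = (\<Sum>v\<in>Vec q l. \<Sum>a\<in>{0..<q}. F (v(l := a)))"
proof -
  have inj: "inj_on (\<lambda>(y, g). g(l := y)) ({0..<q} \<times> PiE {..<l} (\<lambda>_. {0..<q}))"
    using inj_combinator[of l "{..<l}" "\<lambda>_. {0..<q}"] by simp
  have "(\<Sum>w\<in>Vec q (Suc l). F w) = (\<Sum>(a, v)\<in>{0..<q} \<times> Vec q l. F (v(l := a)))"
    unfolding Vec_def lessThan_Suc PiE_insert_eq sum.reindex[OF inj] by (simp add: split_def)
  also have "\<dots> = (\<Sum>a\<in>{0..<q}. \<Sum>v\<in>Vec q l. F (v(l := a)))"
    by (simp add: sum.cartesian_product)
  also have "\<dots> = (\<Sum>v\<in>Vec q l. \<Sum>a\<in>{0..<q}. F (v(l := a)))" by (rule sum.swap)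
  finally show ?thesis .
qed

lemma sum_Vec_free_coords:
  fixes F :: "(nat \<Rightarrow> int) \<Rightarrow> real"
  assumes q: "q > 0" and F: "\<And>v i a. i \<ge> l \<Longrightarrow> F (v(i := a)) = F v"
  shows "(\<Sum>w\<in>Vec q (l + h). F w) = real_of_int q ^ h * (\<Sum>w\<in>Vec q l. F w)"
proof (induction h)
  case (Suc h)
  have "(\<Sum>w\<in>Vec q (l + Suc h). F w) = (\<Sum>v\<in>Vec q (l + h). \<Sum>a\<in>{0..<q}. F v)"
    by (simp add: sum_Vec_Suc F)
  then show ?case using Suc q by (simp add: sum_distrib_left[symmetric])
qed simp

lemma supp_upd: "i \<ge> l \<Longrightarrow> supp q l (v(i := a)) = supp q l v"
  by (auto simp: supp_def)

lemma card_supp_Suc_upd: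
  assumes "a \<in> {0..<q}"
  shows "card (supp q (Suc l) (v(l := a))) = card (supp q l v) + (if a = 0 then 0 else 1)"
proof -
  have "q dvd a \<longleftrightarrow> a = 0"
  proof
    assume "q dvd a"
    then have "\<not> 0 < a" using assms zdvd_not_zless[of a q] by auto
    then show "a = 0" using assms by simp
  qed simp
  then have "supp q (Suc l) (v(l := a)) = (if a = 0 then supp q l v else insert l (supp q l v))"
    by (auto simp: supp_def less_Suc_eq)
  moreover have "l \<notin> supp q l v" by (simp add: supp_def)
  ultimately show ?thesis by simp
qed

lemma conc_upd_ge: "i \<ge> l \<Longrightarrow> conc c q l (v(i := a)) = conc c q l v"
  by (rule conc_cong) auto

lemma prod_conc_upd:
  "i \<ge> l \<Longrightarrow> (\<Prod>j<Suc l. conc c q j (v(i := a))) = (\<Prod>j<Suc l. conc c q j v)"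
  by (intro prod.cong refl conc_upd_ge) auto

text \<open>
  The power of \<open>conc\<close> drives the induction over the coordinates. The denominator pays for the positions and
  values of the first \<open>s\<close> nonzero coordinates, during which nothing is gained. The factor \<open>2\<close> per nonzero
  coordinate is the profit: it makes vectors with many nonzero coordinates exponentially rare.
\<close>

definition potential :: "real \<Rightarrow> int \<Rightarrow> nat \<Rightarrow> nat \<Rightarrow> real \<Rightarrow> nat \<Rightarrow> (nat \<Rightarrow> int) \<Rightarrow> real" where
  "potential c q m s D l v = conc c q l v ^ m * 2 ^ card (supp q l v) / D ^ min (card (supp q l v)) s"

text \<open>
  A vector with fewer than \<open>s\<close> nonzero coordinates either stays as it is (\<open>a = 0\<close>) or pays a factor
  \<open>2 / D = 1 / (q n)\<close>, which over all \<open>q\<close> choices sums to \<open>1 / n\<close>. Afterwards \<open>potential_step\<close> applies, with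
  \<open>2 * 13 / k \<le> 1\<close>; this is the reason for \<open>k \<ge> 26\<close>.
\<close>

lemma potential_extend:
  fixes q :: int and k m s n :: nat
  assumes q: "prime q" and c: "c > 0" and k: "k \<ge> 26" and n: "n \<ge> 1"
    and s: "(real k)\<^sup>2 * ln (real_of_int q) / c \<le> s"
    and m: "real_of_int q * (1 - chord (c / (real k)\<^sup>2) / 2) ^ m \<le> 1 / k"
    and big: "conc (c / (real k)\<^sup>2) q l v \<ge> k / real_of_int q"
  defines "\<Psi> \<equiv> potential (c / (real k)\<^sup>2) q m s (2 * real_of_int q * real n)"
  shows "conc c q l v * (\<Sum>a\<in>{0..<q}. \<Psi> (Suc l) (v(l := a))) \<le> (1 + 1 / n) * \<Psi> l v"
proof -
  have q0: "q > 0" "q > 1" using q prime_gt_0_int prime_gt_1_int by blast+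
  define c' where "c' = c / (real k)\<^sup>2"
  have c': "c' > 0" using c k by (simp add: c'_def)
  define D where "D = 2 * real_of_int q * real n"
  have D: "D > 0" using q0 n by (simp add: D_def)
  define r where "r = card (supp q l v)"
  define R where "R = conc c' q l v"
  have R0: "R > 0" unfolding R_def by (rule conc_pos[OF q0(1)])
  have \<Psi>v: "\<Psi> l v = R ^ m * 2 ^ r / D ^ min r s"
    unfolding \<Psi>_def potential_def R_def r_def c'_def D_def ..
  have \<Psi>a: "\<Psi> (Suc l) (v(l := a)) = conc c' q (Suc l) (v(l := a)) ^ m * 2 ^ (r + (if a = 0 then 0 else 1))
        / D ^ min (r + (if a = 0 then 0 else 1)) s" if "a \<in> {0..<q}" for a
    unfolding \<Psi>_def potential_def c'_def D_def r_def card_supp_Suc_upd[OF that] ..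
  have \<Psi>0: "\<Psi> l v \<ge> 0" unfolding \<Psi>v using R0 D by simp
  have Ra: "conc c' q (Suc l) (v(l := a)) ^ m \<le> R ^ m" for a
    using conc_extend_mono[OF q0(1), of c' l v a] c' conc_pos[OF q0(1), of c' "Suc l" "v(l := a)"]
    by (simp add: R_def power_mono)
  show ?thesis
  proof (cases "r < s")
    case True
    have bnd: "\<Psi> (Suc l) (v(l := a)) \<le> (if a = 0 then \<Psi> l v else 0) + 2 / D * \<Psi> l v" if a: "a \<in> {0..<q}" for a
    proof (cases "a = 0")
      case True
      have "\<Psi> (Suc l) (v(l := a)) \<le> \<Psi> l v"
        unfolding \<Psi>a[OF a] \<Psi>v using True Ra[of a] D by (simp add: divide_right_mono)
      moreover have "2 / D * \<Psi> l v \<ge> 0" using \<Psi>0 D by simp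
      ultimately show ?thesis using True by simp
    next
      case False
      have "\<Psi> (Suc l) (v(l := a)) \<le> R ^ m * 2 ^ Suc r / D ^ Suc r"
        unfolding \<Psi>a[OF a] using False \<open>r < s\<close> Ra[of a] D by (simp add: divide_right_mono)
      also have "\<dots> = 2 / D * \<Psi> l v" unfolding \<Psi>v using \<open>r < s\<close> D by simp
      finally show ?thesis using False by simp
    qed
    have "(\<Sum>a\<in>{0..<q}. \<Psi> (Suc l) (v(l := a))) \<le> (\<Sum>a\<in>{0..<q}. (if a = 0 then \<Psi> l v else 0) + 2 / D * \<Psi> l v)"
      by (intro sum_mono bnd)
    also have "\<dots> = \<Psi> l v + real_of_int q * (2 / D * \<Psi> l v)"
      using q0 by (simp add: sum.distrib)
    also have "\<dots> = (1 + 1 / n) * \<Psi> l v" using q0 n by (simp add: D_def field_simps)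
    finally have "(\<Sum>a\<in>{0..<q}. \<Psi> (Suc l) (v(l := a))) \<le> (1 + 1 / n) * \<Psi> l v" .
    moreover have "(1 + 1 / n) * \<Psi> l v \<ge> 0" using \<Psi>0 by simp
    ultimately show ?thesis
      using conc_le_1[OF q0(1), of c l v] conc_pos[OF q0(1), of c l v] c
      by (meson less_imp_le mult_left_le_one_le mult_left_mono order_trans)
  next
    case False
    have bnd: "\<Psi> (Suc l) (v(l := a)) \<le> 2 * 2 ^ r / D ^ s * conc c' q (Suc l) (v(l := a)) ^ m" if a: "a \<in> {0..<q}" for a
      unfolding \<Psi>a[OF a] using False D conc_pos[OF q0(1), of c' "Suc l" "v(l := a)"]
      by (simp add: min_def field_simps)
    have "(\<Sum>a\<in>{0..<q}. \<Psi> (Suc l) (v(l := a))) \<le> 2 * 2 ^ r / D ^ s * (\<Sum>a\<in>{0..<q}. conc c' q (Suc l) (v(l := a)) ^ m)"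
      unfolding sum_distrib_left by (intro sum_mono bnd)
    then have "conc c q l v * (\<Sum>a\<in>{0..<q}. \<Psi> (Suc l) (v(l := a)))
        \<le> conc c q l v * (2 * 2 ^ r / D ^ s * (\<Sum>a\<in>{0..<q}. conc c' q (Suc l) (v(l := a)) ^ m))"
      using conc_pos[OF q0(1), of c l v] by (intro mult_left_mono) auto
    also have "\<dots> = 2 * 2 ^ r / D ^ s * (conc c q l v * (\<Sum>a\<in>{0..<q}. conc c' q (Suc l) (v(l := a)) ^ m))"
      by simp
    also have "\<dots> \<le> 2 * 2 ^ r / D ^ s * (13 / k * R ^ m)"
    proof (intro mult_left_mono)
      show "conc c q l v * (\<Sum>a\<in>{0..<q}. conc c' q (Suc l) (v(l := a)) ^ m) \<le> 13 / k * R ^ m"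
        unfolding R_def c'_def
      proof (rule potential_step[OF q c _ _ big m])
        show "(real k)\<^sup>2 * ln (real_of_int q) / c \<le> card (supp q l v)"
          using s False by (simp add: r_def)
      qed (use k in auto)
    qed (use D in auto)
    also have "\<dots> = 26 / k * (R ^ m * 2 ^ r / D ^ s)" by (simp add: ac_simps)
    also have "\<dots> \<le> 1 * (R ^ m * 2 ^ r / D ^ s)"
      using k R0 D by (intro mult_right_mono) auto
    also have "\<dots> = \<Psi> l v" unfolding \<Psi>v using False by (simp add: min_def)
    also have "\<dots> \<le> (1 + 1 / n) * \<Psi> l v" using \<Psi>0 by (simp add: distrib_right)
    finally show ?thesis .
  qed
qed

lemma sum_potential:
  fixes q :: int and k m s n :: nat
  assumes q: "prime q" and c: "c > 0" and k: "k \<ge> 26" and n: "n \<ge> 1"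
    and s: "(real k)\<^sup>2 * ln (real_of_int q) / c \<le> s"
    and m: "real_of_int q * (1 - chord (c / (real k)\<^sup>2) / 2) ^ m \<le> 1 / k"
  defines "\<Psi> \<equiv> potential (c / (real k)\<^sup>2) q m s (2 * real_of_int q * real n)"
  shows "(\<Sum>w\<in>{w\<in>Vec q l. conc (c / (real k)\<^sup>2) q l w \<ge> k / real_of_int q}. (\<Prod>j<l. conc c q j w) * \<Psi> l w) \<le> (1 + 1 / n) ^ l"
proof (induction l)
  case 0
  have q0: "q > 0" using q prime_gt_0_int by blast
  have "(\<Sum>w\<in>{w\<in>Vec q 0. conc (c / (real k)\<^sup>2) q 0 w \<ge> k / real_of_int q}. (\<Prod>j<0. conc c q j w) * \<Psi> 0 w)
     \<le> (\<Sum>w\<in>Vec q 0. 1)"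
    using q0 by (intro order_trans[OF sum_mono sum_mono2]) (auto simp: \<Psi>_def potential_def supp_def)
  also have "\<dots> = 1" by (simp add: Vec_def)
  finally show ?case by simp
next
  case (Suc l)
  have q0: "q > 0" using q prime_gt_0_int by blast
  define c' where "c' = c / (real k)\<^sup>2"
  have c': "c' > 0" using c k by (simp add: c'_def)
  define P where "P = (\<lambda>l w. \<Prod>j<l. conc c q j w)"
  have P0: "P l w \<ge> 0" for l w unfolding P_def by (intro prod_nonneg) (auto simp: less_imp_le conc_pos[OF q0])
  have \<Psi>0: "\<Psi> l w \<ge> 0" for l w
    unfolding \<Psi>_def potential_def using q0 conc_pos[OF q0] by (auto simp: less_imp_le)
  let ?G = "\<lambda>l. {w\<in>Vec q l. conc c' q l w \<ge> k / real_of_int q}"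
  have "(\<Sum>w\<in>?G (Suc l). P (Suc l) w * \<Psi> (Suc l) w)
      = (\<Sum>w\<in>Vec q (Suc l). if conc c' q (Suc l) w \<ge> k / real_of_int q then P (Suc l) w * \<Psi> (Suc l) w else 0)"
    by (rule sum.inter_filter) simp
  also have "\<dots> = (\<Sum>v\<in>Vec q l. \<Sum>a\<in>{0..<q}. if conc c' q (Suc l) (v(l := a)) \<ge> k / real_of_int q
           then P (Suc l) v * \<Psi> (Suc l) (v(l := a)) else 0)"
    unfolding sum_Vec_Suc P_def by (simp only: prod_conc_upd[OF order_refl])
  also have "\<dots> \<le> (\<Sum>v\<in>Vec q l. if conc c' q l v \<ge> k / real_of_int q then P l v * ((1 + 1 / n) * \<Psi> l v) else 0)"
  proof (rule sum_mono)
    fix v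
    show "(\<Sum>a\<in>{0..<q}. if conc c' q (Suc l) (v(l := a)) \<ge> k / real_of_int q then P (Suc l) v * \<Psi> (Suc l) (v(l := a)) else 0)
       \<le> (if conc c' q l v \<ge> k / real_of_int q then P l v * ((1 + 1 / n) * \<Psi> l v) else 0)"
    proof (cases "conc c' q l v \<ge> k / real_of_int q")
      case False
      then have "\<not> conc c' q (Suc l) (v(l := a)) \<ge> k / real_of_int q" for a
        using conc_extend_mono[OF q0, of c' l v a] c' by linarith
      then show ?thesis using False by simp
    next
      case True
      have "(\<Sum>a\<in>{0..<q}. if conc c' q (Suc l) (v(l := a)) \<ge> k / real_of_int q then P (Suc l) v * \<Psi> (Suc l) (v(l := a)) else 0)
         \<le> (\<Sum>a\<in>{0..<q}. P (Suc l) v * \<Psi> (Suc l) (v(l := a)))"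
        using P0 \<Psi>0 by (intro sum_mono) auto
      also have "\<dots> = P l v * (conc c q l v * (\<Sum>a\<in>{0..<q}. \<Psi> (Suc l) (v(l := a))))"
        by (simp add: P_def sum_distrib_left mult.assoc)
      also have "\<dots> \<le> P l v * ((1 + 1 / n) * \<Psi> l v)"
        using P0 potential_extend[OF q c k n s m True[unfolded c'_def]] unfolding \<Psi>_def
        by (intro mult_left_mono) auto
      finally show ?thesis using True by simp
    qed
  qed
  also have "\<dots> = (1 + 1 / n) * (\<Sum>v\<in>?G l. P l v * \<Psi> l v)"
    by (subst sum.inter_filter[symmetric]) (auto simp: sum_distrib_left intro!: sum.cong)
  also have "\<dots> \<le> (1 + 1 / n) * (1 + 1 / n) ^ l"
    using Suc unfolding c'_def P_def by (intro mult_left_mono) auto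
  finally show ?case unfolding P_def c'_def by simp
qed

lemma one_plus_inverse_power_le: "l \<le> n \<Longrightarrow> (1 + 1 / real n) ^ l \<le> 3"
proof -
  assume "l \<le> n"
  have "(1 + 1 / real n) ^ l \<le> exp (1 / real n) ^ l"
    using exp_ge_add_one_self[of "1 / real n"] by (intro power_mono) (auto simp: add.commute)
  also have "\<dots> = exp (real l * (1 / real n))" by (rule exp_of_nat_mult[symmetric])
  also have "\<dots> \<le> exp 1" using \<open>l \<le> n\<close> by (auto simp: divide_le_eq)
  also have "\<dots> \<le> 3" using e_less_272 by simp
  finally show ?thesis .
qed

text \<open>
  On the vectors in question the potential is at least \<open>(1 / q) ^ m * 2 ^ \<sigma> / D ^ s\<close>, so dividing by this bound in
  \<open>sum_potential\<close> removes it from the sum.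
\<close>

lemma sum_structured:
  fixes q :: int and k m s n \<sigma> :: nat
  assumes q: "prime q" and c: "c > 0" and k: "k \<ge> 26" and n: "n \<ge> 1" and l: "l \<le> n"
    and s: "(real k)\<^sup>2 * ln (real_of_int q) / c \<le> s"
    and m: "real_of_int q * (1 - chord (c / (real k)\<^sup>2) / 2) ^ m \<le> 1 / k"
  shows "(\<Sum>w\<in>{w\<in>Vec q l. conc (c / (real k)\<^sup>2) q l w \<ge> k / real_of_int q \<and> card (supp q l w) \<ge> \<sigma>}. \<Prod>j<l. conc c q j w)
       \<le> 3 * real_of_int q ^ m * (2 * real_of_int q * real n) ^ s / 2 ^ \<sigma>"
proof -
  have q0: "q > 0" using q prime_gt_0_int by blast
  define D where "D = 2 * real_of_int q * real n"
  have "2 * 1 * 1 \<le> D" unfolding D_def using q0 n by (intro mult_mono) auto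
  then have D: "D \<ge> 1" by simp
  define c' where "c' = c / (real k)\<^sup>2"
  define P where "P = (\<lambda>w. \<Prod>j<l. conc c q j w)"
  have P0: "P w \<ge> 0" for w unfolding P_def by (intro prod_nonneg) (auto simp: less_imp_le conc_pos[OF q0])
  let ?B = "{w\<in>Vec q l. conc c' q l w \<ge> k / real_of_int q \<and> card (supp q l w) \<ge> \<sigma>}"
  let ?\<Psi> = "potential c' q m s D l"
  have \<Psi>0: "?\<Psi> w \<ge> 0" for w
    unfolding potential_def using D conc_pos[OF q0, of c' l w] by (auto simp: less_imp_le)
  have low: "1 \<le> real_of_int q ^ m * D ^ s / 2 ^ \<sigma> * ?\<Psi> w" if w: "w \<in> ?B" for w
  proof -
    have "(1 / real_of_int q) ^ m \<le> conc c' q l w ^ m"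
      using w q0 k by (intro power_mono) (auto intro: order_trans[rotated] simp: divide_right_mono)
    then have "1 \<le> real_of_int q ^ m * conc c' q l w ^ m"
      using q0 by (simp add: power_divide field_simps)
    moreover have "1 \<le> 2 ^ card (supp q l w) / (2::real) ^ \<sigma>" using w by (simp add: power_increasing)
    moreover have "1 \<le> D ^ s / D ^ min (card (supp q l w)) s" using D by (simp add: power_increasing)
    ultimately have "1 * 1 * 1 \<le> (real_of_int q ^ m * conc c' q l w ^ m) * (2 ^ card (supp q l w) / 2 ^ \<sigma>)
        * (D ^ s / D ^ min (card (supp q l w)) s)"
      by (intro mult_mono) auto
    also have "\<dots> = real_of_int q ^ m * D ^ s / 2 ^ \<sigma> * ?\<Psi> w" by (simp add: potential_def)
    finally show ?thesis by simp
  qed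
  have "(\<Sum>w\<in>?B. P w) \<le> (\<Sum>w\<in>?B. real_of_int q ^ m * D ^ s / 2 ^ \<sigma> * (P w * ?\<Psi> w))"
  proof (rule sum_mono)
    fix w assume "w \<in> ?B"
    from mult_left_mono[OF low[OF this] P0[of w]]
    show "P w \<le> real_of_int q ^ m * D ^ s / 2 ^ \<sigma> * (P w * ?\<Psi> w)" by (simp add: mult_ac)
  qed
  also have "\<dots> = real_of_int q ^ m * D ^ s / 2 ^ \<sigma> * (\<Sum>w\<in>?B. P w * ?\<Psi> w)"
    by (simp only: sum_distrib_left)
  also have "\<dots> \<le> real_of_int q ^ m * D ^ s / 2 ^ \<sigma> * 3"
  proof (intro mult_left_mono)
    have "(\<Sum>w\<in>?B. P w * ?\<Psi> w) \<le> (\<Sum>w\<in>{w\<in>Vec q l. conc c' q l w \<ge> k / real_of_int q}. P w * ?\<Psi> w)"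
      using P0 \<Psi>0 by (intro sum_mono2) auto
    also have "\<dots> \<le> (1 + 1 / n) ^ l"
      using sum_potential[OF q c k n s m] unfolding P_def c'_def D_def by simp
    also have "\<dots> \<le> 3" by (rule one_plus_inverse_power_le[OF l])
    finally show "(\<Sum>w\<in>?B. P w * ?\<Psi> w) \<le> 3" .
  qed (use q0 D in auto)
  finally show ?thesis unfolding P_def c'_def D_def by (simp add: mult_ac)
qed

text \<open>
  Weighting each vector with \<open>1 / (q n)\<close> per nonzero coordinate gives total weight at most
  \<open>(1 + 1 / n) ^ l \<le> 3\<close>.
\<close>

lemma card_sparse:
  fixes q :: int
  assumes q: "q > 0" and n: "n \<ge> 1" "l \<le> n"
  shows "real (card {w\<in>Vec q l. card (supp q l w) < \<sigma>}) \<le> 3 * (real_of_int q * real n) ^ \<sigma>"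
proof -
  define D where "D = real_of_int q * real n"
  have "1 * 1 \<le> D" unfolding D_def using q n by (intro mult_mono) auto
  then have D: "D \<ge> 1" by simp
  have sum: "(\<Sum>w\<in>Vec q l. (1 / D) ^ card (supp q l w)) \<le> (1 + 1 / n) ^ l" for l
  proof (induction l)
    case 0
    then show ?case by (simp add: Vec_def supp_def)
  next
    case (Suc l)
    have "(\<Sum>w\<in>Vec q (Suc l). (1 / D) ^ card (supp q (Suc l) w))
       = (\<Sum>v\<in>Vec q l. (1 / D) ^ card (supp q l v) * (\<Sum>a\<in>{0..<q}. (1 / D) ^ (if a = 0 then 0 else 1)))"
      unfolding sum_Vec_Suc sum_distrib_left by (intro sum.cong refl) (simp add: card_supp_Suc_upd)
    also have "\<dots> \<le> (\<Sum>v\<in>Vec q l. (1 / D) ^ card (supp q l v) * (1 + 1 / n))"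
    proof (intro sum_mono mult_left_mono)
      have "(\<Sum>a\<in>{0..<q}. (1 / D) ^ (if a = 0 then 0 else 1)) \<le> (\<Sum>a\<in>{0..<q}. (if a = 0 then 1 else 0) + 1 / D)"
        using D by (intro sum_mono) auto
      also have "\<dots> = 1 + 1 / n" using q n by (simp add: sum.distrib D_def)
      finally show "(\<Sum>a\<in>{0..<q}. (1 / D) ^ (if a = 0 then 0 else 1)) \<le> 1 + 1 / real n" .
    qed (use D in auto)
    also have "\<dots> \<le> (1 + 1 / n) ^ l * (1 + 1 / n)"
      unfolding sum_distrib_right[symmetric] using Suc by (intro mult_right_mono) auto
    finally show ?case by (simp add: mult.commute)
  qed
  let ?B = "{w\<in>Vec q l. card (supp q l w) < \<sigma>}"
  have "real (card ?B) * (1 / D) ^ \<sigma> = (\<Sum>w\<in>?B. (1 / D) ^ \<sigma>)" by simp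
  also have "\<dots> \<le> (\<Sum>w\<in>?B. (1 / D) ^ card (supp q l w))"
    using D by (intro sum_mono power_decreasing) auto
  also have "\<dots> \<le> (\<Sum>w\<in>Vec q l. (1 / D) ^ card (supp q l w))"
    using D by (intro sum_mono2) auto
  also have "\<dots> \<le> 3" using sum[of l] one_plus_inverse_power_le[OF n(2)] by linarith
  finally have "real (card ?B) \<le> 3 * D ^ \<sigma>" using D by (simp add: power_one_over field_simps)
  then show ?thesis unfolding D_def .
qed

text \<open>
  Only the first \<open>l\<close> of the \<open>l + h\<close> coordinates are required to be structured; the other \<open>h\<close> are counted
  trivially, at the cost of \<open>q ^ h\<close>. The first term accounts for vectors with at least \<open>\<sigma>\<close> nonzero coordinates
  among the first \<open>l\<close>, the second one for the sparse vectors.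
\<close>

lemma prob_structured_solution:
  fixes q :: int and k m s n \<sigma> h l :: nat
  assumes q: "prime q" and p: "0 < p" "p < 1" and k: "k \<ge> 26" and n: "l + h \<le> n" "n \<ge> 1"
    and s: "(real k)\<^sup>2 * ln (real_of_int q) / (p * (1 - p)) \<le> s"
    and m: "real_of_int q * (1 - chord (p * (1 - p) / (real k)\<^sup>2) / 2) ^ m \<le> 1 / k"
  shows "prob (erdos_renyi (l + h) p)
      {E. \<exists>w\<in>Vec q (l + h). supp q (l + h) w \<noteq> {} \<and> conc (p * (1 - p) / (real k)\<^sup>2) q l w \<ge> k / real_of_int q
           \<and> solves q a E (l + h) w u}
    \<le> real_of_int q ^ h * (3 * real_of_int q ^ m * (2 * real_of_int q * real n) ^ s / 2 ^ \<sigma>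
         + 3 * (real_of_int q * real n) ^ \<sigma> * max (max p (1 - p)) (1 - chord (p * (1 - p))) ^ (l + h - 1))"
proof -
  have q0: "q > 0" using q prime_gt_0_int by blast
  define c where "c = p * (1 - p)"
  have c: "c > 0" using p by (simp add: c_def)
  define \<zeta> where "\<zeta> = max (max p (1 - p)) (1 - chord c)"
  have \<zeta>0: "\<zeta> \<ge> 0" using p by (simp add: \<zeta>_def)
  define P where "P = (\<lambda>w. prob (erdos_renyi (l + h) p) {E. solves q a E (l + h) w u})"
  define A where "A = {w\<in>Vec q (l + h). conc (c / (real k)\<^sup>2) q l w \<ge> k / real_of_int q \<and> card (supp q l w) \<ge> \<sigma>}"
  define B where "B = {w\<in>Vec q (l + h). supp q (l + h) w \<noteq> {} \<and> card (supp q l w) < \<sigma>}"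
  have fin: "finite A" "finite B" by (auto simp: A_def B_def)
  have "prob (erdos_renyi (l + h) p)
      {E. \<exists>w\<in>Vec q (l + h). supp q (l + h) w \<noteq> {} \<and> conc (c / (real k)\<^sup>2) q l w \<ge> k / real_of_int q
           \<and> solves q a E (l + h) w u}
    \<le> prob (erdos_renyi (l + h) p) (\<Union>w\<in>A \<union> B. {E. solves q a E (l + h) w u})"
  proof (intro measure_pmf.finite_measure_mono subsetI)
    fix E
    assume "E \<in> {E. \<exists>w\<in>Vec q (l + h). supp q (l + h) w \<noteq> {} \<and> conc (c / (real k)\<^sup>2) q l w \<ge> k / real_of_int q
           \<and> solves q a E (l + h) w u}"
    then obtain w where w: "w \<in> Vec q (l + h)" "supp q (l + h) w \<noteq> {}"
      "conc (c / (real k)\<^sup>2) q l w \<ge> k / real_of_int q" "solves q a E (l + h) w u" by blast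
    then have "w \<in> A \<union> B" by (cases "card (supp q l w) < \<sigma>") (simp_all add: A_def B_def)
    then show "E \<in> (\<Union>w\<in>A \<union> B. {E. solves q a E (l + h) w u})" using w(4) by blast
  qed simp
  also have "\<dots> \<le> (\<Sum>w\<in>A \<union> B. P w)"
    unfolding P_def using fin by (intro measure_pmf.finite_measure_subadditive_finite) auto
  also have "\<dots> \<le> (\<Sum>w\<in>A. P w) + (\<Sum>w\<in>B. P w)"
    using sum.union_inter[OF fin, of P] sum_nonneg[of "A \<inter> B" P] by (simp add: P_def)
  also have "(\<Sum>w\<in>A. P w) \<le> real_of_int q ^ h * (3 * real_of_int q ^ m * (2 * real_of_int q * real n) ^ s / 2 ^ \<sigma>)"
  proof -
    define F where "F = (\<lambda>w. if conc (c / (real k)\<^sup>2) q l w \<ge> k / real_of_int q \<and> card (supp q l w) \<ge> \<sigma>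
        then \<Prod>j<l. conc c q j w else 0)"
    have "P w \<le> (\<Prod>j<l. conc c q j w)" for w
    proof -
      have "P w \<le> (\<Prod>j<l + h. conc c q j w)"
        unfolding P_def c_def using p by (intro prob_solves_le_prod q0) auto
      also have "{..<l + h} = {..<l} \<union> {l..<l + h}" by auto
      also have "(\<Prod>j\<in>\<dots>. conc c q j w) = (\<Prod>j<l. conc c q j w) * (\<Prod>j\<in>{l..<l + h}. conc c q j w)"
        by (rule prod.union_disjoint) auto
      also have "\<dots> \<le> (\<Prod>j<l. conc c q j w) * 1"
        using conc_le_1[OF q0, of c] conc_pos[OF q0] c
        by (intro mult_left_mono prod_le_1 prod_nonneg) (auto simp: less_imp_le)
      finally show ?thesis by simp
    qed
    then have "(\<Sum>w\<in>A. P w) \<le> (\<Sum>w\<in>A. \<Prod>j<l. conc c q j w)" by (intro sum_mono)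
    also have "\<dots> = (\<Sum>w\<in>Vec q (l + h). F w)"
      unfolding A_def F_def by (rule sum.inter_filter) simp
    also have "\<dots> = real_of_int q ^ h * (\<Sum>w\<in>Vec q l. F w)"
    proof (rule sum_Vec_free_coords[OF q0])
      fix v :: "nat \<Rightarrow> int" and i b assume i: "l \<le> i"
      have "(\<Prod>j<l. conc c q j (v(i := b))) = (\<Prod>j<l. conc c q j v)"
        using i by (intro prod.cong refl conc_upd_ge) auto
      then show "F (v(i := b)) = F v" unfolding F_def using i by (simp add: conc_upd_ge supp_upd)
    qed
    also have "(\<Sum>w\<in>Vec q l. F w)
      = (\<Sum>w\<in>{w\<in>Vec q l. conc (c / (real k)\<^sup>2) q l w \<ge> k / real_of_int q \<and> card (supp q l w) \<ge> \<sigma>}. \<Prod>j<l. conc c q j w)"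
      unfolding F_def by (rule sum.inter_filter[symmetric]) simp
    also have "\<dots> \<le> 3 * real_of_int q ^ m * (2 * real_of_int q * real n) ^ s / 2 ^ \<sigma>"
      using s m n unfolding c_def[symmetric] by (intro sum_structured[OF q c k]) auto
    finally show ?thesis using q0 by (simp add: mult_left_mono)
  qed
  also have "(\<Sum>w\<in>B. P w) \<le> real_of_int q ^ h * (3 * (real_of_int q * real n) ^ \<sigma> * \<zeta> ^ (l + h - 1))"
  proof -
    have "(\<Sum>w\<in>B. P w) \<le> (\<Sum>w\<in>B. \<zeta> ^ (l + h - 1))"
      unfolding P_def \<zeta>_def c_def by (intro sum_mono prob_solves_nonzero q0 p) (auto simp: B_def)
    also have "\<dots> = real (card B) * \<zeta> ^ (l + h - 1)" by simp
    also have "\<dots> \<le> real_of_int q ^ h * (3 * (real_of_int q * real n) ^ \<sigma>) * \<zeta> ^ (l + h - 1)"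
    proof (intro mult_right_mono)
      define F where "F = (\<lambda>w. if card (supp q l w) < \<sigma> then 1 else 0 :: real)"
      have "real (card B) \<le> real (card {w\<in>Vec q (l + h). card (supp q l w) < \<sigma>})"
        unfolding B_def by (intro of_nat_mono card_mono) auto
      also have "\<dots> = (\<Sum>w\<in>Vec q (l + h). F w)"
        unfolding F_def by (subst sum.inter_filter[symmetric]) auto
      also have "\<dots> = real_of_int q ^ h * (\<Sum>w\<in>Vec q l. F w)"
        by (rule sum_Vec_free_coords[OF q0]) (simp add: F_def supp_upd)
      also have "(\<Sum>w\<in>Vec q l. F w) = real (card {w\<in>Vec q l. card (supp q l w) < \<sigma>})"
        unfolding F_def by (subst sum.inter_filter[symmetric]) auto
      also have "\<dots> \<le> 3 * (real_of_int q * real n) ^ \<sigma>"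
        using n by (intro card_sparse q0) auto
      finally show "real (card B) \<le> real_of_int q ^ h * (3 * (real_of_int q * real n) ^ \<sigma>)"
        using q0 by (simp add: mult_left_mono)
    qed (use \<zeta>0 in auto)
    finally show ?thesis by (simp add: mult.assoc)
  qed
  finally show ?thesis unfolding c_def \<zeta>_def by (simp add: distrib_left)
qed

section \<open>Kernels modulo a prime under insertion of a vertex\<close>

definition singular_mod :: "int \<Rightarrow> int \<Rightarrow> nat set set \<Rightarrow> nat \<Rightarrow> bool" where
  "singular_mod q a E l \<longleftrightarrow> (\<exists>w\<in>Vec q l. supp q l w \<noteq> {} \<and> solves q a E l w (\<lambda>_. 0))"

definition Ker :: "int \<Rightarrow> int \<Rightarrow> nat set set \<Rightarrow> nat \<Rightarrow> (nat \<Rightarrow> int) set" where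
  "Ker q a E l = {w\<in>Vec q l. solves q a E l w (\<lambda>_. 0)}"

definition reduce :: "int \<Rightarrow> nat \<Rightarrow> (nat \<Rightarrow> int) \<Rightarrow> nat \<Rightarrow> int" where
  "reduce q l w = (\<lambda>i\<in>{..<l}. w i mod q)"

lemma reduce_in_Vec: "q > 0 \<Longrightarrow> reduce q l w \<in> Vec q l"
  by (auto simp: reduce_def Vec_def)

lemma reduce_cong: "i < l \<Longrightarrow> [reduce q l w i = w i] (mod q)"
  by (simp add: reduce_def cong_def)

lemma Vec_memD: "w \<in> Vec q l \<Longrightarrow> i < l \<Longrightarrow> w i \<in> {0..<q}"
  using PiE_mem[of w "{..<l}" "\<lambda>_. {0..<q}" i] by (simp add: Vec_def)

lemma Vec_eqI:
  assumes "v \<in> Vec q l" "w \<in> Vec q l" "\<And>i. i < l \<Longrightarrow> [v i = w i] (mod q)"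
  shows "v = w"
proof (rule PiE_ext)
  show "v \<in> PiE {..<l} (\<lambda>_. {0..<q})" "w \<in> PiE {..<l} (\<lambda>_. {0..<q})"
    using assms(1,2) unfolding Vec_def .
  fix i assume "i \<in> {..<l}"
  then have i: "i < l" by simp
  show "v i = w i"
    using assms(3)[OF i] Vec_memD[OF assms(1) i] Vec_memD[OF assms(2) i] by (simp add: cong_def)
qed

lemma shift_mult_cong:
  assumes "\<And>j. j < l \<Longrightarrow> [v j = w j] (mod q)" "i < l"
  shows "[shift_mult E a l v i = shift_mult E a l w i] (mod q)"
  unfolding shift_mult_def using assms by (intro cong_diff cong_sum cong_mult) auto

lemma solves_cong:
  assumes "\<And>j. j < l \<Longrightarrow> [v j = w j] (mod q)"
  shows "solves q a E l v u \<longleftrightarrow> solves q a E l w u"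
proof -
  have "[shift_mult E a l v i = u i] (mod q) \<longleftrightarrow> [shift_mult E a l w i = u i] (mod q)" if "i < l" for i
    using shift_mult_cong[OF assms that] by (auto simp: cong_def)
  then show ?thesis unfolding solves_def by blast
qed

lemma solves_reduce: "solves q a E l (reduce q l w) u \<longleftrightarrow> solves q a E l w u"
  by (rule solves_cong) (rule reduce_cong)

lemma shift_mult_lincomb: "shift_mult E a l (\<lambda>i. v i + t * w i) i = shift_mult E a l v i + t * shift_mult E a l w i"
  by (simp add: shift_mult_def algebra_simps sum.distrib sum_distrib_left)

lemma solves_lincomb:
  assumes "solves q a E l v u" "solves q a E l w u'"
  shows "solves q a E l (\<lambda>i. v i + t * w i) (\<lambda>i. u i + t * u' i)"
  using assms unfolding solves_def shift_mult_lincomb by (auto intro!: cong_add cong_mult)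

lemma dot_lincomb: "dot l x (\<lambda>i. v i + t * w i) = dot l x v + t * dot l x w"
  unfolding dot_def by (simp add: sum_distrib_left sum.distrib[symmetric] if_distrib cong: if_cong sum.cong)

lemma dot_cong: "(\<And>i. i < l \<Longrightarrow> [v i = w i] (mod q)) \<Longrightarrow> [dot l x v = dot l x w] (mod q)"
  unfolding dot_def by (intro cong_sum) auto

lemma shift_mult_symmetric: "(\<Sum>i<l. w i * shift_mult E a l v i) = (\<Sum>i<l. v i * shift_mult E a l w i)"
proof -
  have "(\<Sum>i<l. w i * (\<Sum>j<l. adj E i j * v j)) = (\<Sum>i<l. \<Sum>j<l. w i * adj E i j * v j)"
    by (simp add: sum_distrib_left mult.assoc)
  also have "\<dots> = (\<Sum>j<l. \<Sum>i<l. w i * adj E i j * v j)" by (rule sum.swap)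
  also have "\<dots> = (\<Sum>j<l. v j * (\<Sum>i<l. adj E j i * w i))"
    by (simp add: sum_distrib_left adj_commute mult_ac)
  finally have "(\<Sum>i<l. w i * (\<Sum>j<l. adj E i j * v j)) = (\<Sum>i<l. v i * (\<Sum>j<l. adj E i j * w j))" .
  then show ?thesis by (simp add: shift_mult_def right_diff_distrib sum_subtractf mult_ac)
qed

lemma solves_pairing:
  assumes "solves q a E l v u" "solves q a E l w u'"
  shows "[(\<Sum>i<l. w i * u i) = (\<Sum>i<l. v i * u' i)] (mod q)"
proof -
  have "[(\<Sum>i<l. w i * u i) = (\<Sum>i<l. w i * shift_mult E a l v i)] (mod q)"
    using assms(1) unfolding solves_def by (intro cong_sum cong_mult) (auto intro: cong_sym)
  also have "(\<Sum>i<l. w i * shift_mult E a l v i) = (\<Sum>i<l. v i * shift_mult E a l w i)" by (rule shift_mult_symmetric)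
  also have "[\<dots> = (\<Sum>i<l. v i * u' i)] (mod q)"
    using assms(2) unfolding solves_def by (intro cong_sum cong_mult) auto
  finally show ?thesis .
qed

lemma supp_empty_iff: "supp q l w = {} \<longleftrightarrow> (\<forall>i<l. [w i = 0] (mod q))"
  by (auto simp: supp_def cong_0_iff)

lemma supp_reduce: "supp q l (reduce q l w) = supp q l w"
  by (auto simp: supp_def reduce_def dvd_mod_iff)

lemma nonsingular_imp_zero:
  assumes "q > 0" "\<not> singular_mod q a E l" "solves q a E l w (\<lambda>_. 0)" "i < l"
  shows "[w i = 0] (mod q)"
proof -
  have "supp q l w = {}"
    using assms reduce_in_Vec[of q l w] supp_reduce[of q l w] solves_reduce[of q a E l w "\<lambda>_. 0"]
    unfolding singular_mod_def by metis
  then show ?thesis using assms(4) supp_empty_iff by blast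
qed

lemma nonsingular_unique:
  assumes "q > 0" "\<not> singular_mod q a E l" "solves q a E l v u" "solves q a E l w u" "i < l"
  shows "[v i = w i] (mod q)"
proof -
  have "solves q a E l (\<lambda>i. v i + (- 1) * w i) (\<lambda>i. u i + (- 1) * u i)"
    by (rule solves_lincomb[OF assms(3,4)])
  then have "solves q a E l (\<lambda>i. v i + (- 1) * w i) (\<lambda>_. 0)" by simp
  from nonsingular_imp_zero[OF assms(1,2) this assms(5)]
  show ?thesis by (simp add: cong_iff_dvd_diff)
qed

lemma finite_Ker [simp]: "finite (Ker q a E l)"
  by (simp add: Ker_def)

lemma card_Ker_le:
  assumes "q > 0" shows "card (Ker q a E l) \<le> nat q ^ l"
  unfolding card_Vec[OF assms, of l, symmetric] by (rule card_mono) (auto simp: Ker_def)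

lemma singular_imp_card_Ker:
  assumes q: "q > 0" and "singular_mod q a E l"
  shows "card (Ker q a E l) > 1"
proof -
  obtain w where w: "w \<in> Ker q a E l" "supp q l w \<noteq> {}"
    using assms unfolding singular_mod_def Ker_def by auto
  define z where "z = reduce q l (\<lambda>_. 0)"
  have z: "z \<in> Ker q a E l"
    unfolding Ker_def z_def using reduce_in_Vec[OF q] by (simp add: solves_reduce) (simp add: solves_def shift_mult_def)
  have "supp q l z = {}" unfolding z_def supp_reduce by (simp add: supp_def)
  then have "z \<noteq> w" using w by auto
  then have "card {z, w} = 2" by simp
  moreover have "card {z, w} \<le> card (Ker q a E l)" using w z by (intro card_mono) auto
  ultimately show ?thesis by linarith
qed

text \<open>
  A kernel vector of the extended matrix is determined by its last coordinate.
\<close>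

lemma card_Ker_ext_nonsingular:
  assumes q: "q > 0" and E: "E \<subseteq> possible_edges l" and ns: "\<not> singular_mod q a E l"
  shows "card (Ker q a (ext_graph E l x) (Suc l)) \<le> nat q"
proof -
  have "card (Ker q a (ext_graph E l x) (Suc l)) \<le> card {0..<q}"
  proof (rule card_inj_on_le[of "\<lambda>w. w l"])
    show "(\<lambda>w. w l) ` Ker q a (ext_graph E l x) (Suc l) \<subseteq> {0..<q}"
      unfolding Ker_def using Vec_memD[of _ q "Suc l" l] by blast
    show "inj_on (\<lambda>w. w l) (Ker q a (ext_graph E l x) (Suc l))"
    proof (rule inj_onI)
      fix v w
      assume vw: "v \<in> Ker q a (ext_graph E l x) (Suc l)" "w \<in> Ker q a (ext_graph E l x) (Suc l)" "v l = w l"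
      then have "solves q a E l v (\<lambda>i. 0 - (if x i then v l else 0))" "solves q a E l w (\<lambda>i. 0 - (if x i then w l else 0))"
        unfolding Ker_def mem_Collect_eq solves_ext[OF E] by blast+
      from nonsingular_unique[OF q ns this[folded vw(3)]] have "\<And>i. i < l \<Longrightarrow> [v i = w i] (mod q)" .
      then show "v = w" using vw by (intro Vec_eqI[of v q "Suc l" w]) (auto simp: Ker_def less_Suc_eq)
    qed
  qed simp
  then show ?thesis by simp
qed

text \<open>
  Pairing a kernel vector of the extended matrix with \<open>w0\<close> shows that its last coordinate vanishes. So it
  is a kernel vector of the old matrix which is orthogonal to \<open>x\<close>; adding multiples of \<open>w0\<close>, which is not
  orthogonal to \<open>x\<close>, yields \<open>q\<close> distinct kernel vectors of the old matrix for each one of the new matrix.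
\<close>

lemma card_Ker_ext_le:
  assumes q: "prime q" and E: "E \<subseteq> possible_edges l" and w0: "solves q a E l w0 (\<lambda>_. 0)"
    and x: "\<not> [dot l x w0 = 0] (mod q)"
  shows "card (Ker q a (ext_graph E l x) (Suc l)) * nat q \<le> card (Ker q a E l)"
proof -
  have q0: "q > 0" using q prime_gt_0_int by blast
  let ?K = "Ker q a (ext_graph E l x) (Suc l)"
  have K: "w l = 0 \<and> solves q a E l w (\<lambda>_. 0) \<and> [dot l x w = 0] (mod q)" if w: "w \<in> ?K" for w
  proof -
    have s: "solves q a E l w (\<lambda>i. 0 - (if x i then w l else 0))" "[dot l x w = 0 + a * w l] (mod q)"
      using w by (auto simp: Ker_def solves_ext[OF E])
    have "[(\<Sum>i<l. w0 i * (0 - (if x i then w l else 0))) = (\<Sum>i<l. w i * 0)] (mod q)"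
      by (rule solves_pairing[OF s(1) w0])
    moreover have "(\<Sum>i<l. w0 i * (0 - (if x i then w l else 0))) = - (w l * dot l x w0)"
      by (auto simp: dot_def sum_distrib_left sum_negf[symmetric] intro!: sum.cong)
    ultimately have "q dvd w l * dot l x w0" by (simp add: cong_0_iff)
    then have "q dvd w l" using x q by (auto simp: prime_dvd_mult_iff cong_0_iff)
    moreover have "w l \<in> {0..<q}" using w Vec_memD[of w q "Suc l" l] by (simp add: Ker_def)
    ultimately have "w l = 0" using zdvd_not_zless[of "w l" q] by force
    moreover from this have "(\<lambda>i. 0 - (if x i then w l else 0)) = (\<lambda>_. 0)" by auto
    ultimately show ?thesis using s by simp
  qed
  have "card (?K \<times> {0..<q}) \<le> card (Ker q a E l)"
  proof (rule card_inj_on_le[of "\<lambda>(w, t). reduce q l (\<lambda>i. w i + t * w0 i)"])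
    show "(\<lambda>(w, t). reduce q l (\<lambda>i. w i + t * w0 i)) ` (?K \<times> {0..<q}) \<subseteq> Ker q a E l"
    proof clarify
      fix w t assume "w \<in> ?K"
      then have "solves q a E l w (\<lambda>_. 0)" using K by blast
      from solves_lincomb[OF this w0, of t]
      show "reduce q l (\<lambda>i. w i + t * w0 i) \<in> Ker q a E l"
        unfolding Ker_def by (simp add: solves_reduce reduce_in_Vec[OF q0])
    qed
    show "inj_on (\<lambda>(w, t). reduce q l (\<lambda>i. w i + t * w0 i)) (?K \<times> {0..<q})"
    proof (rule inj_onI, clarify)
      fix v s w t assume v: "v \<in> ?K" and w: "w \<in> ?K" and s: "s \<in> {0..<q}" and t: "t \<in> {0..<q}"
        and eq: "reduce q l (\<lambda>i. v i + s * w0 i) = reduce q l (\<lambda>i. w i + t * w0 i)"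
      have c: "[v i + s * w0 i = w i + t * w0 i] (mod q)" if "i < l" for i
        using fun_cong[OF eq, of i] that by (simp add: reduce_def cong_def)
      then have "[dot l x (\<lambda>i. v i + s * w0 i) = dot l x (\<lambda>i. w i + t * w0 i)] (mod q)"
        by (rule dot_cong)
      then have "[dot l x v + s * dot l x w0 = dot l x w + t * dot l x w0] (mod q)"
        by (simp only: dot_lincomb)
      moreover have "[dot l x v = 0] (mod q)" "[dot l x w = 0] (mod q)" using K[OF v] K[OF w] by simp_all
      then have "[dot l x v = dot l x w] (mod q)" by (rule cong_trans[OF _ cong_sym])
      ultimately have "[(dot l x v + s * dot l x w0) - dot l x v = (dot l x w + t * dot l x w0) - dot l x w] (mod q)"
        by (rule cong_diff)
      then have "[s * dot l x w0 = t * dot l x w0] (mod q)" by simp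
      then have "q dvd (s - t) * dot l x w0" by (simp add: cong_iff_dvd_diff left_diff_distrib)
      then have "[s = t] (mod q)" using x q by (auto simp: prime_dvd_mult_iff cong_0_iff cong_iff_dvd_diff)
      then have st: "s = t" using s t by (simp add: cong_def)
      have "[v i = w i] (mod q)" if "i < Suc l" for i
      proof (cases "i = l")
        case True then show ?thesis using K[OF v] K[OF w] by simp
      next
        case False
        then have "i < l" using that by simp
        from c[OF this] show ?thesis unfolding st by (simp add: cong_add_rcancel)
      qed
      then have "v = w" using v w by (intro Vec_eqI[of v q "Suc l" w]) (auto simp: Ker_def)
      then show "v = w \<and> s = t" using st by simp
    qed
  qed simp
  then show ?thesis by (simp add: card_cartesian_product)
qed

text \<open>
  The last \<open>h\<close> coordinates are left out of the structure condition because the bits at these positions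
  are spent on resampling.
\<close>

definition structured_sol :: "int \<Rightarrow> int \<Rightarrow> real \<Rightarrow> real \<Rightarrow> nat \<Rightarrow> nat \<Rightarrow> (nat \<Rightarrow> int) \<Rightarrow> nat set set \<Rightarrow> bool" where
  "structured_sol q a c \<tau> h l u E \<longleftrightarrow>
     (\<exists>w\<in>Vec q l. supp q l w \<noteq> {} \<and> conc c q (l - h) w \<ge> \<tau> \<and> solves q a E l w u)"

lemma prob_dot_le:
  assumes q: "q > 0" and p: "0 \<le> p" "p \<le> 1" and c: "0 \<le> c" "c \<le> p * (1 - p)" and "j \<le> l"
  shows "prob (bits p l) {x. [dot l x w = b] (mod q)} \<le> conc c q j w"
proof -
  have "prob (bits p l) {x. [dot l x w = b] (mod q)} \<le> conc (p * (1 - p)) q l w"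
    by (rule prob_dot_eq_le_conc[OF q p])
  also have "\<dots> \<le> conc c q l w" by (rule conc_antimono_exp[OF c(2) q])
  also have "\<dots> \<le> conc c q j w" by (rule conc_antimono_len[OF assms(6) c(1) q])
  finally show ?thesis .
qed

lemma prob_no_corank_drop:
  assumes q: "prime q" and p: "0 \<le> p" "p \<le> 1" and c: "0 \<le> c" "c \<le> p * (1 - p)"
    and E: "E \<subseteq> possible_edges l" and sing: "singular_mod q a E l"
    and ns: "\<not> structured_sol q a c \<tau> h l (\<lambda>_. 0) E"
  shows "prob (bits p l) {x. card (Ker q a (ext_graph E l x) (Suc l)) * nat q > card (Ker q a E l)} \<le> \<tau>"
proof -
  have q0: "q > 0" using q prime_gt_0_int by blast
  obtain w0 where w0: "w0 \<in> Vec q l" "supp q l w0 \<noteq> {}" "solves q a E l w0 (\<lambda>_. 0)"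
    using sing unfolding singular_mod_def by blast
  then have small: "conc c q (l - h) w0 < \<tau>" using ns unfolding structured_sol_def by force
  have "prob (bits p l) {x. card (Ker q a (ext_graph E l x) (Suc l)) * nat q > card (Ker q a E l)}
      \<le> prob (bits p l) {x. [dot l x w0 = 0] (mod q)}"
    using card_Ker_ext_le[OF q E w0(3)] by (intro measure_pmf.finite_measure_mono) (auto simp: not_less[symmetric])
  also have "\<dots> \<le> conc c q (l - h) w0" by (rule prob_dot_le[OF q0 p c]) simp
  finally show ?thesis using small by simp
qed

text \<open>
  Kernel sizes replace the corank. A kernel with more than \<open>q ^ r\<close> elements after the insertion requires a
  kernel \<open>q\<close> times as large before it, unless a structured kernel vector exists or the new row happens to be
  orthogonal to an unstructured one.
\<close>

lemma prob_corank_step: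
  assumes q: "prime q" and p: "0 \<le> p" "p \<le> 1" and c: "0 \<le> c" "c \<le> p * (1 - p)" and r: "r \<ge> 1" and \<tau>: "\<tau> \<ge> 0"
    and bad: "prob (erdos_renyi l p) {E. structured_sol q a c \<tau> h l (\<lambda>_. 0) E} \<le> \<beta>"
  shows "prob (erdos_renyi (Suc l) p) {E. card (Ker q a E (Suc l)) > nat q ^ r}
      \<le> prob (erdos_renyi l p) {E. card (Ker q a E l) > nat q ^ Suc r} + \<beta> + \<tau>"
proof -
  have q0: "q > 0" "q > 1" using q prime_gt_0_int prime_gt_1_int by blast+
  let ?A = "{E. card (Ker q a E l) > nat q ^ Suc r}" and ?B = "{E. structured_sol q a c \<tau> h l (\<lambda>_. 0) E}"
  have "prob (erdos_renyi (Suc l) p) {E. card (Ker q a E (Suc l)) > nat q ^ r}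
     \<le> prob (erdos_renyi l p) (?A \<union> ?B) * 1 + \<tau>"
    unfolding erdos_renyi_Suc
  proof (rule prob_bind_le)
    fix E assume "E \<in> set_pmf (erdos_renyi l p)"
    then have E: "E \<subseteq> possible_edges l" by (rule set_erdos_renyi)
    show "prob (map_pmf (ext_graph E l) (bits p l)) {E. card (Ker q a E (Suc l)) > nat q ^ r}
        \<le> indicator (?A \<union> ?B) E * 1 + \<tau>"
    proof (cases "E \<in> ?A \<union> ?B")
      case True
      then show ?thesis using \<tau> measure_pmf.prob_le_1[of "map_pmf (ext_graph E l) (bits p l)"] by (simp add: add_increasing2)
    next
      case False
      show ?thesis
      proof (cases "singular_mod q a E l")
        case True
        have "prob (map_pmf (ext_graph E l) (bits p l)) {E. card (Ker q a E (Suc l)) > nat q ^ r}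
           \<le> prob (bits p l) {x. card (Ker q a (ext_graph E l x) (Suc l)) * nat q > card (Ker q a E l)}"
          unfolding measure_map_pmf
        proof (intro measure_pmf.finite_measure_mono subsetI)
          fix x assume "x \<in> ext_graph E l -` {E. card (Ker q a E (Suc l)) > nat q ^ r}"
          then have "nat q ^ r * nat q < card (Ker q a (ext_graph E l x) (Suc l)) * nat q" using q0 by simp
          moreover have "card (Ker q a E l) \<le> nat q ^ r * nat q" using False by (auto simp: mult.commute)
          ultimately show "x \<in> {x. card (Ker q a (ext_graph E l x) (Suc l)) * nat q > card (Ker q a E l)}"
            unfolding mem_Collect_eq by (rule le_less_trans[rotated])
        qed simp
        also have "\<dots> \<le> \<tau>" using prob_no_corank_drop[OF q p c E True] False by blast
        finally show ?thesis by (simp add: add_increasing)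
      next
        case ns: False
        have "nat q ^ 1 \<le> nat q ^ r" using r q0 by (intro power_increasing) auto
        then have "ext_graph E l -` {E. card (Ker q a E (Suc l)) > nat q ^ r} = {}"
          using card_Ker_ext_nonsingular[OF q0(1) E ns] by (auto simp: not_less intro: order_trans)
        then show ?thesis using \<tau> by (simp add: measure_map_pmf)
      qed
    qed
  qed
  also have "prob (erdos_renyi l p) (?A \<union> ?B)
      \<le> prob (erdos_renyi l p) ?A + prob (erdos_renyi l p) ?B"
    by (rule measure_Un_le) auto
  finally show ?thesis using bad by simp
qed

text \<open>
  Outside the exceptional events, going back \<open>i\<close> vertices would force a kernel with more than \<open>q ^ (r + i)\<close>
  elements, which is impossible when \<open>l \<le> r + i\<close>. For \<open>r = 1\<close> this says that corank at least 2 is unlikely.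
\<close>

lemma prob_corank_ge_2:
  assumes q: "prime q" and p: "0 \<le> p" "p \<le> 1" and c: "0 \<le> c" "c \<le> p * (1 - p)" and \<tau>: "\<tau> \<ge> 0"
    and bad: "\<And>j. l \<le> j \<Longrightarrow> j < l + i \<Longrightarrow>
       prob (erdos_renyi j p) {E. structured_sol q a c \<tau> h j (\<lambda>_. 0) E} \<le> \<beta>"
    and r: "r \<ge> 1" and li: "l \<le> r + i"
  shows "prob (erdos_renyi (l + i) p) {E. card (Ker q a E (l + i)) > nat q ^ r} \<le> i * (\<beta> + \<tau>)"
  using bad r li
proof (induction i arbitrary: r)
  case 0
  have q0: "q > 0" using q prime_gt_0_int by blast
  have "nat q ^ l \<le> nat q ^ r" using 0 q0 by (intro power_increasing) auto
  then have "{E. card (Ker q a E (l + 0)) > nat q ^ r} = {}"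
    using card_Ker_le[OF q0, of a _ l] by (auto simp: not_less intro: order_trans)
  then show ?case by simp
next
  case (Suc i)
  have "prob (erdos_renyi (Suc (l + i)) p) {E. card (Ker q a E (Suc (l + i))) > nat q ^ r}
     \<le> prob (erdos_renyi (l + i) p) {E. card (Ker q a E (l + i)) > nat q ^ Suc r} + \<beta> + \<tau>"
    by (rule prob_corank_step[OF q p c Suc.prems(2) \<tau>]) (rule Suc.prems(1), auto)
  also have "prob (erdos_renyi (l + i) p) {E. card (Ker q a E (l + i)) > nat q ^ Suc r} \<le> i * (\<beta> + \<tau>)"
    by (rule Suc.IH) (use Suc.prems in auto)
  finally show ?case by (simp add: algebra_simps)
qed

section \<open>Singularity modulo a prime\<close>

lemma pair_pmf_conv_bind: "pair_pmf M N = bind_pmf M (\<lambda>x. map_pmf (Pair x) N)"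
  by (simp add: pair_pmf_def map_pmf_def)

lemma prob_pair_times:
  "prob (pair_pmf M N) (S \<times> T) = prob M S * prob N T"
proof -
  have "Pair x -` (S \<times> T) = (if x \<in> S then T else {})" for x by auto
  then have "prob (map_pmf (Pair x) N) (S \<times> T) = indicator S x * prob N T" for x
    by (simp add: measure_map_pmf)
  then show ?thesis unfolding pair_pmf_conv_bind prob_bind_pmf by simp
qed

text \<open>
  Cauchy-Schwarz, or rather nonnegativity of the variance of the conditional probability given the first
  component.
\<close>

lemma prob_pair_resample:
  "(prob (pair_pmf M N) S)\<^sup>2
     \<le> prob (pair_pmf M (pair_pmf N N)) {(m, z, z'). (m, z) \<in> S \<and> (m, z') \<in> S}"
proof -
  define f where "f = (\<lambda>m. prob N {z. (m, z) \<in> S})"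
  have int: "integrable (measure_pmf M) f" "integrable (measure_pmf M) (\<lambda>m. (f m)\<^sup>2)"
    unfolding f_def by (rule measure_pmf.integrable_const_bound[where B = 1]; simp add: power_le_one)+
  have pair: "prob (pair_pmf M L) T = measure_pmf.expectation M (\<lambda>m. prob L {z. (m, z) \<in> T})"
    for L :: "'c pmf" and T
  proof -
    have "pair_pmf M L = bind_pmf M (\<lambda>m. map_pmf (Pair m) L)" by (simp add: pair_pmf_def map_pmf_def)
    then show ?thesis by (simp add: prob_bind_pmf measure_map_pmf vimage_def)
  qed
  have "(prob (pair_pmf M N) S)\<^sup>2 = (measure_pmf.expectation M f)\<^sup>2"
    unfolding pair f_def ..
  also have "\<dots> \<le> measure_pmf.expectation M (\<lambda>m. (f m)\<^sup>2)"
    using measure_pmf.variance_positive[of M f] measure_pmf.variance_eq[OF int] by simp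
  also have "\<dots> = prob (pair_pmf M (pair_pmf N N)) {(m, z, z'). (m, z) \<in> S \<and> (m, z') \<in> S}"
  proof -
    have "prob (pair_pmf N N) {zz'. (m, zz') \<in> {(m, z, z'). (m, z) \<in> S \<and> (m, z') \<in> S}} = (f m)\<^sup>2" for m
    proof -
      have "{zz'. (m, zz') \<in> {(m, z, z'). (m, z) \<in> S \<and> (m, z') \<in> S}} = {z. (m, z) \<in> S} \<times> {z. (m, z) \<in> S}" by auto
      then show ?thesis unfolding f_def power2_eq_square by (simp only: prob_pair_times)
    qed
    then show ?thesis unfolding pair by simp
  qed
  finally show ?thesis .
qed

text \<open>
  The bits of a new row at the positions \<open>j, \<dots>, j + h - 1\<close>, which are to be resampled.
\<close>

definition tail_bits :: "real \<Rightarrow> nat \<Rightarrow> nat \<Rightarrow> (nat \<Rightarrow> bool) pmf" where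
  "tail_bits p j h = Pi_pmf {j..<j + h} False (\<lambda>_. bernoulli_pmf p)"

lemma bits_split:
  "bits p (j + h) = map_pmf (\<lambda>(y, z) i. if i < j then y i else z i) (pair_pmf (bits p j) (tail_bits p j h))"
proof -
  have "{..<j + h} = {..<j} \<union> {j..<j + h}" by auto
  then show ?thesis unfolding bits_def tail_bits_def by (simp add: Pi_pmf_union ivl_disj_int)
qed

lemma pmf_tail_bits_le:
  assumes "0 \<le> p" "p \<le> 1"
  shows "pmf (tail_bits p j h) z \<le> max p (1 - p) ^ h"
proof (cases "\<forall>i. i \<notin> {j..<j + h} \<longrightarrow> z i = False")
  case True
  then have "pmf (tail_bits p j h) z = (\<Prod>i\<in>{j..<j + h}. pmf (bernoulli_pmf p) (z i))"
    unfolding tail_bits_def by (subst pmf_Pi) auto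
  also have "\<dots> \<le> (\<Prod>i\<in>{j..<j + h}. max p (1 - p))"
  proof (intro prod_mono conjI)
    fix i show "pmf (bernoulli_pmf p) (z i) \<le> max p (1 - p)"
      using assms by (cases "z i") auto
  qed simp
  finally show ?thesis by simp
next
  case False
  then have "pmf (tail_bits p j h) z = 0"
    unfolding tail_bits_def by (subst pmf_Pi) auto
  moreover have "0 \<le> max p (1 - p) ^ h" using assms by simp
  ultimately show ?thesis by simp
qed

text \<open>
  If \<open>M\<close> is nonsingular, the second condition reads \<open>x \<bullet> M\<^sup>-\<^sup>1 x = - a\<close>; the vector \<open>v = - M\<^sup>-\<^sup>1 x\<close> avoids the inverse.
\<close>

definition new_singular :: "int \<Rightarrow> int \<Rightarrow> nat \<Rightarrow> nat set set \<Rightarrow> (nat \<Rightarrow> bool) \<Rightarrow> bool" where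
  "new_singular q a l E x \<longleftrightarrow> \<not> singular_mod q a E l \<and>
     (\<exists>v. solves q a E l v (\<lambda>i. - (if x i then 1 else 0)) \<and> [dot l x v = a] (mod q))"

lemma singular_ext_imp_new_singular:
  assumes q: "prime q" and E: "E \<subseteq> possible_edges l" and ns: "\<not> singular_mod q a E l"
    and s: "singular_mod q a (ext_graph E l x) (Suc l)"
  shows "new_singular q a l E x"
proof -
  have q0: "q > 0" using q prime_gt_0_int by blast
  obtain w where w: "supp q (Suc l) w \<noteq> {}" "solves q a (ext_graph E l x) (Suc l) w (\<lambda>_. 0)"
    using s unfolding singular_mod_def by blast
  have w': "solves q a E l w (\<lambda>i. 0 - (if x i then w l else 0))" "[dot l x w = 0 + a * w l] (mod q)"
    using w(2) by (auto simp: solves_ext[OF E])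
  have "\<not> q dvd w l"
  proof
    assume "q dvd w l"
    then have "solves q a E l w (\<lambda>_. 0)"
      using w'(1) unfolding solves_def by (auto simp: cong_iff_dvd_diff dvd_add_left_iff split: if_splits)
    then have "\<And>i. i < l \<Longrightarrow> [w i = 0] (mod q)" by (rule nonsingular_imp_zero[OF q0 ns])
    then have "supp q (Suc l) w = {}" using \<open>q dvd w l\<close> by (auto simp: supp_empty_iff less_Suc_eq cong_0_iff)
    then show False using w(1) by simp
  qed
  then have "coprime (w l) q" using q prime_imp_coprime coprime_commute by metis
  then obtain t where t: "[w l * t = 1] (mod q)" using cong_solve_coprime_int by blast
  define v where "v = (\<lambda>i. 0 + t * w i)"
  have "solves q a E l (\<lambda>_. 0) (\<lambda>_. 0)" by (simp add: solves_def shift_mult_def)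
  from solves_lincomb[OF this w'(1), of t]
  have v: "solves q a E l v (\<lambda>i. 0 + t * (0 - (if x i then w l else 0)))" unfolding v_def .
  have "solves q a E l v (\<lambda>i. - (if x i then 1 else 0))"
    unfolding solves_def
  proof (intro allI impI)
    fix i assume "i < l"
    then have "[shift_mult E a l v i = 0 + t * (0 - (if x i then w l else 0))] (mod q)" using v by (simp add: solves_def)
    also have "0 + t * (0 - (if x i then w l else 0)) = (if x i then - (w l * t) else 0)" by simp
    also have "[\<dots> = (if x i then - 1 else 0)] (mod q)" using t by (simp add: cong_minus_minus_iff)
    finally show "[shift_mult E a l v i = - (if x i then 1 else 0)] (mod q)" by (simp split: if_splits)
  qed
  moreover have "[dot l x v = a] (mod q)"
  proof -
    have "dot l x v = 0 + t * dot l x w" unfolding v_def by (subst dot_lincomb) (simp add: dot_def)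
    also have "[\<dots> = 0 + t * (0 + a * w l)] (mod q)" by (intro cong_add cong_mult w'(2)) auto
    also have "0 + t * (0 + a * w l) = a * (w l * t)" by simp
    also have "[\<dots> = a * 1] (mod q)" by (intro cong_mult t) auto
    finally show ?thesis by simp
  qed
  ultimately show ?thesis using ns unfolding new_singular_def by blast
qed

text \<open>
  The difference of two instances \<open>x\<close>, \<open>x'\<close> of the quadratic condition is bilinear: with \<open>M v = - x\<close> and
  \<open>M v' = - x'\<close>, symmetry of \<open>M\<close> turns \<open>x \<bullet> v = x' \<bullet> v'\<close> into \<open>(x + x') \<bullet> (v - v') = 0\<close>. When \<open>x\<close> and \<open>x'\<close>
  differ only in the resampled bits, \<open>v - v'\<close> depends on those bits alone.
\<close>

lemma resampled_linear_relation:
  assumes x: "solves q a E l v (\<lambda>i. - (if x i then 1 else 0))" "[dot l x v = a] (mod q)"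
    and x': "solves q a E l v' (\<lambda>i. - (if x' i then 1 else 0))" "[dot l x' v' = a] (mod q)"
  shows "[dot l x (\<lambda>i. v i - v' i) + dot l x' (\<lambda>i. v i - v' i) = 0] (mod q)"
proof -
  have d: "dot l y (\<lambda>i. v i - v' i) = dot l y v - dot l y v'" for y
    using dot_lincomb[of l y v "-1" v'] by simp
  have n: "(\<Sum>i<l. u i * - (if y i then 1 else 0)) = - dot l y u" for u y
    by (auto simp: dot_def sum_negf[symmetric] intro!: sum.cong)
  have "[(\<Sum>i<l. v' i * - (if x i then 1 else 0)) = (\<Sum>i<l. v i * - (if x' i then 1 else 0))] (mod q)"
    by (rule solves_pairing[OF x(1) x'(1)])
  then have "[dot l x v' = dot l x' v] (mod q)" unfolding n by (simp add: cong_minus_minus_iff)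
  then have "[(dot l x v - dot l x v') + (dot l x' v - dot l x' v')
      = (a - dot l x' v) + (dot l x' v - a)] (mod q)"
    by (intro cong_add cong_diff x(2) x'(2)) auto
  then show ?thesis unfolding d by simp
qed

lemma cong_cancel_2:
  fixes q d b :: int
  assumes "odd q" "[2 * d = b] (mod q)"
  shows "[d = (q + 1) div 2 * b] (mod q)"
proof -
  have "2 * ((q + 1) div 2) = q + 1" by (rule dvd_mult_div_cancel) (use assms(1) in simp)
  then have "(q + 1) div 2 * (2 * d) = q * d + d" by (metis mult.assoc mult.commute distrib_right mult_1)
  moreover have "[(q + 1) div 2 * (2 * d) = (q + 1) div 2 * b] (mod q)" by (intro cong_mult assms(2)) auto
  ultimately have "[q * d + d = (q + 1) div 2 * b] (mod q)" by simp
  then show ?thesis by (simp add: cong_def mod_simps)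
qed

lemma dot_split:
  "dot (j + h) (\<lambda>i. if i < j then y i else z i) w = dot j y w + (\<Sum>i\<in>{j..<j + h}. if z i then w i else 0)"
proof -
  have "{..<j + h} = {..<j} \<union> {j..<j + h}" by auto
  then show ?thesis unfolding dot_def by (simp add: sum.union_disjoint ivl_disj_int)
qed

text \<open>
  With the resampled bits fixed, \<open>w = v - v'\<close> is the unique solution of \<open>M w = u\<close>, where \<open>u = x' - x\<close> is fixed and
  nonzero. Unless \<open>w\<close> is structured, the linear relation for the other bits \<open>y\<close> has probability at most \<open>\<tau>\<close>.
\<close>

lemma prob_resampled_fixed:
  fixes j h :: nat
  defines "l \<equiv> j + h"
  assumes q: "prime q" "odd q" and p: "0 \<le> p" "p \<le> 1" and c: "0 \<le> c" "c \<le> p * (1 - p)" and \<tau>: "\<tau> \<ge> 0"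
    and zz: "z \<noteq> z'" "\<And>i. i \<notin> {j..<j + h} \<Longrightarrow> \<not> z i \<and> \<not> z' i"
    and bad: "\<And>u. prob (erdos_renyi l p) {E. structured_sol q a c \<tau> h l u E} \<le> \<beta>"
  shows "prob (pair_pmf (erdos_renyi l p) (bits p j))
     {(E, y). new_singular q a l E (\<lambda>i. if i < j then y i else z i) \<and> new_singular q a l E (\<lambda>i. if i < j then y i else z' i)}
     \<le> \<beta> + \<tau>"
proof -
  have q0: "q > 0" "q > 1" using q prime_gt_0_int prime_gt_1_int by blast+
  define X where "X = (\<lambda>y z i. if i < j then y i else z i :: bool)"
  \<comment> \<open>The two rows agree below \<open>j\<close>, so their difference does not involve \<open>y\<close>.\<close>
  define u where "u = (\<lambda>i. (if z' i then 1 else 0) - (if z i then 1 else 0 :: int))"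
  let ?S = "{(E, y). new_singular q a l E (X y z) \<and> new_singular q a l E (X y z')}"
  let ?B = "{E. structured_sol q a c \<tau> h l u E}"
  have "pair_pmf (erdos_renyi l p) (bits p j) = bind_pmf (erdos_renyi l p) (\<lambda>E. map_pmf (Pair E) (bits p j))"
    by (simp add: pair_pmf_def map_pmf_def)
  then have "prob (pair_pmf (erdos_renyi l p) (bits p j)) ?S
      = prob (bind_pmf (erdos_renyi l p) (\<lambda>E. map_pmf (Pair E) (bits p j))) ?S" by simp
  also have "\<dots> \<le> prob (erdos_renyi l p) ?B * 1 + \<tau>"
  proof (rule prob_bind_le)
    fix E
    show "prob (map_pmf (Pair E) (bits p j)) ?S \<le> indicator ?B E * 1 + \<tau>"
    proof (cases "E \<in> ?B")
      case True
      then show ?thesis using \<tau> measure_pmf.prob_le_1[of "map_pmf (Pair E) (bits p j)" ?S] by (simp add: add_increasing2)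
    next
      case notbad: False
      have rel: "\<exists>w\<in>Vec q l. solves q a E l w u \<and> \<not> singular_mod q a E l \<and> [dot l (X y z) w + dot l (X y z') w = 0] (mod q)"
        if y: "(E, y) \<in> ?S" for y
      proof -
        from y obtain v v' where v: "solves q a E l v (\<lambda>i. - (if X y z i then 1 else 0))" "[dot l (X y z) v = a] (mod q)"
            "solves q a E l v' (\<lambda>i. - (if X y z' i then 1 else 0))" "[dot l (X y z') v' = a] (mod q)"
          and ns: "\<not> singular_mod q a E l"
          unfolding new_singular_def by auto
        define w where "w = reduce q l (\<lambda>i. v i - v' i)"
        have "solves q a E l (\<lambda>i. v i + (- 1) * v' i) (\<lambda>i. - (if X y z i then 1 else 0) + (- 1) * - (if X y z' i then 1 else 0))"
          by (rule solves_lincomb[OF v(1,3)])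
        moreover have "(\<lambda>i. - (if X y z i then 1 else 0) + (- 1) * - (if X y z' i then 1 else 0)) = u"
        proof
          fix i show "- (if X y z i then 1 else 0) + (- 1) * - (if X y z' i then 1 else 0) = u i"
            using zz(2)[of i] by (auto simp: X_def u_def)
        qed
        ultimately have "solves q a E l w u" unfolding w_def solves_reduce by simp
        moreover have "w \<in> Vec q l" unfolding w_def by (rule reduce_in_Vec[OF q0(1)])
        moreover have "[dot l (X y z) w + dot l (X y z') w = 0] (mod q)"
        proof -
          have "[dot l x w = dot l x (\<lambda>i. v i - v' i)] (mod q)" for x
            unfolding w_def by (rule dot_cong) (rule reduce_cong)
          then have "[dot l (X y z) w + dot l (X y z') w
              = dot l (X y z) (\<lambda>i. v i - v' i) + dot l (X y z') (\<lambda>i. v i - v' i)] (mod q)"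
            by (intro cong_add)
          then show ?thesis using resampled_linear_relation[OF v] by (rule cong_trans)
        qed
        ultimately show ?thesis using ns by blast
      qed
      show ?thesis
      proof (cases "\<exists>y. (E, y) \<in> ?S")
        case False
        then have "Pair E -` ?S = {}" by auto
        then have "prob (map_pmf (Pair E) (bits p j)) ?S = 0" by (simp only: measure_map_pmf measure_empty)
        then show ?thesis using \<tau> by simp
      next
        case True
        then obtain w where w: "w \<in> Vec q l" "solves q a E l w u" and ns: "\<not> singular_mod q a E l"
          using rel by blast
        have "supp q l w \<noteq> {}"
        proof
          assume "supp q l w = {}"
          then have "\<And>i. i < l \<Longrightarrow> [w i = 0] (mod q)" by (simp add: supp_empty_iff)
          then have "[shift_mult E a l w i = shift_mult E a l (\<lambda>_. 0) i] (mod q)" if "i < l" for i using that by (rule shift_mult_cong)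
          then have "[shift_mult E a l w i = 0] (mod q)" if "i < l" for i using that by (simp add: shift_mult_def)
          moreover have "[shift_mult E a l w i = u i] (mod q)" if "i < l" for i
            using w(2) that unfolding solves_def by blast
          ultimately have "[u i = 0] (mod q)" if "i < l" for i
            using that by (meson cong_sym cong_trans)
          moreover obtain i where i: "z i \<noteq> z' i" using zz(1) by auto
          moreover have "i < l" using zz(2)[of i] i by (auto simp: l_def)
          ultimately have "[u i = 0] (mod q)" by blast
          then show False using i q0 by (auto simp: u_def cong_0_iff split: if_splits)
        qed
        then have small: "conc c q j w < \<tau>"
          using notbad w unfolding structured_sol_def by (force simp: l_def)
        \<comment> \<open>The contribution of the fixed bits; the relation becomes \<open>2 * (y \<bullet> w) + C = 0\<close>.\<close>
        define C where "C = (\<Sum>i\<in>{j..<j + h}. if z i then w i else 0) + (\<Sum>i\<in>{j..<j + h}. if z' i then w i else 0)"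
        have "prob (map_pmf (Pair E) (bits p j)) ?S
           \<le> prob (bits p j) {y. [dot j y w = (q + 1) div 2 * (- C)] (mod q)}"
          unfolding measure_map_pmf
        proof (intro measure_pmf.finite_measure_mono subsetI)
          fix y assume "y \<in> Pair E -` ?S"
          then obtain w' where w': "w' \<in> Vec q l" "solves q a E l w' u"
            "[dot l (X y z) w' + dot l (X y z') w' = 0] (mod q)" using rel[of y] by auto
          have "w' = w"
            by (rule Vec_eqI[OF w'(1) w(1)]) (rule nonsingular_unique[OF q0(1) ns w'(2) w(2)])
          then have "[dot l (X y z) w + dot l (X y z') w = 0] (mod q)" using w' by simp
          moreover have "dot l (X y z) w + dot l (X y z') w = 2 * dot j y w + C"
            unfolding l_def X_def dot_split C_def by simp
          ultimately have "[2 * dot j y w = - C] (mod q)" by (simp add: cong_iff_dvd_diff)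
          then show "y \<in> {y. [dot j y w = (q + 1) div 2 * (- C)] (mod q)}"
            unfolding mem_Collect_eq by (rule cong_cancel_2[OF q(2)])
        qed simp
        also have "\<dots> \<le> conc c q j w" by (rule prob_dot_le[OF q0(1) p c]) simp
        finally show ?thesis using small notbad by simp
      qed
    qed
  qed
  also have "\<dots> \<le> \<beta> + \<tau>" using bad by simp
  finally show ?thesis unfolding X_def .
qed

text \<open>
  The term \<open>max p (1 - p) ^ h\<close> bounds the probability that resampling does not change any bit.
\<close>

lemma prob_new_singular:
  fixes j h :: nat
  defines "l \<equiv> j + h"
  assumes q: "prime q" "odd q" and p: "0 \<le> p" "p \<le> 1" and c: "0 \<le> c" "c \<le> p * (1 - p)" and \<tau>: "\<tau> \<ge> 0"
    and bad: "\<And>u. prob (erdos_renyi l p) {E. structured_sol q a c \<tau> h l u E} \<le> \<beta>"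
  shows "(prob (pair_pmf (erdos_renyi l p) (bits p l)) {(E, x). new_singular q a l E x})\<^sup>2
     \<le> max p (1 - p) ^ h + \<beta> + \<tau>"
proof -
  let ?M = "pair_pmf (erdos_renyi l p) (bits p j)" and ?N = "tail_bits p j h"
  define X where "X = (\<lambda>y z i. if i < j then y i else z i :: bool)"
  let ?S = "{((E, y), z). new_singular q a l E (X y z)}"
  have \<beta>: "\<beta> \<ge> 0" using bad[of undefined] measure_nonneg order_trans by blast
  have "pair_pmf (erdos_renyi l p) (bits p l) = map_pmf (\<lambda>((E, y), z). (E, X y z)) (pair_pmf ?M ?N)"
    unfolding l_def bits_split X_def pair_pmf_def map_pmf_def
    by (simp add: bind_assoc_pmf bind_return_pmf split_def)
  then have "prob (pair_pmf (erdos_renyi l p) (bits p l)) {(E, x). new_singular q a l E x}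
      = prob (pair_pmf ?M ?N) ?S"
    by (simp add: measure_map_pmf vimage_def split_def)
  then have "(prob (pair_pmf (erdos_renyi l p) (bits p l)) {(E, x). new_singular q a l E x})\<^sup>2
      \<le> prob (pair_pmf ?M (pair_pmf ?N ?N)) {(m, z, z'). (m, z) \<in> ?S \<and> (m, z') \<in> ?S}"
    using prob_pair_resample[of ?M ?N ?S] by simp
  also have "pair_pmf ?M (pair_pmf ?N ?N) = bind_pmf (pair_pmf ?N ?N) (\<lambda>zz. map_pmf (\<lambda>m. (m, zz)) ?M)"
    unfolding pair_pmf_def[of ?M "pair_pmf ?N ?N"] map_pmf_def by (rule bind_commute_pmf)
  also have "prob \<dots> {(m, z, z'). (m, z) \<in> ?S \<and> (m, z') \<in> ?S}
      \<le> prob (pair_pmf ?N ?N) {(z, z'). z = z'} * 1 + (\<beta> + \<tau>)"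
  proof (rule prob_bind_le)
    fix zz assume zz: "zz \<in> set_pmf (pair_pmf ?N ?N)"
    obtain z z' where zz_eq: "zz = (z, z')" by (cases zz)
    show "prob (map_pmf (\<lambda>m. (m, zz)) ?M) {(m, z, z'). (m, z) \<in> ?S \<and> (m, z') \<in> ?S}
        \<le> indicator {(z, z'). z = z'} zz * 1 + (\<beta> + \<tau>)"
    proof (cases "z = z'")
      case True
      have "prob (map_pmf (\<lambda>m. (m, zz)) ?M) {(m, z, z'). (m, z) \<in> ?S \<and> (m, z') \<in> ?S} \<le> 1"
        by (rule measure_pmf.prob_le_1)
      then show ?thesis using True \<tau> \<beta> zz_eq by (simp add: add_increasing2)
    next
      case False
      have "z i = False \<and> z' i = False" if "i \<notin> {j..<j + h}" for i
      proof -
        have "z \<in> set_pmf ?N" "z' \<in> set_pmf ?N" using zz zz_eq by auto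
        then show ?thesis using that set_Pi_pmf_subset[of "{j..<j + h}" False "\<lambda>_. bernoulli_pmf p"]
          unfolding tail_bits_def by blast
      qed
      then have z: "\<not> z i \<and> \<not> z' i" if "i \<notin> {j..<j + h}" for i using that by blast
      have "prob (map_pmf (\<lambda>m. (m, zz)) ?M) {(m, z, z'). (m, z) \<in> ?S \<and> (m, z') \<in> ?S}
          = prob ?M {(E, y). new_singular q a l E (X y z) \<and> new_singular q a l E (X y z')}"
        unfolding measure_map_pmf zz_eq by (rule arg_cong[of _ _ "prob ?M"]) auto
      also have "\<dots> \<le> \<beta> + \<tau>"
        unfolding X_def l_def
        by (rule prob_resampled_fixed[OF q p c \<tau> False z]) (auto intro: bad[unfolded l_def])
      finally show ?thesis using False zz_eq by simp
    qed
  qed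
  also have "prob (pair_pmf ?N ?N) {(z, z'). z = z'} \<le> max p (1 - p) ^ h"
  proof -
    have "pair_pmf ?N ?N = bind_pmf ?N (\<lambda>z. map_pmf (Pair z) ?N)" by (simp add: pair_pmf_def map_pmf_def)
    then have "prob (pair_pmf ?N ?N) {(z, z'). z = z'}
        = prob (bind_pmf ?N (\<lambda>z. map_pmf (Pair z) ?N)) {(z, z'). z = z'}" by simp
    also have "\<dots> \<le> prob ?N {} * 0 + max p (1 - p) ^ h"
    proof (rule prob_bind_le)
      fix z :: "nat \<Rightarrow> bool"
      have "Pair z -` {(z, z'). z = z'} = {z}" by auto
      then show "prob (map_pmf (Pair z) ?N) {(z, z'). z = z'} \<le> indicator {} z * 0 + max p (1 - p) ^ h"
        using pmf_tail_bits_le[OF p, of j h z] by (simp add: measure_map_pmf pmf.rep_eq)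
    qed
    finally show ?thesis by simp
  qed
  finally show ?thesis by simp
qed

text \<open>
  The matrix before the last insertion is either nonsingular (\<open>prob_new_singular\<close>), or has corank at least
  2 (\<open>prob_corank_ge_2\<close>), or has corank 1; in the last case the insertion kills the kernel unless it fails to
  shrink it.
\<close>

theorem prob_singular_mod:
  fixes l i h :: nat and \<tau> \<beta> :: real
  defines "L \<equiv> l + i"
  assumes q: "prime q" "odd q" and p: "0 \<le> p" "p \<le> 1" and c: "0 \<le> c" "c \<le> p * (1 - p)" and \<tau>: "\<tau> \<ge> 0"
    and bad: "\<And>j u. l \<le> j \<Longrightarrow> j \<le> L \<Longrightarrow>
       prob (erdos_renyi j p) {E. structured_sol q a c \<tau> h j u E} \<le> \<beta>"
    and li: "l \<le> Suc i" and h: "h \<le> L"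
  shows "prob (erdos_renyi (Suc L) p) {E. singular_mod q a E (Suc L)}
     \<le> Suc i * (\<beta> + \<tau>) + sqrt (max p (1 - p) ^ h + \<beta> + \<tau>)"
proof -
  have q0: "q > 0" "q > 1" using q prime_gt_0_int prime_gt_1_int by blast+
  let ?P = "pair_pmf (erdos_renyi L p) (bits p L)"
  have pair: "?P = bind_pmf (erdos_renyi L p) (\<lambda>E. map_pmf (Pair E) (bits p L))"
    by (simp add: pair_pmf_def map_pmf_def)
  let ?S = "{(E, x). singular_mod q a E L \<and> singular_mod q a (ext_graph E L x) (Suc L)}"
  let ?A = "{E. card (Ker q a E L) > nat q ^ 1}" and ?B = "{E. structured_sol q a c \<tau> h L (\<lambda>_. 0) E}"
  have "erdos_renyi (Suc L) p = map_pmf (\<lambda>(E, x). ext_graph E L x) ?P"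
    unfolding erdos_renyi_Suc pair_pmf_def map_pmf_def by (simp add: bind_assoc_pmf bind_return_pmf)
  then have "prob (erdos_renyi (Suc L) p) {E. singular_mod q a E (Suc L)}
      = prob ?P ((\<lambda>(E, x). ext_graph E L x) -` {E. singular_mod q a E (Suc L)})"
    by (simp add: measure_map_pmf)
  also have "\<dots> \<le> prob ?P (?S \<union> {(E, x). new_singular q a L E x})"
  proof (rule measure_pmf.finite_measure_mono_AE)
    show "AE z in ?P. z \<in> (\<lambda>(E, x). ext_graph E L x) -` {E. singular_mod q a E (Suc L)} \<longrightarrow> z \<in> ?S \<union> {(E, x). new_singular q a L E x}"
    proof (rule AE_pmfI, rule impI)
      fix z assume z: "z \<in> set_pmf ?P" "z \<in> (\<lambda>(E, x). ext_graph E L x) -` {E. singular_mod q a E (Suc L)}"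
      obtain E x where Ex: "z = (E, x)" by (cases z)
      have "E \<subseteq> possible_edges L" using z(1) Ex set_erdos_renyi by auto
      then show "z \<in> ?S \<union> {(E, x). new_singular q a L E x}"
        using z(2) Ex singular_ext_imp_new_singular[OF q(1), of E L a x] by auto
    qed
  qed simp
  also have "\<dots> \<le> prob ?P ?S + prob ?P {(E, x). new_singular q a L E x}"
    by (rule measure_Un_le) auto
  also have "prob ?P ?S \<le> prob (erdos_renyi L p) (?A \<union> ?B) * 1 + \<tau>"
    unfolding pair
  proof (rule prob_bind_le)
    fix E assume "E \<in> set_pmf (erdos_renyi L p)"
    then have E: "E \<subseteq> possible_edges L" by (rule set_erdos_renyi)
    show "prob (map_pmf (Pair E) (bits p L)) ?S \<le> indicator (?A \<union> ?B) E * 1 + \<tau>"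
    proof (cases "E \<in> ?A \<union> ?B")
      case True
      then show ?thesis using \<tau> measure_pmf.prob_le_1[of "map_pmf (Pair E) (bits p L)" ?S] by (simp add: add_increasing2)
    next
      case False
      show ?thesis
      proof (cases "singular_mod q a E L")
        case True
        have "prob (map_pmf (Pair E) (bits p L)) ?S
           \<le> prob (bits p L) {x. card (Ker q a (ext_graph E L x) (Suc L)) * nat q > card (Ker q a E L)}"
          unfolding measure_map_pmf
        proof (intro measure_pmf.finite_measure_mono subsetI)
          fix x assume "x \<in> Pair E -` ?S"
          then have "1 < card (Ker q a (ext_graph E L x) (Suc L))" using singular_imp_card_Ker[OF q0(1)] by auto
          then have "1 * nat q < card (Ker q a (ext_graph E L x) (Suc L)) * nat q"
            using q0 by (intro mult_strict_right_mono) auto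
          moreover have "card (Ker q a E L) \<le> 1 * nat q" using False by auto
          ultimately show "x \<in> {x. card (Ker q a (ext_graph E L x) (Suc L)) * nat q > card (Ker q a E L)}"
            unfolding mem_Collect_eq by (rule le_less_trans[rotated])
        qed simp
        also have "\<dots> \<le> \<tau>" using prob_no_corank_drop[OF q(1) p c E True] False by blast
        finally show ?thesis by (simp add: add_increasing)
      next
        case ns: False
        then have "Pair E -` ?S = {}" by auto
        then have "prob (map_pmf (Pair E) (bits p L)) ?S = 0" by (simp only: measure_map_pmf measure_empty)
        then show ?thesis using \<tau> by simp
      qed
    qed
  qed
  also have "prob (erdos_renyi L p) (?A \<union> ?B)
      \<le> prob (erdos_renyi L p) ?A + prob (erdos_renyi L p) ?B"
    by (rule measure_Un_le) auto
  also have "prob (erdos_renyi L p) ?A \<le> i * (\<beta> + \<tau>)"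
    unfolding L_def by (rule prob_corank_ge_2[where h = h, OF q(1) p c \<tau>]) (use bad li in \<open>auto simp: L_def\<close>)
  also have "prob (erdos_renyi L p) ?B \<le> \<beta>" by (rule bad) (auto simp: L_def)
  also have "prob ?P {(E, x). new_singular q a L E x} \<le> sqrt (max p (1 - p) ^ h + \<beta> + \<tau>)"
  proof (rule real_le_rsqrt)
    have Lh: "L = (L - h) + h" using h by simp
    show "(prob ?P {(E, x). new_singular q a L E x})\<^sup>2 \<le> max p (1 - p) ^ h + \<beta> + \<tau>"
      using prob_new_singular[of q p c \<tau> "L - h" h a \<beta>] q p c \<tau> bad[of L] Lh by (simp add: L_def)
  qed
  finally show ?thesis by (simp add: algebra_simps)
qed

section \<open>Large prime divisors of polynomial values\<close>

lemma prime_power_dvd_mult_cancel: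
  fixes q u v :: int
  assumes q: "prime q" and dvd: "q ^ a dvd u * v" and nd: "\<not> q ^ Suc e dvd u"
  shows "q ^ (a - e) dvd v"
proof (cases "v = 0")
  case False
  have u0: "u \<noteq> 0" using nd by auto
  have nu: "\<not> is_unit q" using q prime_imp_prime_elem prime_elem_not_unit by blast
  have "a \<le> multiplicity q (u * v)"
    using dvd u0 False nu by (intro multiplicity_geI) auto
  also have "\<dots> = multiplicity q u + multiplicity q v"
    using q u0 False by (intro prime_elem_multiplicity_mult_distrib prime_imp_prime_elem)
  also have "multiplicity q u \<le> e"
    using nd u0 nu power_dvd_iff_le_multiplicity[of u q "Suc e"] by auto
  finally have "a - e \<le> multiplicity q v" by simp
  then show ?thesis by (rule multiplicity_dvd')
qed simp

text \<open>
  Induction on the degree through \<open>g(x) - g(r) = (x - r) * h(x)\<close>: for \<open>x \<noteq> r\<close> the factor \<open>x - r\<close> absorbs at most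
  \<open>e\<close> of the \<open>a\<close> factors \<open>q\<close>, so the other elements of \<open>S\<close> are roots of \<open>h\<close> modulo \<open>q ^ (a - e)\<close>.
\<close>

lemma card_roots_mod_prime_power:
  fixes g :: "int poly" and q :: int
  assumes q: "prime q"
  shows "\<lbrakk>lead_coeff g = 1; degree g = d; d * e < a; finite S; \<And>x. x \<in> S \<Longrightarrow> q ^ a dvd poly g x;
      \<And>x y. x \<in> S \<Longrightarrow> y \<in> S \<Longrightarrow> \<bar>x - y\<bar> < q ^ Suc e\<rbrakk> \<Longrightarrow> card S \<le> d"
proof (induction d arbitrary: g a S)
  case 0
  obtain c where "g = [:c:]" using 0(2) by (rule degree_eq_zeroE)
  then have "g = 1" using 0(1) by (simp add: one_pCons)
  have "S = {}"
  proof (rule ccontr)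
    assume "S \<noteq> {}"
    then obtain x where "x \<in> S" by auto
    then have "q ^ a dvd 1" using 0(5)[of x] \<open>g = 1\<close> by simp
    then have "is_unit q" using 0(3) is_unit_power_iff[of q a] by blast
    then show False using q prime_imp_prime_elem prime_elem_not_unit by blast
  qed
  then show ?case by simp
next
  case (Suc d)
  show ?case
  proof (cases "S = {}")
    case False
    then obtain r where r: "r \<in> S" by auto
    define h where "h = synthetic_div g r"
    have dh: "degree h = d" unfolding h_def using Suc.prems(2) by (simp add: degree_synthetic_div)
    have gh: "[:- r, 1:] * h + [:poly g r:] = g" unfolding h_def by (rule synthetic_div_correct')
    have h0: "h \<noteq> 0" unfolding h_def using Suc.prems(2) by (simp add: synthetic_div_eq_0_iff)
    have "1 = coeff g (degree [:- r, 1:] + degree h)" using Suc.prems(1,2) dh by simp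
    also have "\<dots> = coeff ([:- r, 1:] * h) (degree [:- r, 1:] + degree h) + coeff [:poly g r:] (degree [:- r, 1:] + degree h)"
      by (subst gh[symmetric]) (rule coeff_add)
    also have "coeff [:poly g r:] (degree [:- r, 1:] + degree h) = 0" by simp
    also have "coeff ([:- r, 1:] * h) (degree [:- r, 1:] + degree h) = lead_coeff [:- r, 1:] * lead_coeff h"
      by (rule coeff_mult_degree_sum)
    finally have lh: "lead_coeff h = 1" by simp
    have "q ^ (a - e) dvd poly h x" if x: "x \<in> S - {r}" for x
    proof -
      have "poly g x = (x - r) * poly h x + poly g r"
        using arg_cong[OF gh, of "\<lambda>p. poly p x"] by (simp add: algebra_simps)
      then have "(x - r) * poly h x = poly g x - poly g r" by simp
      moreover have "q ^ a dvd poly g x - poly g r" using Suc.prems(5) x r by (intro dvd_diff) auto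
      ultimately have 1: "q ^ a dvd (x - r) * poly h x" by simp
      have "\<not> q ^ Suc e dvd x - r"
      proof
        assume "q ^ Suc e dvd x - r"
        then have "q ^ Suc e \<le> \<bar>x - r\<bar>" using x by (intro zdvd_imp_le) (auto simp: dvd_abs_iff)
        then show False using Suc.prems(6)[of x r] x r by auto
      qed
      from prime_power_dvd_mult_cancel[OF q 1 this] show ?thesis .
    qed
    then have "card (S - {r}) \<le> d"
      using Suc.prems by (intro Suc.IH[OF lh dh, of "a - e"]) auto
    then show ?thesis using r Suc.prems(4) by (simp add: card_Diff_singleton_if)
  qed simp
qed

text \<open>
  Split the interval into blocks of length \<open>q ^ Suc e\<close>.
\<close>

lemma card_roots_interval:
  fixes g :: "int poly" and q :: int and N X :: nat
  assumes q: "prime q" and g: "lead_coeff g = 1" "degree g = d" and a: "d * e < a"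
  shows "real (card {i\<in>{1..X}. q ^ a dvd poly g (int (N + i))}) \<le> d * (X / real_of_int q ^ Suc e + 1)"
proof -
  have q0: "q > 0" using q prime_gt_0_int by blast
  define Q where "Q = nat (q ^ Suc e)"
  have Q: "Q > 0" "int Q = q ^ Suc e" using q0 by (auto simp: Q_def)
  have rQ: "real Q = real_of_int q ^ Suc e" using Q(2) by (metis of_int_of_nat_eq of_int_power)
  define B where "B = (\<lambda>k. {i\<in>{1..X}. q ^ a dvd poly g (int (N + i)) \<and> (i - 1) div Q = k})"
  have "card (B k) \<le> d" for k
  proof -
    have inj: "inj_on (\<lambda>i. int (N + i)) (B k)" by (auto simp: inj_on_def)
    have "card ((\<lambda>i. int (N + i)) ` B k) \<le> d"
    proof (rule card_roots_mod_prime_power[OF q g a])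
      show "finite ((\<lambda>i. int (N + i)) ` B k)" by (auto simp: B_def)
      show "q ^ a dvd poly g x" if "x \<in> (\<lambda>i. int (N + i)) ` B k" for x using that by (auto simp: B_def)
      fix x y assume "x \<in> (\<lambda>i. int (N + i)) ` B k" "y \<in> (\<lambda>i. int (N + i)) ` B k"
      then obtain i j where ij: "x = int (N + i)" "y = int (N + j)" "i \<in> B k" "j \<in> B k" by auto
      have "i - 1 = k * Q + (i - 1) mod Q" "j - 1 = k * Q + (j - 1) mod Q"
        using ij div_mult_mod_eq[of "i - 1" Q] div_mult_mod_eq[of "j - 1" Q] by (auto simp: B_def)
      moreover have "(i - 1) mod Q < Q" "(j - 1) mod Q < Q" using Q by auto
      moreover have "i \<ge> 1" "j \<ge> 1" using ij by (auto simp: B_def)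
      ultimately have "\<bar>int i - int j\<bar> < int Q" by linarith
      then show "\<bar>x - y\<bar> < q ^ Suc e" using ij Q by simp
    qed
    then show ?thesis using card_image[OF inj] by simp
  qed
  then have cB: "card (\<Union>k\<in>{..X div Q}. B k) \<le> (\<Sum>k\<in>{..X div Q}. d)"
    by (intro order_trans[OF card_UN_le] sum_mono) auto
  have "{i\<in>{1..X}. q ^ a dvd poly g (int (N + i))} \<subseteq> (\<Union>k\<in>{..X div Q}. B k)"
    by (auto simp: B_def intro!: div_le_mono)
  then have "card {i\<in>{1..X}. q ^ a dvd poly g (int (N + i))} \<le> card (\<Union>k\<in>{..X div Q}. B k)"
    by (rule card_mono[rotated]) (auto simp: B_def)
  also have "\<dots> \<le> (\<Sum>k\<in>{..X div Q}. d)" by (rule cB)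
  finally have "card {i\<in>{1..X}. q ^ a dvd poly g (int (N + i))} \<le> (X div Q + 1) * d"
    by (simp add: algebra_simps)
  then have "real (card {i\<in>{1..X}. q ^ a dvd poly g (int (N + i))}) \<le> real ((X div Q + 1) * d)"
    by (rule of_nat_mono)
  also have "\<dots> = (real (X div Q) + 1) * d" by (simp add: algebra_simps)
  also have "\<dots> \<le> (X / real Q + 1) * d"
    using of_nat_div_le_of_nat[of X Q, where ?'a = real] by (intro mult_right_mono add_mono) auto
  finally show ?thesis unfolding rQ by (simp add: mult.commute)
qed

lemma sum_div_blocks_le:
  fixes f :: "nat \<Rightarrow> real"
  assumes "d \<ge> 1" "\<And>b. f b \<ge> 0"
  shows "(\<Sum>a<A. f (a div d)) \<le> d * (\<Sum>b<A. f b)"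
proof -
  have "(\<Sum>a<A. f (a div d)) \<le> (\<Sum>a<A * d. f (a div d))"
    using assms by (intro sum_mono2) auto
  also have "\<dots> = (\<Sum>b<A. \<Sum>a\<in>{b * d..<b * d + d}. f (a div d))"
    by (rule sum.nat_group[symmetric])
  also have "\<dots> = (\<Sum>b<A. \<Sum>a\<in>{b * d..<b * d + d}. f b)"
  proof (intro sum.cong refl)
    fix b a assume "a \<in> {b * d..<b * d + d}"
    then have "a div d = b" using assms(1) by (intro div_nat_eqI) (auto simp: algebra_simps)
    then show "f (a div d) = f b" by simp
  qed
  also have "\<dots> = d * (\<Sum>b<A. f b)" by (simp add: sum_distrib_left)
  finally show ?thesis .
qed

lemma geometric_sum_le:
  fixes x :: real assumes "x > 1"
  shows "(\<Sum>b<A. 1 / x ^ Suc b) \<le> 1 / (x - 1)"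
proof -
  have "(\<Sum>b<A. 1 / x ^ Suc b) * (x - 1) = 1 - (1 / x) ^ A"
  proof (induction A)
    case (Suc A)
    have "1 / x ^ Suc A * (x - 1) = (1 / x) ^ A - (1 / x) ^ Suc A"
      using assms by (simp add: right_diff_distrib power_one_over)
    then show ?case using Suc by (simp add: distrib_right)
  qed simp
  also have "\<dots> \<le> 1" using assms by simp
  finally show ?thesis using assms by (simp add: pos_le_divide_eq)
qed

text \<open>
  The multiplicity counts the exponents \<open>Suc a\<close> with \<open>q ^ Suc a\<close> dividing the value, so the sum is a sum over \<open>a\<close>
  of the counts of \<open>card_roots_interval\<close>, taken with \<open>e = a div d\<close>. The geometric series over \<open>e\<close> gives the main
  term, and the error \<open>d\<close> per exponent is controlled by the largest exponent, at most \<open>ln G / ln q\<close>.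
\<close>

lemma sum_multiplicity_le:
  fixes g :: "int poly" and q :: int and N X :: nat and G :: real
  assumes q: "prime q" and g: "lead_coeff g = 1" "degree g = d" "d \<ge> 1"
    and pos: "\<And>i. i \<in> {1..X} \<Longrightarrow> 0 < poly g (int (N + i)) \<and> real_of_int (poly g (int (N + i))) \<le> G"
    and X: "X \<ge> 1"
  shows "(\<Sum>i\<in>{1..X}. real (multiplicity q (poly g (int (N + i))))) * ln (real_of_int q)
     \<le> d * ln G + real d ^ 2 * X * (ln (real_of_int q) / (real_of_int q - 1))"
proof -
  have q0: "q > 1" using q prime_gt_1_int by blast
  have nu: "\<not> is_unit q" using q prime_imp_prime_elem prime_elem_not_unit by blast
  define m where "m = (\<lambda>i. multiplicity q (poly g (int (N + i))))"
  define A where "A = Max (m ` {1..X})"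
  have mA: "m i \<le> A" if "i \<in> {1..X}" for i unfolding A_def using that by (intro Max_ge) auto
  have "A \<in> m ` {1..X}" unfolding A_def using X by (intro Max_in) auto
  then obtain i0 where i0: "i0 \<in> {1..X}" "A = m i0" by auto
  have "q ^ A dvd poly g (int (N + i0))" unfolding i0(2) m_def by (rule multiplicity_dvd)
  then have "q ^ A \<le> poly g (int (N + i0))" using pos[OF i0(1)] by (intro zdvd_imp_le) auto
  then have "real_of_int q ^ A \<le> G" using pos[OF i0(1)] by (metis of_int_le_iff of_int_power order_trans)
  then have lnA: "A * ln (real_of_int q) \<le> ln G"
    using q0 by (subst ln_realpow[symmetric]) (auto intro!: ln_mono)
  have "(\<Sum>i\<in>{1..X}. real (m i)) = (\<Sum>i\<in>{1..X}. \<Sum>a<A. if q ^ Suc a dvd poly g (int (N + i)) then 1 else 0)"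
  proof (rule sum.cong[OF refl])
    fix i assume i: "i \<in> {1..X}"
    then have nz: "poly g (int (N + i)) \<noteq> 0" using pos by force
    have dv: "q ^ Suc a dvd poly g (int (N + i)) \<longleftrightarrow> Suc a \<le> m i" for a
      by (simp only: power_dvd_iff_le_multiplicity[OF nz nu] m_def)
    have "{a. a < A \<and> q ^ Suc a dvd poly g (int (N + i))} = {..<m i}"
      unfolding dv using mA[OF i] by auto
    then show "real (m i) = (\<Sum>a<A. if q ^ Suc a dvd poly g (int (N + i)) then 1 else 0)"
      by (simp add: sum.If_cases Int_def)
  qed
  also have "\<dots> = (\<Sum>a<A. \<Sum>i\<in>{1..X}. if q ^ Suc a dvd poly g (int (N + i)) then 1 else 0)" by (rule sum.swap)
  also have "\<dots> = (\<Sum>a<A. real (card {i\<in>{1..X}. q ^ Suc a dvd poly g (int (N + i))}))"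
    by (simp add: sum.If_cases Int_def)
  also have "\<dots> \<le> (\<Sum>a<A. d * (X / real_of_int q ^ Suc (a div d) + 1))"
  proof (rule sum_mono)
    fix a
    have "d * (a div d) < Suc a" using times_div_less_eq_dividend[of d a] by (simp add: less_Suc_eq_le)
    from card_roots_interval[OF q g(1,2) this]
    show "real (card {i\<in>{1..X}. q ^ Suc a dvd poly g (int (N + i))}) \<le> d * (X / real_of_int q ^ Suc (a div d) + 1)" .
  qed
  also have "\<dots> = d * X * (\<Sum>a<A. 1 / real_of_int q ^ Suc (a div d)) + d * A"
    by (simp add: sum_distrib_left sum.distrib algebra_simps)
  also have "\<dots> \<le> d * X * (d * (1 / (real_of_int q - 1))) + d * A"
  proof (intro add_mono mult_left_mono)
    have "(\<Sum>a<A. 1 / real_of_int q ^ Suc (a div d)) \<le> d * (\<Sum>b<A. 1 / real_of_int q ^ Suc b)"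
      using g(3) q0 by (intro sum_div_blocks_le) auto
    also have "\<dots> \<le> d * (1 / (real_of_int q - 1))"
      using q0 by (intro mult_left_mono geometric_sum_le) auto
    finally show "(\<Sum>a<A. 1 / real_of_int q ^ Suc (a div d)) \<le> d * (1 / (real_of_int q - 1))" .
  qed auto
  finally have "(\<Sum>i\<in>{1..X}. real (m i)) \<le> d * X * (d * (1 / (real_of_int q - 1))) + d * A" .
  then have "(\<Sum>i\<in>{1..X}. real (m i)) * ln (real_of_int q) \<le> (d * X * (d * (1 / (real_of_int q - 1))) + d * A) * ln (real_of_int q)"
    using q0 by (intro mult_right_mono) auto
  also have "\<dots> = d * (A * ln (real_of_int q)) + real d ^ 2 * X * (ln (real_of_int q) / (real_of_int q - 1))"
    by (simp add: power2_eq_square algebra_simps)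
  also have "\<dots> \<le> d * ln G + real d ^ 2 * X * (ln (real_of_int q) / (real_of_int q - 1))"
    using lnA by (intro add_mono mult_left_mono) auto
  finally show ?thesis unfolding m_def .
qed

lemma ln_eq_sum_multiplicity:
  fixes m :: int
  assumes "m > 0" "finite P" "prime_factors m \<subseteq> P" "\<And>q. q \<in> P \<Longrightarrow> prime q"
  shows "ln (real_of_int m) = (\<Sum>q\<in>P. real (multiplicity q m) * ln (real_of_int q))"
proof -
  have pos: "q > 0" if "q \<in> P" for q using assms(4)[OF that] prime_gt_0_int by blast
  have "m = (\<Prod>q\<in>prime_factors m. q ^ multiplicity q m)"
    using assms(1) prod_prime_factors[of m] by simp
  also have "\<dots> = (\<Prod>q\<in>P. q ^ multiplicity q m)"
  proof (intro prod.mono_neutral_left assms(2,3) ballI)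
    fix q assume q: "q \<in> P - prime_factors m"
    then have "\<not> q dvd m" using assms(1) assms(4) by (auto simp: in_prime_factors_iff)
    then show "q ^ multiplicity q m = 1" by (simp add: not_dvd_imp_multiplicity_0)
  qed
  finally have "real_of_int m = (\<Prod>q\<in>P. real_of_int q ^ multiplicity q m)"
    by (metis (mono_tags, lifting) of_int_power of_int_prod prod.cong)
  also have "ln \<dots> = (\<Sum>q\<in>P. ln (real_of_int q ^ multiplicity q m))"
    by (rule ln_prod[OF assms(2)]) (use pos in force)
  also have "\<dots> = (\<Sum>q\<in>P. real (multiplicity q m) * ln (real_of_int q))"
    by (intro sum.cong refl ln_realpow)
  finally show ?thesis .
qed

text \<open>
  Each term satisfies \<open>1 / (n + 1) \<le> ln (n + 1) - ln n\<close>.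
\<close>

lemma harm_le_ln: "n \<ge> 1 \<Longrightarrow> (\<Sum>j\<in>{1..n}. 1 / real j) \<le> 1 + ln n"
proof (induction n rule: dec_induct)
  case (step n)
  then have n: "n \<ge> 1" by simp
  have "1 / real (Suc n) \<le> ln (real (Suc n)) - ln (real n)"
  proof -
    have "ln (real n / real (Suc n)) \<le> real n / real (Suc n) - 1" using n by (intro ln_le_minus_one) auto
    moreover have "ln (real n / real (Suc n)) = ln (real n) - ln (real (Suc n))" using n by (simp add: ln_div)
    moreover have "real n / real (Suc n) - 1 = - 1 / real (Suc n)" by (simp add: field_simps)
    ultimately show ?thesis by simp
  qed
  then show ?case using step by simp
qed simp

text \<open>
  One term \<open>n ^ n / n!\<close> of the exponential series is at most \<open>exp n\<close>.
\<close>

lemma ln_fact_ge: "real n * ln n - n \<le> ln (fact n)"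
proof (cases "n = 0")
  case False
  have "real n ^ n / fact n \<le> exp n"
  proof -
    have "(\<lambda>k. real n ^ k / fact k) sums exp (real n)"
      using exp_converges[of "real n"] by (simp add: divide_inverse mult.commute)
    then have "(\<Sum>k\<in>{n}. real n ^ k / fact k) \<le> exp (real n)"
      unfolding sums_unique[of _ "exp (real n)", symmetric]
      by (metis (no_types, lifting) divide_nonneg_nonneg finite.emptyI finite.insertI of_nat_0_le_iff sum_le_suminf
          sums_iff zero_le_power fact_ge_zero)
    then show ?thesis by simp
  qed
  then have "ln (real n ^ n / fact n) \<le> ln (exp (real n))" using False by (intro ln_mono) auto
  then show ?thesis using False by (simp add: ln_div ln_realpow)
qed simp

text \<open>
  Otherwise all values of \<open>g\<close> at the \<open>X\<close> points are products of primes up to \<open>Y\<close>. The logarithm of their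
  product is at least \<open>ln (X!)\<close>, whereas \<open>sum_multiplicity_le\<close> bounds the contribution of the primes up to
  \<open>Y\<close> by about \<open>d\<^sup>2 * X * ln\<^sup>2 Y\<close>. So \<open>ln X\<close> of order \<open>ln\<^sup>2 Y\<close> suffices for a contradiction.
\<close>

lemma exists_large_prime_divisor:
  fixes g :: "int poly" and N X Y :: nat and G :: real
  assumes g: "lead_coeff g = 1" "degree g = d" "d \<ge> 1"
    and bnd: "\<And>i. i \<in> {1..X} \<Longrightarrow> int i \<le> poly g (int (N + i)) \<and> real_of_int (poly g (int (N + i))) \<le> G"
    and X: "X \<ge> 1" and Y: "Y \<ge> 2"
    and ineq: "Y * d * ln G + real d ^ 2 * X * (ln Y * (1 + ln Y)) < X * ln X - X"
  shows "\<exists>q i. prime q \<and> q > int Y \<and> i \<in> {1..X} \<and> q dvd poly g (int (N + i))"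
proof (rule ccontr)
  assume none: "\<not> ?thesis"
  define P where "P = {q::int. prime q \<and> q \<le> int Y}"
  have "P \<subseteq> {2..int Y}" unfolding P_def using prime_ge_2_int by auto
  then have fP: "finite P" and cP: "card P \<le> Y"
    using finite_subset[of P "{2..int Y}"] card_mono[of "{2..int Y}" P] by auto
  have pos: "poly g (int (N + i)) > 0" if "i \<in> {1..X}" for i using bnd[OF that] that by auto
  have G1: "G \<ge> 1" using bnd[of 1] X by auto
  have "real X * ln X - X \<le> ln (fact X)" by (rule ln_fact_ge)
  also have "\<dots> = (\<Sum>i\<in>{1..X}. ln (real i))"
  proof -
    have "fact X = (\<Prod>i\<in>{1..X}. real i)" unfolding fact_prod by simp
    also have "ln \<dots> = (\<Sum>i\<in>{1..X}. ln (real i))" by (rule ln_prod) auto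
    finally show ?thesis .
  qed
  also have "\<dots> \<le> (\<Sum>i\<in>{1..X}. ln (real_of_int (poly g (int (N + i)))))"
  proof (intro sum_mono ln_mono)
    fix i assume i: "i \<in> {1..X}"
    show "real i \<le> real_of_int (poly g (int (N + i)))" using bnd[OF i] by (metis of_int_le_iff of_int_of_nat_eq)
  qed auto
  also have "\<dots> = (\<Sum>i\<in>{1..X}. \<Sum>q\<in>P. real (multiplicity q (poly g (int (N + i)))) * ln (real_of_int q))"
  proof (intro sum.cong refl ln_eq_sum_multiplicity fP)
    fix i assume i: "i \<in> {1..X}"
    show "0 < poly g (int (N + i))" by (rule pos[OF i])
    show "prime_factors (poly g (int (N + i))) \<subseteq> P"
      using none i unfolding P_def by (auto simp: in_prime_factors_iff not_less)
  qed (auto simp: P_def)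
  also have "\<dots> = (\<Sum>q\<in>P. (\<Sum>i\<in>{1..X}. real (multiplicity q (poly g (int (N + i))))) * ln (real_of_int q))"
    unfolding sum_distrib_right by (rule sum.swap)
  also have "\<dots> \<le> (\<Sum>q\<in>P. d * ln G + real d ^ 2 * X * (ln (real_of_int q) / (real_of_int q - 1)))"
    using bnd pos by (intro sum_mono sum_multiplicity_le g X) (auto simp: P_def)
  also have "\<dots> = card P * (d * ln G) + real d ^ 2 * X * (\<Sum>q\<in>P. ln (real_of_int q) / (real_of_int q - 1))"
    by (simp add: sum.distrib sum_distrib_left)
  also have "\<dots> \<le> Y * (d * ln G) + real d ^ 2 * X * (ln Y * (1 + ln Y))"
  proof (intro add_mono mult_right_mono mult_left_mono)
    have "(\<Sum>q\<in>P. ln (real_of_int q) / (real_of_int q - 1)) \<le> (\<Sum>q\<in>P. ln Y * (1 / (real_of_int q - 1)))"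
    proof (rule sum_mono)
      fix q assume "q \<in> P"
      then have q: "q \<ge> 2" "q \<le> int Y" using \<open>P \<subseteq> {2..int Y}\<close> by auto
      then have "ln (real_of_int q) \<le> ln (real Y)" by (intro ln_mono) auto
      then show "ln (real_of_int q) / (real_of_int q - 1) \<le> ln Y * (1 / (real_of_int q - 1))"
        using q by (simp add: divide_right_mono)
    qed
    also have "\<dots> = ln Y * (\<Sum>q\<in>P. 1 / (real_of_int q - 1))" by (simp add: sum_distrib_left)
    also have "\<dots> \<le> ln Y * (1 + ln Y)"
    proof (intro mult_left_mono)
      have "(\<Sum>q\<in>P. 1 / (real_of_int q - 1)) \<le> (\<Sum>q\<in>{2..int Y}. 1 / (real_of_int q - 1))"
        using \<open>P \<subseteq> {2..int Y}\<close> by (intro sum_mono2) auto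
      also have "\<dots> = (\<Sum>j\<in>{1..Y - 1}. 1 / real j)"
        by (rule sum.reindex_bij_witness[of _ "\<lambda>j. int j + 1" "\<lambda>q. nat (q - 1)"]) (auto simp: of_nat_diff)
      also have "\<dots> \<le> (\<Sum>j\<in>{1..Y}. 1 / real j)" by (intro sum_mono2) auto
      also have "\<dots> \<le> 1 + ln Y" using Y by (intro harm_le_ln) auto
      finally show "(\<Sum>q\<in>P. 1 / (real_of_int q - 1)) \<le> 1 + ln Y" .
    qed (use Y in auto)
    finally show "(\<Sum>q\<in>P. ln (real_of_int q) / (real_of_int q - 1)) \<le> ln Y * (1 + ln Y)" .
  qed (use cP G1 in auto)
  finally show False using ineq by (simp add: mult.assoc)
qed

section \<open>From eigenvalues to singular matrices modulo a prime\<close>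

definition int_adjacency :: "nat \<Rightarrow> nat set set \<Rightarrow> int mat" where
  "int_adjacency n E = Matrix.mat n n (\<lambda>(i, j). adj E i j)"

lemma int_adjacency_carrier [simp]: "int_adjacency n E \<in> carrier_mat n n"
  by (simp add: int_adjacency_def)

lemma adjacency_matrix_eq: "adjacency_matrix n E = map_mat of_int (int_adjacency n E)"
  by (rule eq_matI) (auto simp: adjacency_matrix_def int_adjacency_def adj_def)

lemma det_cong_mod:
  fixes A B :: "int mat"
  assumes A: "A \<in> carrier_mat n n" and B: "B \<in> carrier_mat n n"
    and c: "\<And>i j. i < n \<Longrightarrow> j < n \<Longrightarrow> [A $$ (i, j) = B $$ (i, j)] (mod q)"
  shows "[Determinant.det A = Determinant.det B] (mod q)"
  unfolding det_def'[OF A] det_def'[OF B]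
proof (intro cong_sum cong_mult cong_prod cong_refl c)
  fix \<pi> i assume "\<pi> \<in> {\<pi>. \<pi> permutes {0..<n}}" "i \<in> {0..<n}"
  then show "i < n" "\<pi> i < n" using permutes_in_image[of \<pi> "{0..<n}" i] by auto
qed

text \<open>
  If \<open>A - a I\<close> had no kernel modulo \<open>q\<close>, multiplication by it would be injective on the finite set of
  vectors, hence surjective. Preimages of the unit vectors form an inverse matrix modulo \<open>q\<close>, so the
  determinant would be a unit modulo \<open>q\<close>.
\<close>

lemma singular_mod_if_dvd_det:
  fixes q a :: int
  assumes q: "prime q" and dvd: "q dvd poly (char_poly (int_adjacency n E)) a"
  shows "singular_mod q a E n"
proof (rule ccontr)
  assume ns: "\<not> singular_mod q a E n"
  have q0: "q > 0" using q prime_gt_0_int by blast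
  define \<phi> where "\<phi> = (\<lambda>w. reduce q n (shift_mult E a n w))"
  have \<phi>V: "\<phi> ` Vec q n \<subseteq> Vec q n" unfolding \<phi>_def using reduce_in_Vec[OF q0] by blast
  have "inj_on \<phi> (Vec q n)"
  proof (rule inj_onI)
    fix v w assume v: "v \<in> Vec q n" and w: "w \<in> Vec q n" and eq: "\<phi> v = \<phi> w"
    have "solves q a E n v (shift_mult E a n w)"
      unfolding solves_def
    proof (intro allI impI)
      fix i assume i: "i < n"
      have "[shift_mult E a n v i = \<phi> v i] (mod q)" unfolding \<phi>_def by (rule cong_sym[OF reduce_cong[OF i]])
      also have "\<phi> v i = \<phi> w i" using eq by simp
      also have "[\<phi> w i = shift_mult E a n w i] (mod q)" unfolding \<phi>_def by (rule reduce_cong[OF i])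
      finally show "[shift_mult E a n v i = shift_mult E a n w i] (mod q)" .
    qed
    moreover have "solves q a E n w (shift_mult E a n w)" by (simp add: solves_def)
    ultimately show "v = w" using nonsingular_unique[OF q0 ns] by (intro Vec_eqI[OF v w]) blast
  qed
  then have surj: "\<phi> ` Vec q n = Vec q n" using \<phi>V by (intro endo_inj_surj) auto
  have "\<exists>w. \<forall>i<n. [shift_mult E a n w i = (if i = j then 1 else 0)] (mod q)" for j
  proof -
    have "reduce q n (\<lambda>i. if i = j then 1 else 0) \<in> \<phi> ` Vec q n" unfolding surj by (rule reduce_in_Vec[OF q0])
    then obtain w where w: "\<phi> w = reduce q n (\<lambda>i. if i = j then 1 else 0)" by auto
    have "[shift_mult E a n w i = (if i = j then 1 else 0)] (mod q)" if i: "i < n" for i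
    proof -
      have "[shift_mult E a n w i = \<phi> w i] (mod q)" unfolding \<phi>_def by (rule cong_sym[OF reduce_cong[OF i]])
      also have "\<phi> w i = reduce q n (\<lambda>i. if i = j then 1 else 0) i" unfolding w ..
      also have "[\<dots> = (if i = j then 1 else 0)] (mod q)" by (rule reduce_cong[OF i])
      finally show ?thesis .
    qed
    then show ?thesis by blast
  qed
  then obtain W where W: "\<And>i j. i < n \<Longrightarrow> [shift_mult E a n (W j) i = (if i = j then 1 else 0)] (mod q)" by metis
  define M where "M = Matrix.mat n n (\<lambda>(i, j). (if i = j then a else 0) - adj E i j)"
  define N where "N = Matrix.mat n n (\<lambda>(i, j). W j i)"
  have car: "M \<in> carrier_mat n n" "N \<in> carrier_mat n n" by (auto simp: M_def N_def)
  have entry: "(M * N) $$ (i, j) = - shift_mult E a n (W j) i" if ij: "i < n" "j < n" for i j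
  proof -
    have "(M * N) $$ (i, j) = (\<Sum>k\<in>{0..<n}. M $$ (i, k) * N $$ (k, j))"
      using car ij by (simp add: scalar_prod_def)
    also have "\<dots> = (\<Sum>k<n. ((if i = k then a else 0) - adj E i k) * W j k)"
      using ij by (intro sum.cong) (auto simp: M_def N_def)
    also have "\<dots> = (\<Sum>k<n. (if i = k then a * W j k else 0) - adj E i k * W j k)"
      by (intro sum.cong) (auto simp: left_diff_distrib)
    also have "\<dots> = a * W j i - (\<Sum>k<n. adj E i k * W j k)"
      using ij by (simp add: sum_subtractf)
    finally show ?thesis by (simp add: shift_mult_def)
  qed
  have "[Determinant.det (M * N) = Determinant.det (- 1\<^sub>m n)] (mod q)"
  proof (rule det_cong_mod)
    fix i j assume ij: "i < n" "j < n"
    have "[- shift_mult E a n (W j) i = - (if i = j then 1 else 0)] (mod q)"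
      using W[OF ij(1)] by (simp only: cong_minus_minus_iff)
    then show "[(M * N) $$ (i, j) = (- 1\<^sub>m n) $$ (i, j)] (mod q)"
      unfolding entry[OF ij] using ij by simp
  qed (use car in auto)
  moreover have "Determinant.det (- 1\<^sub>m n :: int mat) = (-1) ^ n"
  proof -
    have "- 1\<^sub>m n = (- 1 :: int) \<cdot>\<^sub>m 1\<^sub>m n" by (rule eq_matI) auto
    then show ?thesis by (simp add: det_smult)
  qed
  moreover have "Determinant.det (M * N) = Determinant.det M * Determinant.det N" by (rule det_mult[OF car])
  ultimately have cong: "[Determinant.det M * Determinant.det N = (-1) ^ n] (mod q)" by simp
  have "poly (char_poly (int_adjacency n E)) a = Determinant.det M"
    unfolding char_poly_def
    by (rule poly_det_cong[OF car(1), where B = "char_poly_matrix (int_adjacency n E)"])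
       (auto simp: char_poly_matrix_def M_def int_adjacency_def)
  then have "[Determinant.det M * Determinant.det N = 0] (mod q)" using dvd by (simp add: cong_0_iff)
  then have "[(-1) ^ n = 0] (mod q)" using cong by (meson cong_sym cong_trans)
  then have "q dvd (-1) ^ n" by (simp add: cong_0_iff)
  then have "q dvd 1" by (cases "even n") auto
  then show False using q prime_imp_prime_elem prime_elem_not_unit by blast
qed

text \<open>
  Compare both sides of \<open>A v = \<alpha> v\<close> at a coordinate of \<open>v\<close> of maximal modulus.
\<close>

lemma norm_root_char_poly_le:
  assumes r: "poly (map_poly of_int (char_poly (int_adjacency n E))) (\<alpha> :: complex) = 0"
  shows "cmod \<alpha> \<le> n"
proof -
  define A where "A = map_mat complex_of_int (int_adjacency n E)"
  have A: "A \<in> carrier_mat n n" by (simp add: A_def)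
  have "eigenvalue A \<alpha>"
    unfolding eigenvalue_root_char_poly[OF A] using r
    unfolding A_def of_int_hom.char_poly_hom[OF int_adjacency_carrier] .
  then obtain v where v: "v \<in> carrier_vec n" "v \<noteq> 0\<^sub>v n" "A *\<^sub>v v = \<alpha> \<cdot>\<^sub>v v"
    using A unfolding eigenvalue_def eigenvector_def by auto
  then have n0: "n > 0" by (metis carrier_vecD eq_vecI gr0I index_zero_vec(2) less_nat_zero_code)
  define m where "m = Max ((\<lambda>i. cmod (v $ i)) ` {..<n})"
  have "m \<in> (\<lambda>i. cmod (v $ i)) ` {..<n}" unfolding m_def using n0 by (intro Max_in) auto
  then obtain i where i: "i < n" "m = cmod (v $ i)" by auto
  have le: "cmod (v $ j) \<le> m" if "j < n" for j unfolding m_def using that by (intro Max_ge) auto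
  have "m > 0"
  proof (rule ccontr)
    assume "\<not> m > 0"
    then have "cmod (v $ j) \<le> 0" if "j < n" for j using le[OF that] by linarith
    then have "v $ j = 0" if "j < n" for j using that by simp
    then have "v = 0\<^sub>v n" using v(1) by (intro eq_vecI) auto
    then show False using v(2) by simp
  qed
  have "cmod \<alpha> * m = cmod ((A *\<^sub>v v) $ i)" unfolding v(3) i(2) using v(1) i(1) by (simp add: norm_mult)
  also have "(A *\<^sub>v v) $ i = (\<Sum>j\<in>{0..<n}. A $$ (i, j) * v $ j)"
    using A v(1) i(1) by (simp add: scalar_prod_def)
  also have "cmod \<dots> \<le> (\<Sum>j\<in>{0..<n}. cmod (A $$ (i, j) * v $ j))" by (rule norm_sum)
  also have "\<dots> \<le> (\<Sum>j\<in>{0..<n}. m)"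
  proof (rule sum_mono)
    fix j assume "j \<in> {0..<n}"
    then have j: "j < n" by simp
    then have "cmod (A $$ (i, j)) \<le> 1" using i(1) by (simp add: A_def int_adjacency_def adj_def)
    then have "cmod (A $$ (i, j)) * cmod (v $ j) \<le> 1 * m" using le[OF j] by (intro mult_mono) auto
    then show "cmod (A $$ (i, j) * v $ j) \<le> m" by (simp add: norm_mult)
  qed
  finally have "cmod \<alpha> * m \<le> n * m" by simp
  then show ?thesis using \<open>m > 0\<close> by simp
qed

lemma common_denominator:
  fixes m :: "rat poly"
  shows "\<exists>D m0. D > 0 \<and> map_poly of_int m0 = Polynomial.smult (of_int D) m"
proof (induction m)
  case 0
  show ?case by (intro exI[of _ 1] exI[of _ 0]) simp
next
  case (pCons a m)
  then obtain D m0 where D: "D > 0" "map_poly of_int m0 = Polynomial.smult (of_int D) m" by blast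
  obtain x y where xy: "a = of_int x / of_int y" "y > 0"
    by (metis quotient_of_denom_pos quotient_of_div surj_pair)
  have "map_poly of_int (pCons (D * x) (Polynomial.smult y m0)) = Polynomial.smult (of_int (D * y)) (pCons a m)"
  proof (rule poly_eqI)
    fix i
    have "of_int (coeff m0 j) = of_int D * coeff m j" for j
      using arg_cong[OF D(2), of "\<lambda>p. coeff p j"] by (simp add: coeff_map_poly)
    then show "coeff (map_poly of_int (pCons (D * x) (Polynomial.smult y m0))) i = coeff (Polynomial.smult (of_int (D * y)) (pCons a m)) i"
      using xy by (cases i) (auto simp: coeff_map_poly)
  qed
  then show ?case using D xy by (intro exI[of _ "D * y"] exI) auto
qed

lemma smult_cancel_left:
  fixes c :: "'a :: idom"
  assumes "c \<noteq> 0" "Polynomial.smult c u = Polynomial.smult c v"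
  shows "u = v"
proof (rule poly_eqI)
  fix i show "coeff u i = coeff v i"
    using arg_cong[OF assms(2), of "\<lambda>t. coeff t i"] assms(1) by simp
qed

text \<open>
  Gauss's lemma. After clearing denominators with \<open>D\<close> and \<open>D'\<close>, the contents of the factors divide the
  leading coefficients \<open>D\<close> and \<open>D'\<close> and have product \<open>D * D'\<close>; so they are equal to them and can be cancelled.
\<close>

lemma monic_factor_integral:
  fixes m h :: "rat poly" and cp :: "int poly"
  assumes "m * h = map_poly of_int cp" and cp: "lead_coeff cp = 1" and m: "lead_coeff m = 1"
  obtains g g' where "map_poly of_int g = m" "g * g' = cp"
proof -
  obtain D m0 where D: "D > 0" "map_poly of_int m0 = Polynomial.smult (of_int D) m"
    using common_denominator by blast
  obtain D' h0 where D': "D' > 0" "map_poly of_int h0 = Polynomial.smult (of_int D') h"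
    using common_denominator by blast
  have hom: "map_poly rat_of_int (p * r) = map_poly of_int p * map_poly of_int r" for p r
    by (rule of_int_poly_hom.hom_mult)
  have inj: "p = r" if "map_poly rat_of_int p = map_poly of_int r" for p r
    using that by simp
  have smult: "map_poly rat_of_int (Polynomial.smult t p) = Polynomial.smult (of_int t) (map_poly of_int p)" for t p
    by (rule poly_eqI) (simp add: coeff_map_poly)
  have lead: "lead_coeff (map_poly rat_of_int p) = of_int (lead_coeff p)" for p
    by (simp add: coeff_map_poly degree_map_poly)
  have lm0: "lead_coeff m0 = D"
  proof -
    have "rat_of_int (lead_coeff m0) = of_int D" unfolding lead[symmetric] D(2) using m by simp
    then show ?thesis by simp
  qed
  have "lead_coeff m * lead_coeff h = 1"
    unfolding lead_coeff_mult[symmetric] assms(1) lead cp by simp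
  then have lh: "lead_coeff h = 1" using m by simp
  have lh0: "lead_coeff h0 = D'"
  proof -
    have "rat_of_int (lead_coeff h0) = of_int D'" unfolding lead[symmetric] D'(2) using lh by simp
    then show ?thesis by simp
  qed
  have prod: "m0 * h0 = Polynomial.smult (D * D') cp"
  proof (rule inj)
    show "map_poly rat_of_int (m0 * h0) = map_poly of_int (Polynomial.smult (D * D') cp)"
      unfolding hom smult D(2) D'(2) assms(1)[symmetric] by (simp add: mult.commute)
  qed
  have "Polynomial.content cp dvd coeff cp (degree cp)" by (rule content_dvd_coeff)
  then have ccp: "Polynomial.content cp = 1" using cp by (metis dvd_refl normalize_content is_unit_normalize)
  have "Polynomial.content m0 * Polynomial.content h0 = normalize (D * D') * Polynomial.content cp"
    unfolding content_mult[symmetric] prod by (rule content_smult)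
  then have c: "Polynomial.content m0 * Polynomial.content h0 = D * D'" using D D' ccp by (simp add: abs_mult)
  have "Polynomial.content m0 dvd D" using content_dvd_coeff[of m0 "degree m0"] lm0 by simp
  moreover have "Polynomial.content h0 dvd D'" using content_dvd_coeff[of h0 "degree h0"] lh0 by simp
  moreover have nn: "Polynomial.content m0 \<ge> 0" "Polynomial.content h0 \<ge> 0" by (metis abs_ge_zero normalize_content normalize_int_def)+
  ultimately have le: "Polynomial.content m0 \<le> D" "Polynomial.content h0 \<le> D'" using D D' zdvd_imp_le by auto
  have pos: "Polynomial.content m0 > 0" "Polynomial.content h0 > 0" using c D D' nn
    by (metis less_le mult_zero_left mult_zero_right zero_less_mult_iff order.strict_iff_order)+
  have "Polynomial.content m0 = D"
  proof (rule ccontr)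
    assume "Polynomial.content m0 \<noteq> D"
    then have "Polynomial.content m0 < D" using le by simp
    then have "Polynomial.content m0 * Polynomial.content h0 < D * Polynomial.content h0" using pos by simp
    also have "\<dots> \<le> D * D'" using le D by simp
    finally show False using c by simp
  qed
  moreover from this have "Polynomial.content h0 = D'" using c D by simp
  ultimately have pp: "m0 = Polynomial.smult D (primitive_part m0)" "h0 = Polynomial.smult D' (primitive_part h0)"
    using content_times_primitive_part[of m0] content_times_primitive_part[of h0] by simp_all
  have "Polynomial.smult (of_int D) (map_poly of_int (primitive_part m0)) = Polynomial.smult (of_int D) m"
    unfolding smult[symmetric] pp(1)[symmetric] D(2) ..
  then have "map_poly of_int (primitive_part m0) = m" by (rule smult_cancel_left[rotated]) (use D in simp)
  moreover have "primitive_part m0 * primitive_part h0 = cp"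
  proof -
    have "Polynomial.smult (D * D') (primitive_part m0 * primitive_part h0)
        = Polynomial.smult D (primitive_part m0) * Polynomial.smult D' (primitive_part h0)"
      by (simp add: mult.commute)
    also have "\<dots> = m0 * h0" by (simp only: pp[symmetric])
    finally have "Polynomial.smult (D * D') (primitive_part m0 * primitive_part h0) = m0 * h0" .
    then have "Polynomial.smult (D * D') (primitive_part m0 * primitive_part h0) = Polynomial.smult (D * D') cp"
      using prod by simp
    then show ?thesis by (rule smult_cancel_left[rotated]) (use D D' in simp)
  qed
  ultimately show ?thesis using that by blast
qed

text \<open>
  A superset of the minimal polynomials that have to be considered for graphs on \<open>n\<close> vertices.
\<close>

definition bounded_polys :: "nat \<Rightarrow> nat \<Rightarrow> int poly set" where
  "bounded_polys K n = {g. lead_coeff g = 1 \<and> 1 \<le> degree g \<and> degree g \<le> K \<and>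
     (\<forall>\<alpha>::complex. poly (map_poly of_int g) \<alpha> = 0 \<longrightarrow> cmod \<alpha> \<le> n)}"

text \<open>
  The minimal polynomial of the eigenvalue divides the characteristic polynomial over the rationals, and
  Gauss's lemma makes it integral.
\<close>

lemma low_degree_eigenvalue_factor:
  assumes ev: "eigenvalue (adjacency_matrix n E) \<mu>" and alg: "algebraic \<mu>" and deg: "algebraic_degree \<mu> \<le> K"
  shows "\<exists>g\<in>bounded_polys K n. g dvd char_poly (int_adjacency n E)"
proof -
  define cp where "cp = char_poly (int_adjacency n E)"
  have mon: "lead_coeff cp = 1" unfolding cp_def using degree_monic_char_poly[OF int_adjacency_carrier] by auto
  define m where "m = rat_min_poly \<mu>"
  have "\<exists>!q. is_rat_min_poly \<mu> q" by (rule ex1_is_rat_min_poly[OF alg])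
  then have "is_rat_min_poly \<mu> m" unfolding m_def rat_min_poly_def by (rule theI')
  then have m: "lead_coeff m = 1" "poly (map_poly of_rat m) \<mu> = 0"
    "\<And>r. r \<noteq> 0 \<Longrightarrow> poly (map_poly of_rat r) \<mu> = 0 \<Longrightarrow> degree m \<le> degree r"
    unfolding is_rat_min_poly_def by auto
  have dm: "degree m = algebraic_degree \<mu>" by (simp add: m_def algebraic_degree_def)
  have m0: "m \<noteq> 0" using m(1) by auto
  have dm1: "degree m \<ge> 1"
  proof (rule ccontr)
    assume "\<not> degree m \<ge> 1"
    then have "degree m = 0" by simp
    then obtain b where b: "m = [:b:]" by (rule degree_eq_zeroE)
    then have "b = 1" using m(1) by simp
    then show False using m(2) b by simp
  qed
  have "eigenvalue (map_mat real_of_int (int_adjacency n E)) \<mu>" using ev unfolding adjacency_matrix_eq .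
  then have root: "poly (map_poly real_of_int cp) \<mu> = 0"
    unfolding cp_def of_int_hom.char_poly_hom[OF int_adjacency_carrier, symmetric]
    by (subst (asm) eigenvalue_root_char_poly[of _ n]) auto
  have rr: "map_poly of_rat (map_poly rat_of_int p) = map_poly real_of_int p" for p
    by (rule poly_eqI) (simp add: coeff_map_poly)
  define r where "r = map_poly rat_of_int cp mod m"
  have split: "map_poly rat_of_int cp = m * (map_poly of_int cp div m) + r" unfolding r_def by simp
  have evp: "poly (map_poly of_rat (a * b + c)) \<mu> = poly (map_poly of_rat a) \<mu> * poly (map_poly of_rat b) \<mu> + poly (map_poly of_rat c) \<mu>"
    for a b c :: "rat poly"
  proof -
    interpret h: map_poly_comm_ring_hom "of_rat :: rat \<Rightarrow> real" by unfold_locales (simp_all add: of_rat_add of_rat_mult)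
    show ?thesis by (simp only: h.hom_add h.hom_mult poly_add poly_mult)
  qed
  have "poly (map_poly of_rat (map_poly rat_of_int cp)) \<mu> = 0" using root unfolding rr .
  then have "poly (map_poly of_rat (m * (map_poly of_int cp div m) + r)) \<mu> = 0" by (simp only: split[symmetric])
  then have "poly (map_poly of_rat r) \<mu> = 0" unfolding evp m(2) by simp
  moreover have "r = 0 \<or> degree r < degree m" unfolding r_def by (rule degree_mod_less[OF m0])
  ultimately have "r = 0" using m(3)[of r] by linarith
  then have "m * (map_poly of_int cp div m) = map_poly of_int cp" using split by simp
  from monic_factor_integral[OF this mon m(1)] obtain g g' where g: "map_poly of_int g = m" "g * g' = cp" .
  have dg: "degree g = degree m" unfolding g(1)[symmetric] by (simp add: degree_map_poly)
  have "rat_of_int (lead_coeff g) = 1"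
    using m(1) unfolding g(1)[symmetric] by (simp add: coeff_map_poly degree_map_poly)
  then have "lead_coeff g = 1" by simp
  moreover have "cmod \<alpha> \<le> n" if "poly (map_poly of_int g) \<alpha> = 0" for \<alpha> :: complex
  proof -
    have "poly (map_poly of_int cp) \<alpha> = 0"
      unfolding g(2)[symmetric] of_int_poly_hom.hom_mult using that by simp
    then show ?thesis unfolding cp_def by (rule norm_root_char_poly_le)
  qed
  ultimately have "g \<in> bounded_polys K n" unfolding bounded_polys_def using dg dm dm1 deg by auto
  then show ?thesis using g(2) unfolding cp_def[symmetric] by (intro bexI[of _ g]) auto
qed

lemma bounded_polys_linear_factors:
  assumes "g \<in> bounded_polys K n"
  obtains as where "map_poly complex_of_int g = (\<Prod>a\<leftarrow>as. [:- a, 1:])" "length as = degree g" "\<forall>a\<in>set as. cmod a \<le> n"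
proof -
  obtain as where as: "Polynomial.smult (lead_coeff (map_poly complex_of_int g)) (\<Prod>a\<leftarrow>as. [:- a, 1:]) = map_poly complex_of_int g"
    "length as = degree (map_poly complex_of_int g)"
    using fundamental_theorem_algebra_factorized by blast
  have "lead_coeff (map_poly complex_of_int g) = 1"
    using assms unfolding bounded_polys_def by (simp add: coeff_map_poly degree_map_poly)
  then have 1: "map_poly complex_of_int g = (\<Prod>a\<leftarrow>as. [:- a, 1:])" using as(1) by simp
  have "cmod a \<le> n" if "a \<in> set as" for a
  proof -
    have "poly (map_poly complex_of_int g) a = 0"
      unfolding 1 poly_prod_list using that by (auto simp: prod_list_zero_iff)
    then show ?thesis using assms unfolding bounded_polys_def by auto
  qed
  then show ?thesis using that[OF 1] as(2) by (simp add: degree_map_poly)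
qed

lemma coeff_linear_factors_le:
  fixes as :: "complex list"
  assumes "\<forall>a\<in>set as. cmod a \<le> r" "r \<ge> 0"
  shows "cmod (coeff (\<Prod>a\<leftarrow>as. [:- a, 1:]) k) \<le> (r + 1) ^ length as"
  using assms(1)
proof (induction as arbitrary: k)
  case Nil
  then show ?case by (cases k) auto
next
  case (Cons a as)
  define p where "p = (\<Prod>a\<leftarrow>as. [:- a, 1:])"
  have IH: "cmod (coeff p j) \<le> (r + 1) ^ length as" for j using Cons unfolding p_def by simp
  have ra: "cmod a \<le> r" using Cons.prems by simp
  have "coeff ([:- a, 1:] * p) k = - a * coeff p k + (if k = 0 then 0 else coeff p (k - 1))"
    by (cases k) (auto simp: coeff_pCons)
  then have "cmod (coeff ([:- a, 1:] * p) k) \<le> cmod a * cmod (coeff p k) + cmod (if k = 0 then 0 else coeff p (k - 1))"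
    by (metis norm_minus_cancel norm_mult norm_triangle_ineq)
  also have "\<dots> \<le> r * (r + 1) ^ length as + (r + 1) ^ length as"
    using IH ra assms(2) by (intro add_mono mult_mono) auto
  finally show ?case unfolding p_def by (simp add: algebra_simps)
qed

text \<open>
  Bounded roots give bounded coefficients, by expanding the product of the linear factors.
\<close>

lemma finite_card_bounded_polys:
  shows "finite (bounded_polys K n)" "card (bounded_polys K n) \<le> (2 * (n + 1) ^ K + 1) ^ (K + 1)"
proof -
  define M where "M = (int n + 1) ^ K"
  let ?S = "PiE {..K} (\<lambda>_. {-M..M})"
  let ?f = "\<lambda>g :: int poly. restrict (coeff g) {..K}"
  have img: "?f ` bounded_polys K n \<subseteq> ?S"
  proof (clarsimp)
    fix g k assume g: "g \<in> bounded_polys K n" "k \<le> K"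
    obtain as where as: "map_poly complex_of_int g = (\<Prod>a\<leftarrow>as. [:- a, 1:])" "length as = degree g" "\<forall>a\<in>set as. cmod a \<le> n"
      using bounded_polys_linear_factors[OF g(1)] by blast
    have "real_of_int \<bar>coeff g k\<bar> = cmod (coeff (map_poly complex_of_int g) k)" by (simp add: coeff_map_poly)
    also have "\<dots> \<le> (real n + 1) ^ degree g" unfolding as(1) as(2)[symmetric] by (rule coeff_linear_factors_le[OF as(3)]) simp
    also have "\<dots> \<le> (real n + 1) ^ K" using g(1) by (intro power_increasing) (auto simp: bounded_polys_def)
    also have "\<dots> = real_of_int M" by (simp add: M_def)
    finally have "\<bar>coeff g k\<bar> \<le> M" by linarith
    then show "- M \<le> coeff g k \<and> coeff g k \<le> M" by linarith
  qed
  have inj: "inj_on ?f (bounded_polys K n)"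
  proof (rule inj_onI)
    fix g h assume gh: "g \<in> bounded_polys K n" "h \<in> bounded_polys K n" "?f g = ?f h"
    show "g = h"
    proof (rule poly_eqI)
      fix k show "coeff g k = coeff h k"
      proof (cases "k \<le> K")
        case True then show ?thesis using fun_cong[OF gh(3), of k] by simp
      next
        case False
        then have "degree g < k" "degree h < k" using gh by (auto simp: bounded_polys_def)
        then show ?thesis by (simp add: coeff_eq_0)
      qed
    qed
  qed
  have fS: "finite ?S" by (intro finite_PiE) auto
  show "finite (bounded_polys K n)" using finite_imageD[OF finite_subset[OF img fS] inj] .
  have "card (bounded_polys K n) \<le> card ?S" by (rule card_inj_on_le[OF inj img fS])
  also have "card ?S = nat (2 * M + 1) ^ (K + 1)" by (simp add: card_PiE)
  also have "nat (2 * M + 1) = 2 * (n + 1) ^ K + 1"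
  proof -
    have "M = int ((n + 1) ^ K)" by (simp add: M_def add.commute)
    then show ?thesis by linarith
  qed
  finally show "card (bounded_polys K n) \<le> (2 * (n + 1) ^ K + 1) ^ (K + 1)" .
qed

text \<open>
  In absolute value both bounds are read off from the linear factors. The value is positive because a monic
  polynomial without real roots beyond \<open>n\<close> is positive there.
\<close>

lemma bounded_polys_values:
  assumes g: "g \<in> bounded_polys K n" and i: "i \<in> {1..X}"
  shows "int i \<le> poly g (int (n + i))" "real_of_int (poly g (int (n + i))) \<le> (2 * real n + X) ^ K"
proof -
  have dg: "1 \<le> degree g" "degree g \<le> K" "lead_coeff g = 1" using g by (auto simp: bounded_polys_def)
  obtain as where as: "map_poly complex_of_int g = (\<Prod>a\<leftarrow>as. [:- a, 1:])" "length as = degree g" "\<forall>a\<in>set as. cmod a \<le> n"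
    using bounded_polys_linear_factors[OF g] by blast
  have val: "complex_of_int (poly g x) = (\<Prod>a\<leftarrow>as. of_int x - a)" for x
  proof -
    have "complex_of_int (poly g x) = poly (map_poly complex_of_int g) (of_int x)" by (simp add: of_int_hom.poly_map_poly)
    also have "\<dots> = (\<Prod>a\<leftarrow>as. of_int x - a)" unfolding as(1) poly_prod_list by (simp add: o_def)
    finally show ?thesis .
  qed
  have abs_val: "real_of_int \<bar>poly g x\<bar> = (\<Prod>a\<leftarrow>as. cmod (of_int x - a))" for x
  proof -
    have "real_of_int \<bar>poly g x\<bar> = cmod (complex_of_int (poly g x))" by simp
    also have "\<dots> = (\<Prod>a\<leftarrow>as. cmod (of_int x - a))" unfolding val by (induction as) (auto simp: norm_mult)
    finally show ?thesis .
  qed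
  have bounds: "real i ^ length as \<le> (\<Prod>a\<leftarrow>as. cmod (of_int (int (n + i)) - a)) \<and>
     (\<Prod>a\<leftarrow>as. cmod (of_int (int (n + i)) - a)) \<le> (2 * real n + real i) ^ length as"
    using as(3)
  proof (induction as)
    case (Cons a as)
    have a: "cmod a \<le> n" using Cons.prems by simp
    have "cmod (of_int (int (n + i))) = real n + real i" by (metis norm_of_nat of_int_of_nat_eq of_nat_add)
    then have "real i \<le> cmod (of_int (int (n + i)) - a)" "cmod (of_int (int (n + i)) - a) \<le> 2 * real n + real i"
      using a norm_triangle_ineq2[of "of_int (int (n + i))" a] norm_triangle_ineq4[of "of_int (int (n + i))" a] by linarith+
    then show ?case using Cons by (auto intro!: mult_mono prod_list_nonneg)
  qed simp
  have i1: "real i \<ge> 1" using i by simp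
  have "real i \<le> real i ^ length as" using i1 dg as(2) by (simp add: self_le_power)
  then have "real i \<le> real_of_int \<bar>poly g (int (n + i))\<bar>" unfolding abs_val using bounds by linarith
  then have absi: "int i \<le> \<bar>poly g (int (n + i))\<bar>" by linarith
  have "real_of_int \<bar>poly g (int (n + i))\<bar> \<le> (2 * real n + real i) ^ length as" unfolding abs_val using bounds by blast
  also have "\<dots> \<le> (2 * real n + X) ^ length as" using i by (intro power_mono) auto
  also have "\<dots> \<le> (2 * real n + X) ^ K" using i dg as(2) by (intro power_increasing) auto
  finally show "real_of_int (poly g (int (n + i))) \<le> (2 * real n + X) ^ K" by simp
  define G where "G = map_poly real_of_int g"
  have Gval: "poly G (real_of_int x) = real_of_int (poly g x)" for x unfolding G_def by (simp add: of_int_hom.poly_map_poly)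
  have "poly g (int (n + i)) > 0"
  proof (rule ccontr)
    assume "\<not> poly g (int (n + i)) > 0"
    then have neg: "poly G (real (n + i)) < 0" using absi i Gval[of "int (n + i)"] by auto
    have "lead_coeff G > 0" unfolding G_def using dg(3) by (simp add: coeff_map_poly degree_map_poly)
    then obtain x0 where x0: "\<And>x. x \<ge> x0 \<Longrightarrow> poly G x \<ge> lead_coeff G" using poly_pinfty_gt_lc by blast
    define b where "b = max x0 (real (n + i) + 1)"
    have "poly G b > 0" using x0[of b] \<open>lead_coeff G > 0\<close> by (simp add: b_def)
    moreover have "real (n + i) < b" by (simp add: b_def)
    ultimately obtain x where x: "x > real (n + i)" "poly G x = 0"
      using poly_IVT_pos[of "real (n + i)" b G] neg by blast
    have "map_poly complex_of_int g = map_poly complex_of_real G"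
      unfolding G_def by (rule poly_eqI) (simp add: coeff_map_poly)
    then have "poly (map_poly complex_of_int g) (complex_of_real x) = complex_of_real (poly G x)"
      by (simp add: of_real_hom.poly_map_poly)
    then have "cmod (complex_of_real x) \<le> n" using g x(2) unfolding bounded_polys_def by auto
    then show False using x(1) by simp
  qed
  then show "int i \<le> poly g (int (n + i))" using absi by linarith
qed

section \<open>Choice of parameters\<close>

text \<open>
  The bound of \<open>prob_structured_solution\<close> in exponential form, for parameters of order \<open>x\<^sup>2\<close>. In the application
  \<open>x = ln n\<close> and \<open>\<sigma>\<close> is about \<open>sqrt n\<close>, which outweighs \<open>x ^ 4\<close> but is outweighed, even with a factor \<open>x\<^sup>2\<close>, by
  the number \<open>e\<close> of rows.
\<close>

lemma structured_error_le_exp: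
  fixes q n x C \<zeta> :: real and h m s \<sigma> e :: nat
  assumes q: "1 \<le> q" and n: "1 \<le> n" and C: "0 \<le> C" and \<zeta>: "0 < \<zeta>"
    and lnq: "ln q \<le> C * x\<^sup>2" and lnqn: "ln (2 * q * n) \<le> C * x\<^sup>2"
    and h: "h \<le> C * x\<^sup>2" and m: "m \<le> C * x\<^sup>2" and s: "s \<le> C * x\<^sup>2"
  shows "q ^ h * (3 * q ^ m * (2 * q * n) ^ s / 2 ^ \<sigma> + 3 * (q * n) ^ \<sigma> * \<zeta> ^ e)
     \<le> 3 * exp (3 * C\<^sup>2 * x ^ 4 - \<sigma> * ln 2) + 3 * exp (C\<^sup>2 * x ^ 4 + \<sigma> * (C * x\<^sup>2) + e * ln \<zeta>)"
proof -
  have pe: "y ^ k = exp (k * ln y)" if "y > 0" for y :: real and k :: nat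
    using that by (simp add: exp_of_nat_mult)
  have sq: "real k * ln y \<le> C\<^sup>2 * x ^ 4" if "real k \<le> C * x\<^sup>2" "ln y \<le> C * x\<^sup>2" "0 \<le> ln y" for k y
  proof -
    have "real k * ln y \<le> (C * x\<^sup>2) * (C * x\<^sup>2)" using that C by (intro mult_mono) auto
    also have "\<dots> = C\<^sup>2 * x ^ 4" by (simp add: power2_eq_square power4_eq_xxxx)
    finally show ?thesis .
  qed
  have qn: "1 \<le> q * n" using q n by (metis mult_mono mult_1 order_trans zero_le_one)
  have l0: "0 \<le> ln q" "0 \<le> ln (2 * q * n)" "ln (q * n) \<le> ln (2 * q * n)"
    using q n qn by (auto simp: mult.assoc)
  have qh: "q ^ h \<le> exp (C\<^sup>2 * x ^ 4)" and qm: "q ^ m \<le> exp (C\<^sup>2 * x ^ 4)"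
    using q sq[OF h lnq l0(1)] sq[OF m lnq l0(1)] by (simp_all add: pe)
  have qs: "(2 * q * n) ^ s \<le> exp (C\<^sup>2 * x ^ 4)"
    using qn sq[OF s lnqn l0(2)] by (subst pe) (auto simp: mult.assoc)
  have q\<sigma>: "(q * n) ^ \<sigma> \<le> exp (\<sigma> * (C * x\<^sup>2))"
  proof -
    have "ln (q * n) \<le> C * x\<^sup>2" using l0(3) lnqn by linarith
    then have "real \<sigma> * ln (q * n) \<le> \<sigma> * (C * x\<^sup>2)" by (intro mult_left_mono) auto
    then show ?thesis using qn by (subst pe) auto
  qed
  have "q ^ h * (3 * q ^ m * (2 * q * n) ^ s / 2 ^ \<sigma>)
      \<le> exp (C\<^sup>2 * x ^ 4) * (3 * exp (C\<^sup>2 * x ^ 4) * exp (C\<^sup>2 * x ^ 4) / 2 ^ \<sigma>)"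
    using q n by (intro mult_mono divide_right_mono qh qm qs) auto
  also have "\<dots> = 3 * exp (3 * C\<^sup>2 * x ^ 4 - \<sigma> * ln 2)"
  proof -
    define t where "t = C\<^sup>2 * x ^ 4"
    have t: "3 * C\<^sup>2 * x ^ 4 - \<sigma> * ln 2 = t + t + t - \<sigma> * ln 2" by (simp add: t_def)
    show ?thesis unfolding t t_def[symmetric] by (simp only: exp_diff exp_add exp_of_nat_mult) simp
  qed
  finally have 1: "q ^ h * (3 * q ^ m * (2 * q * n) ^ s / 2 ^ \<sigma>) \<le> 3 * exp (3 * C\<^sup>2 * x ^ 4 - \<sigma> * ln 2)" .
  have "q ^ h * (3 * (q * n) ^ \<sigma> * \<zeta> ^ e) \<le> exp (C\<^sup>2 * x ^ 4) * (3 * exp (\<sigma> * (C * x\<^sup>2)) * exp (e * ln \<zeta>))"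
    using q n \<zeta> by (intro mult_mono qh q\<sigma>) (auto simp: pe)
  also have "\<dots> = 3 * exp (C\<^sup>2 * x ^ 4 + \<sigma> * (C * x\<^sup>2) + e * ln \<zeta>)" by (simp add: exp_add)
  finally show ?thesis using 1 by (simp add: distrib_left)
qed

lemma eventually_structured_error:
  fixes C B a :: real
  assumes "a > 0"
  shows "\<forall>\<^sub>F n in sequentially. 3 * C\<^sup>2 * ln (real n) ^ 4 - sqrt n * ln 2 + B * ln n + 3 \<le> 0
     \<and> C\<^sup>2 * ln (real n) ^ 4 + (sqrt n + 1) * (\<bar>C\<bar> * (ln n)\<^sup>2) - (n / 2 - 3) * a + B * ln n + 3 \<le> 0"
proof (intro eventually_conj)
  have "filterlim (\<lambda>n::nat. sqrt n * ln 2 - (3 * C\<^sup>2 * ln (real n) ^ 4 + B * ln n + 3)) at_top sequentially"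
    by real_asymp
  then have "\<forall>\<^sub>F n::nat in sequentially. sqrt n * ln 2 - (3 * C\<^sup>2 * ln (real n) ^ 4 + B * ln n + 3) \<ge> 0"
    unfolding filterlim_at_top by (rule spec)
  then show "\<forall>\<^sub>F n in sequentially. 3 * C\<^sup>2 * ln (real n) ^ 4 - sqrt n * ln 2 + B * ln n + 3 \<le> 0"
    by (rule eventually_mono) linarith
  define D where "D = \<bar>C\<bar>"
  have "filterlim (\<lambda>n::nat. (n / 2 - 3) * a - (D\<^sup>2 * ln (real n) ^ 4 + (sqrt n + 1) * (D * (ln n)\<^sup>2) + B * ln n + 3)) at_top sequentially"
    using assms by real_asymp
  then have "\<forall>\<^sub>F n::nat in sequentially. (n / 2 - 3) * a - (D\<^sup>2 * ln (real n) ^ 4 + (sqrt n + 1) * (D * (ln n)\<^sup>2) + B * ln n + 3) \<ge> 0"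
    unfolding filterlim_at_top by (rule spec)
  then show "\<forall>\<^sub>F n in sequentially. C\<^sup>2 * ln (real n) ^ 4 + (sqrt n + 1) * (\<bar>C\<bar> * (ln n)\<^sup>2) - (n / 2 - 3) * a + B * ln n + 3 \<le> 0"
  proof (rule eventually_mono)
    fix n :: nat
    have *: "0 \<le> t - (u + v + w + 3) \<Longrightarrow> u + v - t + w + 3 \<le> 0" for t u v w :: real by linarith
    assume "(n / 2 - 3) * a - (D\<^sup>2 * ln (real n) ^ 4 + (sqrt n + 1) * (D * (ln n)\<^sup>2) + B * ln n + 3) \<ge> 0"
    from *[OF this] show "C\<^sup>2 * ln (real n) ^ 4 + (sqrt n + 1) * (\<bar>C\<bar> * (ln n)\<^sup>2) - (n / 2 - 3) * a + B * ln n + 3 \<le> 0"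
      by (simp add: D_def)
  qed
qed

lemma three_exp_le_powr:
  fixes n A B :: real
  assumes "n > 0" "A + B * ln n + 3 \<le> 0"
  shows "3 * exp A \<le> n powr (- B) / 2"
proof -
  have "2 ^ 3 \<le> exp (1::real) ^ 3" using exp_ge_add_one_self[of "1::real"] by (intro power_mono) auto
  then have e3: "8 \<le> exp (3::real)" by (simp add: exp_of_nat_mult[symmetric])
  have "exp A \<le> exp (- B * ln n - 3)" using assms(2) by simp
  also have "\<dots> = n powr (- B) / exp 3" using assms(1) by (simp add: powr_def exp_diff)
  also have "\<dots> \<le> n powr (- B) / 8" using e3 by (intro divide_left_mono) auto
  finally show ?thesis using powr_ge_zero[of n "- B"] by linarith
qed

text \<open>
  The lower bound on \<open>q\<close> makes \<open>\<tau> = 26 / q\<close> smaller than \<open>n powr (- 2 * B)\<close>, as the square root in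
  \<open>prob_singular_mod\<close> demands; the upper bound keeps the counting factors \<open>q ^ h\<close>, \<open>q ^ m\<close> and \<open>q ^ \<sigma>\<close> under control.
\<close>

lemma eventually_prob_singular_mod:
  fixes p B C2 :: real
  assumes p: "0 < p" "p < 1" and B: "B > 0" and C2: "C2 > 0"
  shows "\<forall>\<^sub>F n in sequentially. \<forall>q a. prime q \<and> odd q \<and> real n powr (2 * B + 3) \<le> real_of_int q
       \<and> ln (real_of_int q) \<le> C2 * (ln n)\<^sup>2 \<longrightarrow>
     prob (erdos_renyi n p) {E. singular_mod q a E n} \<le> real n powr (- B)"
proof -
  define k where "k = (26::nat)"
  define c where "c = p * (1 - p)"
  have c: "c > 0" using p by (simp add: c_def)
  define c' where "c' = c / (real k)\<^sup>2"
  have c': "c' > 0" "c' \<le> c" using c by (auto simp: c'_def k_def)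
  define \<kappa> where "\<kappa> = chord c'"
  have \<kappa>: "0 < \<kappa>" "\<kappa> < 1 / 2" using chord_bounds[OF c'(1)] by (auto simp: \<kappa>_def)
  define M where "M = max p (1 - p)"
  have M: "0 < M" "M < 1" using p by (auto simp: M_def)
  define \<zeta> where "\<zeta> = max M (1 - chord c)"
  have \<zeta>: "0 < \<zeta>" "\<zeta> < 1" using M chord_bounds[OF c] by (auto simp: \<zeta>_def)
  \<comment> \<open>All error terms will be of order \<open>n powr (- B2)\<close>: the square root costs half of the exponent, and
    the factor \<open>n\<close> from the vertex exposure and the constants need the surplus 3.\<close>
  define B2 where "B2 = 2 * B + 3"
  define C where "C = C2 + 2 + (B2 / (- ln M) + 1) + ((real k)\<^sup>2 * C2 / c + 1) + ((C2 + 25) * 2 / \<kappa> + 1)"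
  have pieces: "B2 / (- ln M) \<ge> 0" "(real k)\<^sup>2 * C2 / c \<ge> 0" "(C2 + 25) * 2 / \<kappa> \<ge> 0"
    using B M c C2 \<kappa> by (auto simp: B2_def divide_nonneg_neg)
  have C0: "C \<ge> 0" unfolding C_def using pieces C2 by linarith
  have C_ge: "B2 / (- ln M) + 1 \<le> C" "(real k)\<^sup>2 * C2 / c + 1 \<le> C" "(C2 + 25) * 2 / \<kappa> + 1 \<le> C"
    "C2 + 2 \<le> C" "C2 \<le> C" unfolding C_def using pieces C2 by linarith+
  have a: "- ln \<zeta> > 0" using \<zeta> by simp
  have "\<forall>\<^sub>F n::nat in sequentially. ln n \<ge> 1" by real_asymp
  moreover have "\<forall>\<^sub>F n::nat in sequentially. (C * (ln n)\<^sup>2) \<le> n / 2 - 3"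
  proof -
    have "filterlim (\<lambda>n::nat. (n / 2 - 3) - C * (ln n)\<^sup>2) at_top sequentially" by real_asymp
    then have "\<forall>\<^sub>F n::nat in sequentially. (n / 2 - 3) - C * (ln n)\<^sup>2 \<ge> 0" unfolding filterlim_at_top by (rule spec)
    then show ?thesis by (rule eventually_mono) linarith
  qed
  moreover have "\<forall>\<^sub>F n::nat in sequentially. n \<ge> 33" by (rule eventually_ge_at_top)
  ultimately show ?thesis using eventually_structured_error[OF a, of C B2]
  proof eventually_elim
    case (elim n)
    define x where "x = ln (real n)"
    have x1: "x \<ge> 1" using elim by (simp add: x_def)
    have xx: "x \<le> x\<^sup>2" "1 \<le> x\<^sup>2" using self_le_power[OF x1, of 2] one_le_power[OF x1, of 2] by simp_all
    have n33: "n \<ge> 33" using elim by simp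
    define N where "N = real n powr (- B2)"
    define P where "P = real n powr (- B)"
    have P: "0 < P" "P \<le> 1" using n33 B powr_mono[of "- B" 0 "real n"] by (simp_all add: P_def)
    have NP: "N = P * P / real n ^ 3"
    proof -
      have "N = real n powr ((- B + - B) - 3)" by (simp add: N_def B2_def)
      also have "\<dots> = P * P / real n powr 3" unfolding P_def using n33 by (simp only: powr_diff powr_add)
      finally show ?thesis using n33 by (simp add: powr_numeral)
    qed
    show ?case
    proof (intro allI impI)
      fix q a :: int
      assume "prime q \<and> odd q \<and> real n powr (2 * B + 3) \<le> real_of_int q \<and> ln (real_of_int q) \<le> C2 * (ln n)\<^sup>2"
      then have q: "prime q" "odd q" and qlow: "real n powr B2 \<le> real_of_int q"
        and lnq: "ln (real_of_int q) \<le> C2 * x\<^sup>2" by (auto simp: B2_def x_def)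
      have q1: "q > 1" using q prime_gt_1_int by blast
      have lnq0: "ln (real_of_int q) \<ge> 0" using q1 by simp
      \<comment> \<open>Enough resampled bits to make \<open>max p (1 - p) ^ h\<close> small.\<close>
      define h where "h = nat \<lceil>B2 * x / (- ln M)\<rceil>"
      define s where "s = nat \<lceil>(real k)\<^sup>2 * ln (real_of_int q) / c\<rceil>"
      \<comment> \<open>As \<open>1 - \<kappa> / 2 \<le> exp (- \<kappa> / 2)\<close> and \<open>exp 25 \<ge> 26 = k\<close>, this makes \<open>q * (1 - \<kappa> / 2) ^ m\<close> at most \<open>1 / k\<close>.\<close>
      define m where "m = nat \<lceil>(ln (real_of_int q) + 25) * 2 / \<kappa>\<rceil>"
      define \<sigma> where "\<sigma> = nat \<lceil>sqrt n\<rceil>"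
      define \<tau> where "\<tau> = k / real_of_int q"
      have ceil: "y \<le> real (nat \<lceil>y\<rceil>)" "y \<ge> 0 \<Longrightarrow> real (nat \<lceil>y\<rceil>) \<le> y + 1" for y :: real
        by linarith+
      have h_ge: "B2 * x / (- ln M) \<le> h" unfolding h_def by (rule ceil)
      have h_le: "h \<le> C * x\<^sup>2"
      proof -
        have "h \<le> B2 * x / (- ln M) + 1"
          unfolding h_def using B M x1 by (intro ceil) (auto simp: B2_def divide_nonneg_neg)
        also have "B2 * x / (- ln M) = (B2 / (- ln M)) * x" by simp
        also have "\<dots> + 1 \<le> (B2 / (- ln M)) * x\<^sup>2 + x\<^sup>2" using xx pieces(1) by (intro add_mono mult_left_mono) auto
        also have "\<dots> = (B2 / (- ln M) + 1) * x\<^sup>2" by (simp only: distrib_right mult_1)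
        also have "\<dots> \<le> C * x\<^sup>2" by (intro mult_right_mono C_ge) simp
        finally show ?thesis .
      qed
      have s_ge: "(real k)\<^sup>2 * ln (real_of_int q) / c \<le> s" unfolding s_def by (rule ceil)
      have s_le: "s \<le> C * x\<^sup>2"
      proof -
        have "s \<le> (real k)\<^sup>2 * ln (real_of_int q) / c + 1"
          unfolding s_def using c lnq0 by (intro ceil) auto
        also have "\<dots> \<le> (real k)\<^sup>2 * (C2 * x\<^sup>2) / c + x\<^sup>2"
          using c lnq xx by (intro add_mono divide_right_mono mult_left_mono) auto
        also have "\<dots> = ((real k)\<^sup>2 * C2 / c + 1) * x\<^sup>2" by (simp add: distrib_right)
        also have "\<dots> \<le> C * x\<^sup>2" by (intro mult_right_mono C_ge) simp
        finally show ?thesis .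
      qed
      have m_ge: "(ln (real_of_int q) + 25) * 2 / \<kappa> \<le> m" unfolding m_def by (rule ceil)
      have m_le: "m \<le> C * x\<^sup>2"
      proof -
        have "m \<le> (ln (real_of_int q) + 25) * 2 / \<kappa> + 1"
          unfolding m_def using \<kappa> lnq0 by (intro ceil) auto
        also have "\<dots> \<le> (C2 * x\<^sup>2 + 25 * x\<^sup>2) * 2 / \<kappa> + x\<^sup>2"
          using \<kappa> lnq xx by (intro add_mono divide_right_mono mult_right_mono) auto
        also have "\<dots> = ((C2 + 25) * 2 / \<kappa> + 1) * x\<^sup>2" by (simp add: algebra_simps add_divide_distrib)
        also have "\<dots> \<le> C * x\<^sup>2" by (intro mult_right_mono C_ge) simp
        finally show ?thesis .
      qed
      have \<sigma>: "sqrt n \<le> \<sigma>" "\<sigma> \<le> sqrt n + 1" unfolding \<sigma>_def by (rule ceil, rule ceil) simp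
      have lnqC: "ln (real_of_int q) \<le> C * x\<^sup>2"
      proof -
        have "C2 * x\<^sup>2 \<le> C * x\<^sup>2" by (intro mult_right_mono C_ge) simp
        then show ?thesis using lnq by linarith
      qed
      have lnqn: "ln (2 * real_of_int q * real n) \<le> C * x\<^sup>2"
      proof -
        have "ln (2 * real_of_int q * real n) = ln 2 + ln (real_of_int q) + x"
          using q1 n33 by (simp add: ln_mult x_def)
        also have "\<dots> \<le> x\<^sup>2 + C2 * x\<^sup>2 + x\<^sup>2" using ln_le_minus_one[of 2] xx lnq by (intro add_mono) auto
        also have "\<dots> = (C2 + 2) * x\<^sup>2" by (simp add: algebra_simps)
        also have "\<dots> \<le> C * x\<^sup>2" by (intro mult_right_mono C_ge) simp
        finally show ?thesis .
      qed
      have m_ok: "real_of_int q * (1 - \<kappa> / 2) ^ m \<le> 1 / k"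
      proof -
        have "(1 - \<kappa> / 2) ^ m \<le> exp (- (\<kappa> / 2)) ^ m"
          using \<kappa> exp_ge_add_one_self[of "- (\<kappa> / 2)"] by (intro power_mono) auto
        also have "\<dots> = exp (m * - (\<kappa> / 2))" by (rule exp_of_nat_mult[symmetric])
        also have "\<dots> \<le> exp (- ln (real_of_int q) - 25)"
          using m_ge \<kappa> by (simp add: field_simps)
        also have "\<dots> = 1 / (real_of_int q * exp 25)" using q1 by (simp add: exp_diff exp_minus field_simps)
        also have "\<dots> \<le> 1 / (real_of_int q * k)"
          using q1 exp_ge_add_one_self[of "25::real"] by (intro divide_left_mono mult_left_mono) (auto simp: k_def)
        finally have "real_of_int q * (1 - \<kappa> / 2) ^ m \<le> real_of_int q * (1 / (real_of_int q * k))"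
          using q1 by (intro mult_left_mono) auto
        then show ?thesis using q1 by simp
      qed
      define L where "L = n - 1"
      \<comment> \<open>Going back over half of the vertices exceeds any possible corank.\<close>
      define l where "l = L div 2"
      define i where "i = L - l"
      have "l \<le> L" by (simp add: l_def)
      then have L: "n = Suc L" "L = l + i" using n33 by (simp_all add: L_def i_def)
      have L3: "l \<le> Suc i" unfolding i_def l_def by linarith
      have lreal: "real l \<ge> n / 2 - 1" unfolding l_def L_def using n33 by linarith
      have hl: "h \<le> l"
      proof -
        have "real h \<le> n / 2 - 3" using h_le elim by (simp add: x_def)
        then show ?thesis using lreal by linarith
      qed
      have bad: "prob (erdos_renyi j p) {E. structured_sol q a c' \<tau> h j u E} \<le> N"
        if j: "l \<le> j" "j \<le> L" for j u
      proof -
        have jh: "j - h + h = j" using hl j by simp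
        have "prob (erdos_renyi (j - h + h) p)
            {E. \<exists>w\<in>Vec q (j - h + h). supp q (j - h + h) w \<noteq> {} \<and> conc (p * (1 - p) / (real k)\<^sup>2) q (j - h) w \<ge> k / real_of_int q
               \<and> solves q a E (j - h + h) w u}
          \<le> real_of_int q ^ h * (3 * real_of_int q ^ m * (2 * real_of_int q * real n) ^ s / 2 ^ \<sigma>
             + 3 * (real_of_int q * real n) ^ \<sigma> * max (max p (1 - p)) (1 - chord (p * (1 - p))) ^ (j - h + h - 1))"
        proof (rule prob_structured_solution[OF q(1) p])
          show "k \<ge> 26" by (simp add: k_def)
          show "j - h + h \<le> n" "n \<ge> 1" using jh j L by auto
          show "(real k)\<^sup>2 * ln (real_of_int q) / (p * (1 - p)) \<le> s" using s_ge by (simp add: c_def)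
          show "real_of_int q * (1 - chord (p * (1 - p) / (real k)\<^sup>2) / 2) ^ m \<le> 1 / k"
            using m_ok by (simp add: \<kappa>_def c'_def c_def)
        qed
        then have "prob (erdos_renyi j p) {E. structured_sol q a c' \<tau> h j u E}
          \<le> real_of_int q ^ h * (3 * real_of_int q ^ m * (2 * real_of_int q * real n) ^ s / 2 ^ \<sigma>
             + 3 * (real_of_int q * real n) ^ \<sigma> * \<zeta> ^ (j - 1))"
          unfolding jh structured_sol_def \<tau>_def c'_def c_def \<zeta>_def M_def .
        also have "\<dots> \<le> 3 * exp (3 * C\<^sup>2 * x ^ 4 - \<sigma> * ln 2) + 3 * exp (C\<^sup>2 * x ^ 4 + \<sigma> * (C * x\<^sup>2) + (j - 1) * ln \<zeta>)"
          using q1 n33 by (intro structured_error_le_exp C0 \<zeta>(1) lnqC lnqn h_le m_le s_le) auto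
        also have "\<dots> \<le> N / 2 + N / 2"
          unfolding N_def
        proof (intro add_mono three_exp_le_powr)
          have "sqrt n * ln 2 \<le> \<sigma> * ln 2" using \<sigma> by (intro mult_right_mono) auto
          then show "3 * C\<^sup>2 * x ^ 4 - \<sigma> * ln 2 + B2 * ln (real n) + 3 \<le> 0" using elim unfolding x_def by linarith
          have "\<sigma> * (C * x\<^sup>2) \<le> (sqrt n + 1) * (\<bar>C\<bar> * x\<^sup>2)" using \<sigma> C0 by (intro mult_mono) auto
          moreover have "real (j - 1) * ln \<zeta> \<le> (n / 2 - 3) * ln \<zeta>"
          proof (rule mult_right_mono_neg)
            show "real n / 2 - 3 \<le> real (j - 1)" using lreal j by linarith
          qed (use a in simp)
          ultimately show "C\<^sup>2 * x ^ 4 + \<sigma> * (C * x\<^sup>2) + real (j - 1) * ln \<zeta> + B2 * ln (real n) + 3 \<le> 0"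
            using elim unfolding x_def by (simp only: mult_minus_right) linarith
        qed (use n33 in auto)
        finally show ?thesis by simp
      qed
      have \<tau>0: "\<tau> \<ge> 0" using q1 by (simp add: \<tau>_def)
      have \<tau>N: "\<tau> \<le> 26 * N"
      proof -
        have "0 < real n powr B2" using n33 by simp
        then have "k / real_of_int q \<le> k / real n powr B2" using qlow q1 by (intro divide_left_mono) auto
        also have "\<dots> = 26 * N" by (simp add: N_def k_def powr_minus divide_inverse)
        finally show ?thesis by (simp add: \<tau>_def)
      qed
      have Mh: "M ^ h \<le> N"
      proof -
        have lnM: "ln M < 0" using M by simp
        have "M ^ h = exp (h * ln M)" using M by (simp add: exp_of_nat_mult)
        also have "\<dots> \<le> exp (- B2 * x)" using h_ge lnM by (simp add: field_simps)
        also have "\<dots> = N" using n33 by (simp add: N_def powr_def x_def)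
        finally show ?thesis .
      qed
      have "prob (erdos_renyi n p) {E. singular_mod q a E n}
          \<le> Suc i * (N + \<tau>) + sqrt (M ^ h + N + \<tau>)"
        unfolding L(1) L(2) M_def
      proof (rule prob_singular_mod[OF q])
        show "0 \<le> p" "p \<le> 1" "0 \<le> c'" "c' \<le> p * (1 - p)" "0 \<le> \<tau>" using p c' \<tau>0 by (auto simp: c_def)
        show "l \<le> Suc i" by (rule L3)
        show "h \<le> l + i" using hl by simp
      qed (use bad L in auto)
      also have "\<dots> \<le> n * (27 * N) + sqrt (28 * N)"
      proof (intro add_mono mult_mono real_sqrt_le_mono)
        have "Suc i \<le> n" using L by linarith
        then show "real (Suc i) \<le> real n" by (rule of_nat_mono)
        show "N + \<tau> \<le> 27 * N" "M ^ h + N + \<tau> \<le> 28 * N" using \<tau>N Mh by linarith+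
        show "0 \<le> N + \<tau>" using \<tau>0 by (simp add: N_def)
      qed simp
      also have "\<dots> \<le> 27 * P / n + 6 * P / n"
      proof (intro add_mono)
        have "n * (27 * N) = 27 * P / n * (P / n)" unfolding NP using n33 by (simp add: field_simps power3_eq_cube)
        also have "\<dots> \<le> 27 * P / n * 1" using P n33 by (intro mult_left_mono) (auto simp: divide_le_eq)
        finally show "n * (27 * N) \<le> 27 * P / n" by simp
        have "28 * N \<le> (6 * P / n)\<^sup>2"
        proof -
          have "28 * N = 28 * (P\<^sup>2 / (real n)\<^sup>2) / n" unfolding NP by (simp add: power2_eq_square power3_eq_cube)
          also have "\<dots> \<le> 36 * (P\<^sup>2 / (real n)\<^sup>2) / 1" using n33 by (intro frac_le mult_right_mono) auto
          also have "\<dots> = (6 * P / n)\<^sup>2" by (simp add: power_divide power_mult_distrib)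
          finally show ?thesis .
        qed
        then show "sqrt (28 * N) \<le> 6 * P / n" using P by (intro real_le_lsqrt) auto
      qed
      also have "\<dots> = P * (33 / n)" by (simp add: add_divide_distrib[symmetric])
      also have "\<dots> \<le> P * 1" using P n33 by (intro mult_left_mono) auto
      finally show "prob (erdos_renyi n p) {E. singular_mod q a E n} \<le> real n powr (- B)"
        by (simp add: P_def)
    qed
  qed
qed

text \<open>
  The interval length \<open>X\<close> is \<open>exp (C1 * ln\<^sup>2 n)\<close>, with \<open>C1\<close> large enough for \<open>exists_large_prime_divisor\<close>; since
  \<open>q\<close> divides a value of size at most \<open>X ^ (2 * K)\<close>, its logarithm is \<open>O(ln\<^sup>2 n)\<close>.
\<close>

lemma eventually_large_prime_divisor:
  fixes K :: nat and b :: real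
  assumes K: "K \<ge> 1" and b: "b > 0"
  shows "\<exists>C2>0. \<forall>\<^sub>F n in sequentially. \<forall>g\<in>bounded_polys K n. \<exists>q a. prime q \<and> odd q
      \<and> real n powr b \<le> real_of_int q \<and> ln (real_of_int q) \<le> C2 * (ln n)\<^sup>2 \<and> q dvd poly g a"
proof -
  \<comment> \<open>With \<open>ln Y \<le> (b + 1) * ln n\<close>, half of \<open>X * ln X\<close> then exceeds \<open>d\<^sup>2 * X * ln Y * (1 + ln Y) + X\<close>; the other
    half absorbs the contribution of the \<open>Y\<close> primes.\<close>
  define C1 where "C1 = 2 * (real K ^ 2 * (b + 2)\<^sup>2 + 1) + 1"
  have C1: "C1 \<ge> 3" by (simp add: C1_def)
  define C2 where "C2 = 2 * real K * (C1 + 1)"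
  have C2: "C2 > 0" using K C1 by (simp add: C2_def)
  have "\<forall>\<^sub>F n::nat in sequentially. ln n \<ge> 1" by real_asymp
  moreover have "\<forall>\<^sub>F n::nat in sequentially. n \<ge> 3" by (rule eventually_ge_at_top)
  moreover have "\<forall>\<^sub>F n::nat in sequentially. ln n \<ge> ln (8 * real K ^ 2) + b"
  proof -
    have "filterlim (\<lambda>n::nat. ln (real n)) at_top sequentially" by real_asymp
    then show ?thesis unfolding filterlim_at_top by (rule spec)
  qed
  ultimately have "\<forall>\<^sub>F n in sequentially. \<forall>g\<in>bounded_polys K n. \<exists>q a. prime q \<and> odd q
      \<and> real n powr b \<le> real_of_int q \<and> ln (real_of_int q) \<le> C2 * (ln n)\<^sup>2 \<and> q dvd poly g a"
  proof eventually_elim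
    case (elim n)
    define x where "x = ln (real n)"
    have x1: "x \<ge> 1" using elim by (simp add: x_def)
    have xx: "x \<le> x\<^sup>2" "1 \<le> x\<^sup>2" using self_le_power[OF x1, of 2] one_le_power[OF x1, of 2] by simp_all
    have n0: "real n > 0" using elim by simp
    then have nx: "real n = exp x" by (simp add: x_def)
    have "ln (8 * real K ^ 2) + b * x \<le> (ln (8 * real K ^ 2) + b) * x"
    proof -
      have "8 * 1 ^ 2 \<le> 8 * real K ^ 2" using K by (intro mult_left_mono power_mono) auto
      then have "0 \<le> ln (8 * real K ^ 2)" by simp
      then have "ln (8 * real K ^ 2) * 1 \<le> ln (8 * real K ^ 2) * x" using x1 by (intro mult_left_mono)
      then show ?thesis by (simp add: distrib_right)
    qed
    also have "\<dots> \<le> x * x" using elim x1 by (intro mult_right_mono) (auto simp: x_def)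
    also have "\<dots> \<le> C1 * x\<^sup>2" using C1 xx by (simp add: power2_eq_square mult_le_cancel_right1)
    finally have "exp (ln (8 * real K ^ 2) + b * x) \<le> exp (C1 * x\<^sup>2)" by simp
    then have big1: "4 * real K ^ 2 * (2 * real n powr b) \<le> exp (C1 * x\<^sup>2)"
      using K n0 by (simp add: exp_add powr_def x_def)
    have "ln 2 + x \<le> x\<^sup>2 + x\<^sup>2" using ln_le_minus_one[of 2] xx by (intro add_mono) auto
    also have "\<dots> \<le> C1 * x\<^sup>2" using C1 xx mult_right_mono[of 2 C1 "x\<^sup>2"] by simp
    finally have "exp (ln 2 + x) \<le> exp (C1 * x\<^sup>2)" by simp
    then have big2: "2 * real n \<le> exp (C1 * x\<^sup>2)" by (simp add: exp_add nx)
    define Y where "Y = nat \<lceil>real n powr b\<rceil>"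
    define X where "X = nat \<lceil>exp (C1 * x\<^sup>2)\<rceil>"
    have nb: "real n powr b > 1" using elim b by (auto intro: gr_one_powr)
    have Y: "real n powr b \<le> Y" "Y \<le> 2 * real n powr b" "Y \<ge> 2"
      unfolding Y_def using nb by linarith+
    have ex1: "1 \<le> exp (C1 * x\<^sup>2)" using C1 by simp
    have X: "exp (C1 * x\<^sup>2) \<le> X" "X \<le> 2 * exp (C1 * x\<^sup>2)" unfolding X_def using ex1 by linarith+
    have X6: "2 * real n \<le> X" "4 * real K ^ 2 * Y \<le> X"
    proof -
      show "2 * real n \<le> X" using big2 X by linarith
      have "4 * real K ^ 2 * Y \<le> 4 * real K ^ 2 * (2 * real n powr b)" using Y by (intro mult_left_mono) auto
      then show "4 * real K ^ 2 * Y \<le> X" using big1 X by linarith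
    qed
    have X3: "real X \<ge> 6" using X6(1) elim by linarith
    have lnX: "C1 * x\<^sup>2 \<le> ln X"
      using X(1) X3 by (subst ln_ge_iff) auto
    have lnX2: "ln X \<le> (C1 + 1) * x\<^sup>2"
    proof -
      have "ln (real X) \<le> ln (2 * exp (C1 * x\<^sup>2))" using X X3 by (intro ln_mono) auto
      also have "\<dots> = ln 2 + C1 * x\<^sup>2" by (simp add: ln_mult)
      also have "\<dots> \<le> x\<^sup>2 + C1 * x\<^sup>2" using ln_le_minus_one[of 2] xx by simp
      finally show ?thesis by (simp add: algebra_simps)
    qed
    have lnY: "0 \<le> ln Y" "ln Y \<le> (b + 1) * x"
    proof -
      show "0 \<le> ln Y" using Y(3) by simp
      have "ln (real Y) \<le> ln (2 * real n powr b)" using Y by (intro ln_mono) auto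
      also have "\<dots> = ln 2 + b * x" using elim by (simp add: ln_mult ln_powr x_def)
      also have "\<dots> \<le> x + b * x" using ln_le_minus_one[of 2] x1 by simp
      finally show "ln Y \<le> (b + 1) * x" by (simp add: algebra_simps)
    qed
    define G where "G = (2 * real n + X) ^ K"
    have GX: "G \<le> real X ^ (2 * K)"
    proof -
      have "2 * real n + X \<le> 2 * real X" using X6 by linarith
      also have "\<dots> \<le> real X * real X" using X3 by (intro mult_right_mono) auto
      finally have "G \<le> (real X * real X) ^ K" unfolding G_def by (intro power_mono) auto
      then show ?thesis by (simp add: power_mult power2_eq_square)
    qed
    have G0: "G > 0" unfolding G_def using X3 by simp
    have lnG: "ln G \<le> 2 * K * ln X"
    proof -
      have "ln G \<le> ln (real X ^ (2 * K))" using GX G0 by (intro ln_mono) auto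
      also have "\<dots> = 2 * K * ln X" by (simp add: ln_realpow)
      finally show ?thesis .
    qed
    show ?case
    proof
      fix g assume g: "g \<in> bounded_polys K n"
      define d where "d = degree g"
      have d: "1 \<le> d" "d \<le> K" and lead: "lead_coeff g = 1" using g by (auto simp: bounded_polys_def d_def)
      have ineq: "Y * d * ln G + real d ^ 2 * X * (ln Y * (1 + ln Y)) < X * ln X - X"
      proof -
        have lX: "ln X > 0" using X3 by simp
        have "Y * d * ln G \<le> Y * d * (2 * K * ln X)" using lnG by (intro mult_left_mono) auto
        also have "\<dots> \<le> Y * K * (2 * K * ln X)" using d lX by (intro mult_right_mono) (auto intro!: mult_left_mono)
        also have "\<dots> = (4 * real K ^ 2 * Y) * ln X / 2" by (simp add: power2_eq_square)
        also have "\<dots> \<le> X * ln X / 2" using X6(2) lX by (intro divide_right_mono mult_right_mono) auto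
        finally have 1: "Y * d * ln G \<le> X * ln X / 2" .
        have "ln Y * (1 + ln Y) \<le> ((b + 2) * x) * ((b + 2) * x)"
          using lnY x1 b by (intro mult_mono) (auto simp: algebra_simps)
        then have yy: "ln Y * (1 + ln Y) \<le> (b + 2)\<^sup>2 * x\<^sup>2" by (simp add: power2_eq_square algebra_simps)
        have "real d ^ 2 * X * (ln Y * (1 + ln Y)) \<le> real K ^ 2 * X * ((b + 2)\<^sup>2 * x\<^sup>2)"
        proof (rule mult_mono[OF _ yy])
          show "real d ^ 2 * X \<le> real K ^ 2 * X" using d by (intro mult_right_mono power_mono) auto
        qed (use lnY(1) in auto)
        then have "real d ^ 2 * X * (ln Y * (1 + ln Y)) + X \<le> X * (real K ^ 2 * (b + 2)\<^sup>2 * x\<^sup>2 + 1)"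
          by (simp add: algebra_simps)
        also have "\<dots> \<le> X * ((real K ^ 2 * (b + 2)\<^sup>2 + 1) * x\<^sup>2)"
          using xx by (intro mult_left_mono) (auto simp: distrib_right)
        also have "\<dots> < X * (ln X / 2)"
        proof (intro mult_strict_left_mono)
          have "C1 * x\<^sup>2 = 2 * ((real K ^ 2 * (b + 2)\<^sup>2 + 1) * x\<^sup>2) + x\<^sup>2"
            by (simp add: C1_def algebra_simps)
          then have "2 * ((real K ^ 2 * (b + 2)\<^sup>2 + 1) * x\<^sup>2) < C1 * x\<^sup>2" using xx by linarith
          then show "(real K ^ 2 * (b + 2)\<^sup>2 + 1) * x\<^sup>2 < ln X / 2" using lnX by linarith
        qed (use X3 in auto)
        finally show ?thesis using 1 by linarith
      qed
      have "\<exists>q i. prime q \<and> q > int Y \<and> i \<in> {1..X} \<and> q dvd poly g (int (n + i))"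
      proof (rule exists_large_prime_divisor[OF lead _ d(1)])
        show "degree g = d" by (simp add: d_def)
        show "X \<ge> 1" using X3 by linarith
        show "Y \<ge> 2" by (rule Y(3))
        show "real (Y * d) * ln G + (real d)\<^sup>2 * real X * (ln (real Y) * (1 + ln (real Y))) < real X * ln (real X) - real X"
          using ineq by simp
        fix i assume "i \<in> {1..X}"
        then show "int i \<le> poly g (int (n + i)) \<and> real_of_int (poly g (int (n + i))) \<le> G"
          using bounded_polys_values[OF g] unfolding G_def by blast
      qed
      then obtain q i where qi: "prime q" "q > int Y" "i \<in> {1..X}" "q dvd poly g (int (n + i))" by blast
      have vals: "int i \<le> poly g (int (n + i))" "real_of_int (poly g (int (n + i))) \<le> G"
        using bounded_polys_values[OF g qi(3)] unfolding G_def by auto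
      have "odd q" using qi Y(3) prime_odd_int[of q] by linarith
      moreover have "real n powr b \<le> real_of_int q" using Y(1) qi(2) by linarith
      moreover have "ln (real_of_int q) \<le> C2 * x\<^sup>2"
      proof -
        have "q \<le> poly g (int (n + i))" using vals(1) qi by (intro zdvd_imp_le) auto
        then have "real_of_int q \<le> G" using vals(2) by linarith
        then have "ln (real_of_int q) \<le> ln G" using qi(2) by (intro ln_mono) auto
        also have "\<dots> \<le> 2 * K * ln X" by (rule lnG)
        also have "\<dots> \<le> 2 * K * ((C1 + 1) * x\<^sup>2)" using lnX2 by (intro mult_left_mono) auto
        finally show ?thesis by (simp only: C2_def mult.assoc)
      qed
      ultimately show "\<exists>q a. prime q \<and> odd q \<and> real n powr b \<le> real_of_int q
          \<and> ln (real_of_int q) \<le> C2 * (ln n)\<^sup>2 \<and> q dvd poly g a"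
        using qi(1,4) unfolding x_def by blast
    qed
  qed
  then show ?thesis using C2 by blast
qed

theorem theorem3p9:
  fixes p B K :: real
  assumes "0 < p" and "p < 1" and "B > 0" and "K \<ge> 1"
  shows "\<forall>\<^sub>F n in sequentially.
           measure_pmf.prob (erdos_renyi n p)
             {E. \<exists>\<mu>. eigenvalue (adjacency_matrix n E) \<mu> \<and>
                     algebraic \<mu> \<and> real (algebraic_degree \<mu>) \<le> K}
           \<le> real n powr (- B)"
proof -
  define k where "k = nat \<lfloor>K\<rfloor>"
  have k: "k \<ge> 1" "\<And>d::nat. real d \<le> K \<Longrightarrow> d \<le> k" using assms(4) by (auto simp: k_def le_nat_floor le_floor_iff)
  \<comment> \<open>There are at most \<open>n ^ r\<close> polynomials to consider.\<close>
  define r where "r = (2 * k + 2) * (k + 1)"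
  define B0 where "B0 = B + r"
  have B0: "B0 > 0" using assms(3) by (simp add: B0_def)
  obtain C2 where C2: "C2 > 0" and ev: "\<forall>\<^sub>F n in sequentially. \<forall>g\<in>bounded_polys k n. \<exists>q a. prime q \<and> odd q
      \<and> real n powr (2 * B0 + 3) \<le> real_of_int q \<and> ln (real_of_int q) \<le> C2 * (ln n)\<^sup>2 \<and> q dvd poly g a"
    using eventually_large_prime_divisor[OF k(1), of "2 * B0 + 3"] B0 by auto
  have "\<forall>\<^sub>F n::nat in sequentially. n \<ge> 2" by (rule eventually_ge_at_top)
  with ev eventually_prob_singular_mod[OF assms(1,2) B0 C2] show ?thesis
  proof eventually_elim
    case (elim n)
    let ?bad = "{E. \<exists>\<mu>. eigenvalue (adjacency_matrix n E) \<mu> \<and> algebraic \<mu> \<and> real (algebraic_degree \<mu>) \<le> K}"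
    have "\<forall>g\<in>bounded_polys k n. \<exists>qa. measure_pmf.prob (erdos_renyi n p) {E. singular_mod (fst qa) (snd qa) E n}
        \<le> real n powr (- B0) \<and> prime (fst qa) \<and> fst qa dvd poly g (snd qa)"
    proof
      fix g assume "g \<in> bounded_polys k n"
      then obtain q a where "prime q" "odd q" "real n powr (2 * B0 + 3) \<le> real_of_int q"
        "ln (real_of_int q) \<le> C2 * (ln n)\<^sup>2" "q dvd poly g a" using elim(1) by blast
      moreover from this have "measure_pmf.prob (erdos_renyi n p) {E. singular_mod q a E n} \<le> real n powr (- B0)"
        using elim(2) by blast
      ultimately show "\<exists>qa. measure_pmf.prob (erdos_renyi n p) {E. singular_mod (fst qa) (snd qa) E n}
          \<le> real n powr (- B0) \<and> prime (fst qa) \<and> fst qa dvd poly g (snd qa)"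
        by (intro exI[of _ "(q, a)"]) simp
    qed
    from bchoice[OF this] obtain f where f: "\<forall>g\<in>bounded_polys k n.
        measure_pmf.prob (erdos_renyi n p) {E. singular_mod (fst (f g)) (snd (f g)) E n} \<le> real n powr (- B0)
        \<and> prime (fst (f g)) \<and> fst (f g) dvd poly g (snd (f g))" ..
    define q where "q = fst \<circ> f"
    define a where "a = snd \<circ> f"
    have qa: "\<And>g. g \<in> bounded_polys k n \<Longrightarrow>
        measure_pmf.prob (erdos_renyi n p) {E. singular_mod (q g) (a g) E n} \<le> real n powr (- B0)"
      "\<And>g. g \<in> bounded_polys k n \<Longrightarrow> prime (q g) \<and> q g dvd poly g (a g)"
      using f by (simp_all add: q_def a_def)
    have "?bad \<subseteq> (\<Union>g\<in>bounded_polys k n. {E. singular_mod (q g) (a g) E n})"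
    proof
      fix E assume "E \<in> ?bad"
      then obtain \<mu> where \<mu>: "eigenvalue (adjacency_matrix n E) \<mu>" "algebraic \<mu>" "algebraic_degree \<mu> \<le> k"
        using k(2) by blast
      obtain g where g: "g \<in> bounded_polys k n" "g dvd char_poly (int_adjacency n E)"
        using low_degree_eigenvalue_factor[OF \<mu>] by blast
      have "poly g (a g) dvd poly (char_poly (int_adjacency n E)) (a g)" using g(2) by (auto elim!: dvdE)
      then have "q g dvd poly (char_poly (int_adjacency n E)) (a g)" using qa(2)[OF g(1)] dvd_trans by blast
      then show "E \<in> (\<Union>g\<in>bounded_polys k n. {E. singular_mod (q g) (a g) E n})"
        using singular_mod_if_dvd_det qa(2)[OF g(1)] g(1) by blast
    qed
    then have "measure_pmf.prob (erdos_renyi n p) ?bad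
        \<le> measure_pmf.prob (erdos_renyi n p) (\<Union>g\<in>bounded_polys k n. {E. singular_mod (q g) (a g) E n})"
      by (intro measure_pmf.finite_measure_mono) auto
    also have "\<dots> \<le> (\<Sum>g\<in>bounded_polys k n. measure_pmf.prob (erdos_renyi n p) {E. singular_mod (q g) (a g) E n})"
      using finite_card_bounded_polys(1) by (intro measure_pmf.finite_measure_subadditive_finite) auto
    also have "\<dots> \<le> (\<Sum>g\<in>bounded_polys k n. real n powr (- B0))" by (intro sum_mono qa(1))
    also have "\<dots> = card (bounded_polys k n) * real n powr (- B0)" by simp
    also have "\<dots> \<le> real n ^ r * real n powr (- B0)"
    proof (intro mult_right_mono)
      have n2: "n \<ge> 2" using elim by simp
      have "n + 1 \<le> n ^ 2"
      proof -
        have "n + 1 \<le> 2 * n" using n2 by simp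
        also have "\<dots> \<le> n * n" using n2 by (intro mult_right_mono) auto
        finally show ?thesis by (simp add: power2_eq_square)
      qed
      then have "(n + 1) ^ k \<le> (n ^ 2) ^ k" by (intro power_mono) auto
      then have "2 * (n + 1) ^ k + 1 \<le> 2 * n ^ (2 * k) + n ^ (2 * k)"
        using n2 by (intro add_mono) (auto simp: power_mult)
      also have "\<dots> \<le> n ^ 2 * n ^ (2 * k)"
      proof -
        have "2 ^ 2 \<le> n ^ 2" using n2 by (intro power_mono) auto
        then have "3 * n ^ (2 * k) \<le> n ^ 2 * n ^ (2 * k)" by (intro mult_right_mono) auto
        then show ?thesis by simp
      qed
      also have "\<dots> = n ^ (2 * k + 2)" by (simp add: power_add power2_eq_square)
      finally have "(2 * (n + 1) ^ k + 1) ^ (k + 1) \<le> (n ^ (2 * k + 2)) ^ (k + 1)" by (intro power_mono) auto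
      then have "card (bounded_polys k n) \<le> n ^ r"
        unfolding r_def power_mult using finite_card_bounded_polys(2)[of k n] by linarith
      then have "real (card (bounded_polys k n)) \<le> real (n ^ r)" by (rule of_nat_mono)
      then show "real (card (bounded_polys k n)) \<le> real n ^ r" by (simp only: of_nat_power)
    qed simp
    also have "\<dots> = real n powr (- B)"
    proof -
      have "real n > 0" using elim(3) by simp
      then have "real n ^ r = real n powr r" by (rule powr_realpow[symmetric])
      then show ?thesis by (simp only: powr_add[symmetric]) (simp add: B0_def)
    qed
    finally show ?case .
  qed
qed

end
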